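(* Let $h \in K(t)$ be such that $v_\infty(h) \geq -2$ and $v_t(h) = 0$. Then there exists $c \in K$ such that, with $f := h + c t^2$, both quadratic forms $\langle 1,\pi\rangle \otimes \langle 1, -\gamma, -t, -f\rangle$ and $\langle 1,\pi\rangle \otimes \langle 1, -\gamma, -t, -\gamma f\rangle$ are isotropic over $K(t)$.
   Context: $K$ is a p-adic field (finite extension of some $\mathbb{Q}_p$) with fixed uniformizer $\pi$, and $\gamma \in K^*$ is fixed such that $\langle 1,\pi\rangle \otimes \langle 1,-\gamma\rangle$ is anisotropic over $K$. $v_t$ is the $t$-adic valuation on $K(t)$ and $v_\infty$ is the valuation at infinity ($v_\infty(p/q) = \deg q - \deg p$). *)

theory Defs
  imports Complex_Main
    "HOL-Computational_Algebra.Computational_Algebra"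
    "HOL-Library.Extended"
begin

section \<open>p-adic fields\<close>

definition padic_abs :: "nat \<Rightarrow> rat \<Rightarrow> real" where
  "padic_abs p x =
     (if x = 0 then 0
      else real p powi (int (multiplicity (int p) (snd (quotient_of x)))
                        - int (multiplicity (int p) (fst (quotient_of x)))))"

definition nonarch_abs :: "('a::field \<Rightarrow> real) \<Rightarrow> bool" where
  "nonarch_abs N \<longleftrightarrow>
     (\<forall>x. 0 \<le> N x) \<and> (\<forall>x. N x = 0 \<longleftrightarrow> x = 0) \<and>
     (\<forall>x y. N (x * y) = N x * N y) \<and> (\<forall>x y. N (x + y) \<le> max (N x) (N y))"

definition is_subfield :: "'a::field set \<Rightarrow> bool" where
  "is_subfield F \<longleftrightarrow>
     0 \<in> F \<and> 1 \<in> F \<and>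
     (\<forall>x\<in>F. \<forall>y\<in>F. x + y \<in> F \<and> x * y \<in> F) \<and> (\<forall>x\<in>F. - x \<in> F \<and> inverse x \<in> F)"

definition complete_wrt :: "('a::field \<Rightarrow> real) \<Rightarrow> 'a set \<Rightarrow> bool" where
  "complete_wrt N F \<longleftrightarrow>
     (\<forall>X::nat \<Rightarrow> 'a. range X \<subseteq> F \<longrightarrow>
        (\<forall>e>0. \<exists>M. \<forall>m\<ge>M. \<forall>n\<ge>M. N (X m - X n) < e) \<longrightarrow>
        (\<exists>L\<in>F. (\<lambda>n. N (X n - L)) \<longlonglongrightarrow> 0))"

text \<open>
  The field \<open>\<rat>\<^sub>p\<close> is the completion of \<open>\<rat>\<close> with respect to the p-adic absolute value, up to
  isomorphism of valued fields.  The following says that the subfield \<open>F\<close>, with the absolute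
  value \<open>N\<close> restricted to it, is such a completion.
\<close>

definition is_Qp :: "nat \<Rightarrow> ('a::field_char_0 \<Rightarrow> real) \<Rightarrow> 'a set \<Rightarrow> bool" where
  "is_Qp p N F \<longleftrightarrow>
     is_subfield F \<and>
     (\<forall>r. N (of_rat r) = padic_abs p r) \<and>
     (\<forall>x\<in>F. \<forall>e>0. \<exists>r::rat. N (x - of_rat r) < e) \<and>
     complete_wrt N F"

definition finite_over :: "'a::field set \<Rightarrow> bool" where
  "finite_over F \<longleftrightarrow>
     (\<exists>B::'a set. finite B \<and> (\<forall>x. \<exists>c. c ` B \<subseteq> F \<and> x = (\<Sum>b\<in>B. c b * b)))"

text \<open>
  The whole type \<open>'a\<close> is a finite extension of \<open>\<rat>\<^sub>p\<close>, and \<open>N\<close> is the (unique) extension of the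
  p-adic absolute value to it.
\<close>

definition padic_field :: "nat \<Rightarrow> ('a::field_char_0 \<Rightarrow> real) \<Rightarrow> bool" where
  "padic_field p N \<longleftrightarrow> prime p \<and> nonarch_abs N \<and> (\<exists>F. is_Qp p N F \<and> finite_over F)"

text \<open>A uniformizer generates the maximal ideal of the valuation ring \<open>{x. N x \<le> 1}\<close>.\<close>

definition uniformizer :: "('a::field \<Rightarrow> real) \<Rightarrow> 'a \<Rightarrow> bool" where
  "uniformizer N u \<longleftrightarrow> {x. N x < 1} = {u * y | y. N y \<le> 1}"

section \<open>The rational function field and two of its valuations\<close>

text \<open>The field \<open>K(t)\<close> is \<^typ>\<open>'a poly fract\<close>, where \<open>K\<close> is the type \<open>'a\<close>.\<close>

definition ratf_const :: "'a::field \<Rightarrow> 'a poly fract" where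
  "ratf_const c = Fract [:c:] 1"

definition ratf_t :: "'a::field poly fract" where
  "ratf_t = Fract [:0, 1:] 1"

text \<open>
  Both definitions are independent of the representation of \<open>h\<close> as a fraction, as the two lemmas
  following them show.
\<close>

definition val_t :: "'a::field poly fract \<Rightarrow> int extended" where
  "val_t h = (if h = 0 then \<infinity> else
     (THE v. \<exists>p q. p \<noteq> 0 \<and> q \<noteq> 0 \<and> h = Fract p q \<and>
                   v = Fin (int (order 0 p) - int (order 0 q))))"

definition val_inf :: "'a::field poly fract \<Rightarrow> int extended" where
  "val_inf h = (if h = 0 then \<infinity> else
     (THE v. \<exists>p q. p \<noteq> 0 \<and> q \<noteq> 0 \<and> h = Fract p q \<and>
                   v = Fin (int (degree q) - int (degree p))))"

lemma val_t_Fract: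
  assumes "q \<noteq> 0"
  shows "val_t (Fract p q) =
     (if p = 0 then \<infinity> else Fin (int (order 0 p) - int (order 0 q)))"
proof (cases "p = 0")
  case True
  thus ?thesis by (simp add: val_t_def fract_collapse)
next
  case False
  have nz: "Fract p q \<noteq> 0"
    using False assms by (simp add: Zero_fract_def eq_fract)
  have "order 0 p' + order 0 q = order 0 p + order 0 q'"
    if "p' \<noteq> 0" "q' \<noteq> 0" "Fract p q = Fract p' q'" for p' q' :: "'a poly"
  proof -
    have "p * q' = p' * q"
      using that assms by (simp add: eq_fract)
    thus ?thesis
      using that assms False order_mult[of p q' 0] order_mult[of p' q 0] by simp
  qed
  note eq = this
  have uniq: "int (order 0 p') - int (order 0 q') = int (order 0 p) - int (order 0 q)"
    if "p' \<noteq> 0" "q' \<noteq> 0" "Fract p q = Fract p' q'" for p' q' :: "'a poly"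
    using eq[OF that] by linarith
  show ?thesis
    using nz False assms uniq unfolding val_t_def
    by (simp only: if_False) (rule the_equality, blast, metis)
qed

lemma val_inf_Fract:
  assumes "q \<noteq> 0"
  shows "val_inf (Fract p q) =
     (if p = 0 then \<infinity> else Fin (int (degree q) - int (degree p)))"
proof (cases "p = 0")
  case True
  thus ?thesis by (simp add: val_inf_def fract_collapse)
next
  case False
  have nz: "Fract p q \<noteq> 0"
    using False assms by (simp add: Zero_fract_def eq_fract)
  have "degree p' + degree q = degree p + degree q'"
    if "p' \<noteq> 0" "q' \<noteq> 0" "Fract p q = Fract p' q'" for p' q' :: "'a poly"
  proof -
    have "p * q' = p' * q"
      using that assms by (simp add: eq_fract)
    thus ?thesis
      using that assms False degree_mult_eq[of p q'] degree_mult_eq[of p' q] by simp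
  qed
  note eq = this
  have uniq: "int (degree q') - int (degree p') = int (degree q) - int (degree p)"
    if "p' \<noteq> 0" "q' \<noteq> 0" "Fract p q = Fract p' q'" for p' q' :: "'a poly"
    using eq[OF that] by linarith
  show ?thesis
    using nz False assms uniq unfolding val_inf_def
    by (simp only: if_False) (rule the_equality, blast, metis)
qed

section \<open>Diagonal quadratic forms\<close>

text \<open>
  The list \<open>[a\<^sub>1, \<dots>, a\<^sub>n]\<close> stands for the form \<open>\<langle>a\<^sub>1, \<dots>, a\<^sub>n\<rangle>\<close>, i.e. for
  \<open>a\<^sub>1 x\<^sub>1\<^sup>2 + \<dots> + a\<^sub>n x\<^sub>n\<^sup>2\<close>, over the field that is the type of its entries.
\<close>

definition diag_form :: "'k::field list \<Rightarrow> 'k list \<Rightarrow> 'k" where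
  "diag_form as xs = (\<Sum>i<length as. as ! i * (xs ! i)\<^sup>2)"

definition isotropic :: "'k::field list \<Rightarrow> bool" where
  "isotropic as \<longleftrightarrow>
     (\<exists>xs. length xs = length as \<and> (\<exists>x\<in>set xs. x \<noteq> 0) \<and> diag_form as xs = 0)"

abbreviation anisotropic :: "'k::field list \<Rightarrow> bool" where
  "anisotropic as \<equiv> \<not> isotropic as"

definition form_tensor :: "'k::field list \<Rightarrow> 'k list \<Rightarrow> 'k list"  (infixl "\<otimes>\<^sub>q" 70) where
  "as \<otimes>\<^sub>q bs = [a * b. a \<leftarrow> as, b \<leftarrow> bs]"

end

theory Submission
  imports Defs
begin

text \<open>
  Write \<open>h = P / Q\<close> with \<open>P(0)\<close> and \<open>Q(0)\<close> nonzero, let \<open>m = t Q\<close>, \<open>\<kappa> = \<pi> h(0)\<close> and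
  \<open>c = 1 / (\<kappa> \<sigma>\<^sup>2)\<close> for a small constant \<open>\<sigma>\<close>, and let \<open>\<alpha> \<in> {1, \<gamma>}\<close>.  It suffices to choose
  polynomials \<open>A, B\<close> such that
  \<open>\<alpha> f Q\<^sup>2 + t (A\<^sup>2 + \<pi> B\<^sup>2)\<close> is a value of the quaternion norm \<open>\<langle>1, \<pi>\<rangle> \<otimes> \<langle>1, - \<gamma>\<rangle>\<close>.  That norm
  is multiplicative and universal over \<open>K\<close>, so one may rescale by \<open>\<kappa> \<sigma>\<^sup>2 / \<alpha>\<close>, which turns the
  expression into a small perturbation
  \<open>m\<^sup>2 + \<sigma>\<^sup>2 (\<kappa> P Q + (\<kappa> / \<alpha>) t (A\<^sup>2 + \<pi> B\<^sup>2))\<close> of the square \<open>m\<^sup>2\<close>.  Looking for a quaternion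
  of the shape \<open>(m + \<sigma>\<^sup>2 x) + \<sigma> \<eta>\<close> with \<open>\<eta>\<close> pure leads to the equation
  \<open>2 m x + \<Psi>(\<eta>, A, B) + \<sigma>\<^sup>2 x\<^sup>2 = \<kappa> P Q\<close> for a quinary form \<open>\<Psi>\<close>.  For small \<open>\<sigma>\<close> it is
  solved by a contraction on polynomials of bounded degree, starting from a smooth solution of
  \<open>\<Psi> \<equiv> \<kappa> P Q\<close> modulo \<open>m\<close>.  By the Chinese remainder theorem and Hensel lifting such a solution
  exists as soon as \<open>\<Psi>\<close> is isotropic over \<open>K[t] / (q)\<close> for every irreducible factor \<open>q\<close> of
  \<open>Q\<close>, and that is a local field, over which every quinary form is isotropic.
\<close>

section \<open>Ultrametric norms\<close>

text \<open>\<open>K(t)\<close> is not complete, so the perturbation of \<open>m\<^sup>2\<close> has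
  to be solved inside a finite-dimensional space of polynomials over \<open>K\<close>. The bound on
  \<open>val_inf h\<close> gives \<open>degree (P * Q) \<le> 2 * degree m\<close>, which keeps the
  right-hand side in that space. The constant \<kappa> is chosen so that \<open>\<kappa> P Q\<close>
  takes the value \<open>\<pi> P(0)\<^sup>2\<close> at zero, a value of the entry \<pi> of \<Psi>.
  At the factors of \<open>Q\<close> the right-hand side vanishes, so that isotropy is all one needs
  there. Any sufficiently small \<sigma> works, hence one \<sigma>, and with it one
  \<open>c\<close>, serves both values of \<alpha>. Isotropy of quinary forms is shown for
  \<open>K\<close> and for \<open>K[t] / (q)\<close> at once and must cover residue characteristic
  2, where lattices need not have orthogonal bases. An anisotropic form \<open>q\<close> makes the
  square root of \<open>\<nu> (q v)\<close> an ultrametric norm, and each quotient of consecutive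
  lattices has dimension at most 2 over the residue field. All facts about local fields are drawn
  from completeness and total boundedness; the valuation of \<open>K[t] / (q)\<close> is the
  spectral radius of a norm on remainders.\<close>

lemma LIMSEQ_0_less:
  fixes X :: "nat \<Rightarrow> real"
  assumes "X \<longlonglongrightarrow> 0" "0 < e"
  obtains M where "\<And>n. n \<ge> M \<Longrightarrow> X n < e"
  using order_tendstoD(2)[OF assms] by (auto simp: eventually_sequentially)

text \<open>Nonzero elements may have size 0, so that a quotient ring can be studied through a
  seminorm on the ring itself.\<close>

locale ultranorm =
  fixes s :: "'r::ab_group_add \<Rightarrow> real"
  assumes nonneg [simp]: "0 \<le> s x"
    and zero [simp]: "s 0 = 0"
    and diff: "s (x - y) \<le> max (s x) (s y)"
begin

lemma minus [simp]: "s (- x) = s x"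
  using diff[of 0 x] diff[of 0 "- x"] nonneg[of x] nonneg[of "- x"] by simp

lemma add: "s (x + y) \<le> max (s x) (s y)"
  using diff[of x "- y"] by simp

lemma diff_commute: "s (x - y) = s (y - x)"
  using minus[of "x - y"] by simp

lemma add_le: "s x \<le> B \<Longrightarrow> s y \<le> B \<Longrightarrow> s (x + y) \<le> B"
  using add[of x y] by simp

lemma add_less: "s x < B \<Longrightarrow> s y < B \<Longrightarrow> s (x + y) < B"
  using add[of x y] by simp

lemma diff_le: "s x \<le> B \<Longrightarrow> s y \<le> B \<Longrightarrow> s (x - y) \<le> B"
  using diff[of x y] by simp

lemma diff_less: "s x < B \<Longrightarrow> s y < B \<Longrightarrow> s (x - y) < B"
  using diff[of x y] by simp

lemma diff_trans_less: "s (x - y) < B \<Longrightarrow> s (y - z) < B \<Longrightarrow> s (x - z) < B"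
  using add_less[of "x - y" B "y - z"] by simp

lemma diff_trans_le: "s (x - y) \<le> B \<Longrightarrow> s (y - z) \<le> B \<Longrightarrow> s (x - z) \<le> B"
  using add_le[of "x - y" B "y - z"] by simp

lemma eq_if_diff_less: "s (x - y) < s x \<Longrightarrow> s y = s x"
  using diff[of x "x - y"] add[of "x - y" y] by (auto simp: max_def split: if_splits)

lemma sum_le:
  assumes "\<And>i. i \<in> A \<Longrightarrow> s (f i) \<le> B" and "0 \<le> B"
  shows "s (sum f A) \<le> B"
  using assms by (induction A rule: infinite_finite_induct) (auto intro: add_le)

lemma eq_if_diff_zero: "s (x - y) = 0 \<Longrightarrow> s x = s y"
  using add[of "x - y" y] add[of "y - x" x] nonneg[of x] nonneg[of y]
  by (simp add: diff_commute max_def split: if_splits)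

definition cauchy :: "(nat \<Rightarrow> 'r) \<Rightarrow> bool" where
  "cauchy X \<longleftrightarrow> (\<forall>e>0. \<exists>M. \<forall>m\<ge>M. \<forall>n\<ge>M. s (X m - X n) < e)"

definition complete_on :: "'r set \<Rightarrow> bool" where
  "complete_on W \<longleftrightarrow>
     (\<forall>X. range X \<subseteq> W \<longrightarrow> cauchy X \<longrightarrow> (\<exists>L\<in>W. (\<lambda>n. s (X n - L)) \<longlonglongrightarrow> 0))"

text \<open>Total boundedness of every ball of \<open>W\<close>; together with completeness it
  stands in for local compactness. The centres may lie outside \<open>W\<close>.\<close>

definition totally_bounded_on :: "'r set \<Rightarrow> bool" where
  "totally_bounded_on W \<longleftrightarrow>
     (\<forall>r. \<forall>e>0. \<exists>T. finite T \<and> (\<forall>x\<in>W. s x \<le> r \<longrightarrow> (\<exists>t\<in>T. s (x - t) < e)))"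

lemma complete_onD:
  assumes "complete_on W" "\<And>n. X n \<in> W" "cauchy X"
  obtains L where "L \<in> W" "(\<lambda>n. s (X n - L)) \<longlonglongrightarrow> 0"
  using assms unfolding complete_on_def by (meson image_subsetI)

lemma totally_bounded_onD:
  assumes "totally_bounded_on W" "e > 0"
  obtains T where "finite T" "\<And>x. x \<in> W \<Longrightarrow> s x \<le> r \<Longrightarrow> \<exists>t\<in>T. s (x - t) < e"
proof -
  have "\<exists>T. finite T \<and> (\<forall>x\<in>W. s x \<le> r \<longrightarrow> (\<exists>t\<in>T. s (x - t) < e))"
    using assms by (simp add: totally_bounded_on_def)
  then show ?thesis
    using that by (elim exE conjE) simp
qed

lemma cauchy_if_Suc:
  assumes "(\<lambda>n. s (X (Suc n) - X n)) \<longlonglongrightarrow> 0"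
  shows "cauchy X"
  unfolding cauchy_def
proof (intro allI impI)
  fix e :: real assume "e > 0"
  then obtain M where M: "\<And>n. n \<ge> M \<Longrightarrow> s (X (Suc n) - X n) < e"
    using LIMSEQ_0_less[OF assms] by blast
  have *: "s (X n - X M) < e" if "n \<ge> M" for n
    using that
  proof (induction n rule: dec_induct)
    case base
    then show ?case using \<open>e > 0\<close> by simp
  next
    case (step n)
    then show ?case using M[of n] diff_trans_less by blast
  qed
  show "\<exists>M. \<forall>m\<ge>M. \<forall>n\<ge>M. s (X m - X n) < e"
    using * diff_trans_less diff_commute by (metis)
qed

text \<open>Increments tending to zero already make the iterates Cauchy in an ultrametric. The limit
  is fixed only up to an element of size 0, as \<open>s\<close> is a seminorm.\<close>

lemma contraction_fixpoint:
  assumes W: "complete_on W" "x0 \<in> W" "\<And>x. x \<in> W \<Longrightarrow> T x \<in> W"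
    and c: "0 \<le> c" "c < 1"
    and T: "\<And>x y. x \<in> W \<Longrightarrow> y \<in> W \<Longrightarrow> s (T x - T y) \<le> c * s (x - y)"
  shows "\<exists>x\<in>W. s (T x - x) = 0"
proof -
  define X where "X n = (T ^^ n) x0" for n
  have X: "X n \<in> W" for n
    by (induction n) (use W in \<open>auto simp: X_def\<close>)
  have step: "s (X (Suc n) - X n) \<le> c ^ n * s (X 1 - X 0)" for n
  proof (induction n)
    case (Suc n)
    have "s (X (Suc (Suc n)) - X (Suc n)) \<le> c * s (X (Suc n) - X n)"
      using T[OF X[of "Suc n"] X[of n]] by (simp add: X_def)
    also have "\<dots> \<le> c * (c ^ n * s (X 1 - X 0))"
      using Suc c by (intro mult_left_mono)
    finally show ?case by simp
  qed simp
  have lim: "(\<lambda>n. s (X (Suc n) - X n)) \<longlonglongrightarrow> 0"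
  proof (rule real_tendsto_sandwich[of "\<lambda>_. 0" _ _ "\<lambda>n. c ^ n * s (X 1 - X 0)"])
    show "(\<lambda>n. c ^ n * s (X 1 - X 0)) \<longlonglongrightarrow> 0"
      using LIMSEQ_realpow_zero[OF c] by (intro tendsto_mult_left_zero)
  qed (use step in auto)
  obtain L where L: "L \<in> W" "(\<lambda>n. s (X n - L)) \<longlonglongrightarrow> 0"
    using complete_onD[OF W(1) X cauchy_if_Suc[OF lim]] by blast
  have "s (T L - L) \<le> e" if "e > 0" for e
  proof -
    obtain M where M: "\<And>n. n \<ge> M \<Longrightarrow> s (X n - L) < e"
      using LIMSEQ_0_less[OF L(2) \<open>e > 0\<close>] by blast
    have "s (T L - X (Suc M)) \<le> c * s (L - X M)"
      using T[OF L(1) X[of M]] by (simp add: X_def)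
    also have "\<dots> \<le> 1 * e"
      using M[of M] c by (intro mult_mono) (auto simp: diff_commute)
    finally show ?thesis
      using M[of "Suc M"] diff_trans_le[of "T L" "X (Suc M)" e L] by simp
  qed
  then have "s (T L - L) \<le> 0"
    by (metis dense not_le order_less_imp_le)
  then show ?thesis
    using L(1) nonneg[of "T L - L"] by (intro bexI[of _ L]) auto
qed

text \<open>Bolzano-Weierstrass: by pigeonhole an infinite index set contains an infinite one on
  which \<open>X\<close> varies by less than \<open>e\<close>, and a diagonal choice from nested
  index sets is Cauchy.\<close>

lemma cluster_point:
  assumes W: "complete_on W" "totally_bounded_on W"
    and X: "\<And>k. X k \<in> W" "\<And>k. s (X k) \<le> r"
  shows "\<exists>L\<in>W. \<forall>e>0. \<forall>n::nat. \<exists>k\<ge>n. s (X k - L) < e"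
proof -
  have step: "\<exists>J. infinite J \<and> J \<subseteq> I \<and> (\<forall>k\<in>J. \<forall>l\<in>J. s (X k - X l) < e)"
    if "infinite I" "e > 0" for I :: "nat set" and e
  proof -
    obtain T where T: "finite T" "\<And>x. x \<in> W \<Longrightarrow> s x \<le> r \<Longrightarrow> \<exists>t\<in>T. s (x - t) < e"
      using totally_bounded_onD[OF W(2) \<open>e > 0\<close>] by metis
    have "\<forall>k. \<exists>t. t \<in> T \<and> s (X k - t) < e"
      using T(2) X by blast
    then obtain t where t: "\<And>k. t k \<in> T" "\<And>k. s (X k - t k) < e"
      by metis
    have "finite (t ` I)"
      using T(1) t(1) by (meson finite_subset image_subsetI)
    then obtain k where k: "k \<in> I" "infinite {l \<in> I. t l = t k}"
      using pigeonhole_infinite[OF \<open>infinite I\<close>] by blast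
    have "s (X i - X j) < e" if "t i = t k" "t j = t k" for i j
      using t(2)[of i] t(2)[of j] that diff_trans_less diff_commute by metis
    then show ?thesis
      using k by (intro exI[of _ "{l \<in> I. t l = t k}"]) auto
  qed
  define e where "e n = inverse (real (Suc n))" for n
  have e: "e n > 0" for n by (simp add: e_def)
  have "\<exists>I. \<forall>n. infinite (I n) \<and> I (Suc n) \<subseteq> I n \<and>
      (\<forall>k\<in>I (Suc n). \<forall>l\<in>I (Suc n). s (X k - X l) < e n)"
  proof (rule dependent_nat_choice[of "\<lambda>_ I. infinite I"
      "\<lambda>n I J. J \<subseteq> I \<and> (\<forall>k\<in>J. \<forall>l\<in>J. s (X k - X l) < e n)", simplified])
    show "\<exists>x. infinite (x :: nat set)" by auto
  next
    fix I :: "nat set" and n assume "infinite I"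
    then show "\<exists>J. infinite J \<and> J \<subseteq> I \<and> (\<forall>k\<in>J. \<forall>l\<in>J. s (X k - X l) < e n)"
      using step e by blast
  qed
  then obtain I where "\<forall>n. infinite (I n) \<and> I (Suc n) \<subseteq> I n \<and>
      (\<forall>k\<in>I (Suc n). \<forall>l\<in>I (Suc n). s (X k - X l) < e n)"
    by (rule exE)
  then have I: "\<And>n. infinite (I n)" "\<And>n. I (Suc n) \<subseteq> I n"
      "\<And>n k l. k \<in> I (Suc n) \<Longrightarrow> l \<in> I (Suc n) \<Longrightarrow> s (X k - X l) < e n"
    by simp_all
  have mono: "I n \<subseteq> I m" if "m \<le> n" for m n
    using lift_Suc_antimono_le[of I] I(2) that by blast
  have "\<exists>k. k \<in> I n \<and> k \<ge> n" for n
    using I(1)[of n] by (meson infinite_nat_iff_unbounded_le)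
  then obtain k where k: "\<And>n. k n \<in> I n" "\<And>n. k n \<ge> n"
    by metis
  have near: "s (X (k m) - X (k n)) < e j" if "m \<ge> Suc j" "n \<ge> Suc j" for m n j
    using I(3)[of "k m" j "k n"] mono[OF that(1)] mono[OF that(2)] k(1) by blast
  have small: "\<exists>j. e j < d" if "d > 0" for d
    unfolding e_def using reals_Archimedean[OF that] by blast
  have "cauchy (\<lambda>n. X (k n))"
    unfolding cauchy_def using near small by (meson order_less_trans)
  then obtain L where L: "L \<in> W" "(\<lambda>n. s (X (k n) - L)) \<longlonglongrightarrow> 0"
    using complete_onD[OF W(1), of "\<lambda>n. X (k n)"] X(1) by blast
  have "\<exists>j\<ge>n. s (X j - L) < d" if "d > 0" for d n
  proof -
    obtain M where M: "\<And>i. i \<ge> M \<Longrightarrow> s (X (k i) - L) < d"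
      using LIMSEQ_0_less[OF L(2) \<open>d > 0\<close>] by blast
    show ?thesis
      using M[of "max M n"] k(2)[of "max M n"] by (intro exI[of _ "k (max M n)"]) auto
  qed
  then show ?thesis
    using L(1) by blast
qed

end

section \<open>Residues and quadratic forms over a local ring\<close>

definition qform :: "(nat \<Rightarrow> 'r::comm_ring_1) \<Rightarrow> nat \<Rightarrow> (nat \<Rightarrow> 'r) \<Rightarrow> 'r" where
  "qform a m v = (\<Sum>i<m. a i * (v i)\<^sup>2)"

text \<open>The polar form \<open>q (u + v) - q u - q v\<close>. Keeping the factor 2 avoids
  halving, which would destroy integrality in residue characteristic 2.\<close>

definition bform :: "(nat \<Rightarrow> 'r::comm_ring_1) \<Rightarrow> nat \<Rightarrow> (nat \<Rightarrow> 'r) \<Rightarrow> (nat \<Rightarrow> 'r) \<Rightarrow> 'r" where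
  "bform a m u v = (\<Sum>i<m. 2 * a i * u i * v i)"

lemma qform_comb:
  "qform a m (\<lambda>i. x * u i + y * v i) = x\<^sup>2 * qform a m u + x * y * bform a m u v + y\<^sup>2 * qform a m v"
  unfolding qform_def bform_def
  by (simp add: sum_distrib_left flip: sum.distrib) (intro sum.cong refl, simp add: algebra_simps power2_eq_square)

lemma qform_scale: "qform a m (\<lambda>i. x * u i) = x\<^sup>2 * qform a m u"
  using qform_comb[of a m x u 0 "\<lambda>_. 0"] by simp

lemma bform_comb:
  "bform a m u (\<lambda>i. x * v i + y * t i) = x * bform a m u v + y * bform a m u t"
  unfolding bform_def
  by (simp add: sum_distrib_left flip: sum.distrib) (intro sum.cong refl, simp add: algebra_simps power2_eq_square)

lemma bform_self: "bform a m u u = 2 * qform a m u"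
  unfolding bform_def qform_def by (simp add: sum_distrib_left) (intro sum.cong refl, simp add: algebra_simps power2_eq_square)

lemma (in ultranorm) complete_on_ball:
  assumes "complete_on W" "0 < r"
  shows "complete_on {x \<in> W. s x \<le> r}"
  unfolding complete_on_def
proof (intro allI impI)
  fix X assume X: "range X \<subseteq> {x \<in> W. s x \<le> r}" "cauchy X"
  have XW: "X n \<in> W" "s (X n) \<le> r" for n using X(1) by auto
  obtain L where L: "L \<in> W" "(\<lambda>n. s (X n - L)) \<longlonglongrightarrow> 0"
    by (rule complete_onD[OF assms(1) XW(1) X(2)])
  obtain M where M: "\<And>n. n \<ge> M \<Longrightarrow> s (X n - L) < r"
    using LIMSEQ_0_less[OF L(2) assms(2)] by blast
  have "s (X M - (X M - L)) \<le> r"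
    using M[of M] XW(2) by (intro diff_le[of "X M" r "X M - L"]) auto
  then have "s L \<le> r" by simp
  then show "\<exists>L\<in>{x \<in> W. s x \<le> r}. (\<lambda>n. s (X n - L)) \<longlonglongrightarrow> 0"
    using L by (intro bexI[of _ L]) auto
qed

text \<open>
  A local field presented as a ring modulo the kernel of its valuation: identities hold only up to
  elements of valuation 0.  This covers \<open>K[t] / (q)\<close> without a type that depends on \<open>q\<close>.
\<close>

locale local_ring = ultranorm \<nu> for \<nu> :: "'r::comm_ring_1 \<Rightarrow> real" +
  assumes one [simp]: "\<nu> 1 = 1"
    and mult: "\<nu> (x * y) = \<nu> x * \<nu> y"
    and inverse_ex: "\<nu> x \<noteq> 0 \<Longrightarrow> \<exists>y. \<nu> (x * y - 1) = 0"
    and complete: "complete_on UNIV"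
    and totally_bounded: "totally_bounded_on UNIV"
    and nontrivial: "\<exists>x. 0 < \<nu> x \<and> \<nu> x < 1"
    and two: "\<nu> 2 \<noteq> 0"
begin

section \<open>Arithmetic up to null elements, and the residue field\<close>

lemma power: "\<nu> (x ^ n) = \<nu> x ^ n"
  by (induction n) (auto simp: mult)

lemma two_le: "\<nu> 2 \<le> 1"
  using add_le[of 1 1 1] by simp

lemma mult_le_1: "\<nu> x \<le> 1 \<Longrightarrow> \<nu> y \<le> 1 \<Longrightarrow> \<nu> (x * y) \<le> 1"
  by (simp add: mult mult_le_one)

definition invr :: "'r \<Rightarrow> 'r" where
  "invr x = (SOME y. \<nu> (x * y - 1) = 0)"

lemma invr: "\<nu> x \<noteq> 0 \<Longrightarrow> \<nu> (x * invr x - 1) = 0"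
  unfolding invr_def by (rule someI_ex) (rule inverse_ex)

lemma nu_invr: "\<nu> x \<noteq> 0 \<Longrightarrow> \<nu> (invr x) = 1 / \<nu> x"
  using eq_if_diff_zero[OF invr] by (simp add: mult field_simps)

lemma zero_add: "\<nu> x = 0 \<Longrightarrow> \<nu> y = 0 \<Longrightarrow> \<nu> (x + y) = 0"
  using add[of x y] nonneg[of "x + y"] by simp

lemma zero_diff: "\<nu> x = 0 \<Longrightarrow> \<nu> y = 0 \<Longrightarrow> \<nu> (x - y) = 0"
  using diff[of x y] nonneg[of "x - y"] by simp

lemma zero_multl: "\<nu> x = 0 \<Longrightarrow> \<nu> (x * y) = 0"
  by (simp add: mult)

lemma zero_sum: "(\<And>i. i \<in> A \<Longrightarrow> \<nu> (f i) = 0) \<Longrightarrow> \<nu> (sum f A) = 0"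
  by (induction A rule: infinite_finite_induct) (auto intro: zero_add)

text \<open>The valuation is discrete because finitely many balls of radius \<open>\<nu> z\<close>
  cover the unit ball, and on each of them all elements of size at least \<open>\<nu> z\<close> have
  the same size.\<close>

lemma uniformizer_ex:
  obtains w where "0 < \<nu> w" "\<nu> w < 1" "\<And>x. \<nu> x < 1 \<Longrightarrow> \<nu> x \<le> \<nu> w"
proof -
  obtain z where z: "0 < \<nu> z" "\<nu> z < 1"
    using nontrivial by blast
  obtain T where T: "finite T" "\<And>x. \<nu> x \<le> 1 \<Longrightarrow> \<exists>t\<in>T. \<nu> (x - t) < \<nu> z"
    using totally_bounded_onD[OF totally_bounded z(1)] by (metis UNIV_I)
  define A where "A = \<nu> ` {x. \<nu> z \<le> \<nu> x \<and> \<nu> x < 1}"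
  have "A \<subseteq> \<nu> ` T"
  proof
    fix y assume "y \<in> A"
    then obtain x where x: "y = \<nu> x" "\<nu> z \<le> \<nu> x" "\<nu> x < 1"
      unfolding A_def by auto
    obtain t where "t \<in> T" "\<nu> (x - t) < \<nu> z"
      using T(2)[of x] x(3) by auto
    then show "y \<in> \<nu> ` T"
      using eq_if_diff_less[of x t] x by (metis image_eqI order_less_le_trans)
  qed
  then have fin: "finite A"
    using T(1) finite_surj by blast
  have ne: "A \<noteq> {}"
    using z by (auto simp: A_def)
  obtain w where w: "Max A = \<nu> w" "\<nu> z \<le> \<nu> w" "\<nu> w < 1"
    using Max_in[OF fin ne] by (auto simp: A_def)
  show ?thesis
  proof (rule that[of w])
    fix x assume "\<nu> x < 1"
    show "\<nu> x \<le> \<nu> w"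
    proof (cases "\<nu> z \<le> \<nu> x")
      case True
      then have "\<nu> x \<in> A" using \<open>\<nu> x < 1\<close> by (auto simp: A_def)
      then show ?thesis using Max_ge[OF fin] w(1) by metis
    qed (use w in auto)
  qed (use w z in auto)
qed

text \<open>The choice depends on \<open>x\<close> only through its open unit ball, so congruent
  elements get the same representative. Equality of representatives then serves as equality in the
  residue field.\<close>

definition rep :: "'r \<Rightarrow> 'r" where
  "rep x = (SOME y. \<nu> (x - y) < 1)"

lemma rep: "\<nu> (x - rep x) < 1"
  unfolding rep_def by (rule someI[of _ x]) simp

lemma rep_eq_iff: "rep x = rep y \<longleftrightarrow> \<nu> (x - y) < 1"
proof
  assume "rep x = rep y"
  then show "\<nu> (x - y) < 1"
    using rep[of x] rep[of y] diff_trans_less[of x "rep x" 1 y] by (simp add: diff_commute)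
next
  assume *: "\<nu> (x - y) < 1"
  have "\<nu> (x - z) < 1 \<longleftrightarrow> \<nu> (y - z) < 1" for z
    using * diff_trans_less[of x y 1 z] diff_trans_less[of y x 1 z] by (auto simp: diff_commute)
  then show "rep x = rep y"
    unfolding rep_def by simp
qed

lemma rep_rep: "rep (rep x) = rep x"
  using rep[of x] by (simp add: rep_eq_iff diff_commute)

lemma rep_le: "\<nu> x \<le> 1 \<Longrightarrow> \<nu> (rep x) \<le> 1"
  using rep[of x] diff_le[of x 1 "x - rep x"] by simp

definition residues :: "'r set" where
  "residues = rep ` {x. \<nu> x \<le> 1}"

lemma finite_residues: "finite residues"
proof -
  obtain T where T: "finite T" "\<And>x. \<nu> x \<le> 1 \<Longrightarrow> \<exists>t\<in>T. \<nu> (x - t) < 1"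
    using totally_bounded_onD[OF totally_bounded, of 1 1] by (metis UNIV_I zero_less_one)
  have "residues \<subseteq> rep ` T"
    using T(2) by (force simp: residues_def rep_eq_iff[symmetric])
  then show ?thesis
    using T(1) finite_surj by blast
qed

lemma rep_in: "\<nu> x \<le> 1 \<Longrightarrow> rep x \<in> residues"
  by (auto simp: residues_def)

lemma residuesD: "x \<in> residues \<Longrightarrow> \<nu> x \<le> 1" "x \<in> residues \<Longrightarrow> rep x = x"
  by (auto simp: residues_def rep_rep rep_le)

text \<open>With 2 in the maximal ideal, squaring is additive on residues, hence injective, hence
  onto by finiteness.\<close>

lemma square_root_char_2:
  assumes "\<nu> 2 < 1" "\<nu> a = 1"
  shows "\<exists>y. \<nu> y = 1 \<and> \<nu> (y\<^sup>2 - a) < 1"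
proof -
  have inj: "inj_on (\<lambda>x. rep (x\<^sup>2)) residues"
  proof (rule inj_onI)
    fix x y assume xy: "x \<in> residues" "y \<in> residues" "rep (x\<^sup>2) = rep (y\<^sup>2)"
    have "(x - y)\<^sup>2 = (x\<^sup>2 - y\<^sup>2) + 2 * (y * (y - x))"
      by (simp add: algebra_simps power2_eq_square)
    moreover have "\<nu> (2 * (y * (y - x))) < 1"
      using assms(1) residuesD(1)[OF xy(1)] residuesD(1)[OF xy(2)] mult_le_1[of y "y - x"]
        diff_le[of y 1 x] mult_left_le[of "\<nu> (y * (y - x))" "\<nu> 2"] by (simp add: mult[of 2])
    ultimately have "\<nu> ((x - y)\<^sup>2) < 1"
      using xy(3) by (auto intro: add_less simp: rep_eq_iff)
    then have "\<nu> (x - y) < 1"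
      by (simp add: power power_less_one_iff)
    then show "x = y"
      using xy residuesD(2) rep_eq_iff by metis
  qed
  have "(\<lambda>x. rep (x\<^sup>2)) ` residues \<subseteq> residues"
    using residuesD(1) by (auto intro!: rep_in simp: power power_le_one)
  then have "(\<lambda>x. rep (x\<^sup>2)) ` residues = residues"
    using endo_inj_surj[OF finite_residues _ inj] by blast
  then have "rep a \<in> (\<lambda>x. rep (x\<^sup>2)) ` residues"
    using rep_in[of a] assms(2) by simp
  then obtain y where y: "y \<in> residues" "rep a = rep (y\<^sup>2)"
    by (rule imageE)
  then have *: "\<nu> (y\<^sup>2 - a) < 1"
    by (simp add: rep_eq_iff diff_commute)
  then have "\<nu> (y\<^sup>2) = 1"
    using eq_if_diff_less[of a "y\<^sup>2"] assms(2) by (simp add: diff_commute)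
  then have "\<nu> y = 1"
    using nonneg[of y] by (auto simp: power power2_eq_1_iff)
  with * show ?thesis by blast
qed

text \<open>The residues of \<open>a x\<^sup>2\<close> and those of \<open>c - b y\<^sup>2\<close> each make up more than half of all residues,
  hence they meet.\<close>

lemma binary_form_residue:
  assumes "\<nu> 2 = 1" "\<nu> a = 1" "\<nu> b = 1" "\<nu> c = 1"
  shows "\<exists>x y. \<nu> x \<le> 1 \<and> \<nu> y \<le> 1 \<and> \<nu> (a * x\<^sup>2 + b * y\<^sup>2 - c) < 1"
proof -
  have half: "card residues < 2 * card (f ` residues)"
    if f: "\<And>x y. x \<in> residues \<Longrightarrow> y \<in> residues \<Longrightarrow> f x = f y \<Longrightarrow> \<nu> (x\<^sup>2 - y\<^sup>2) < 1"
    for f :: "'r \<Rightarrow> 'r"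
  proof -
    \<comment> \<open>The class of zero is its own negative, so its fibre is a singleton while other
      fibres have at most two elements. This is what makes "more than half" strict.\<close>
    define o' where "o' = rep 0"
    have o': "o' \<in> residues" "\<nu> o' < 1"
      using rep[of 0] by (auto simp: o'_def intro: rep_in)
    define F where "F z = {x \<in> residues. f x = z}" for z
    have F: "F (f x) \<subseteq> {x, rep (- x)}" if "x \<in> residues" for x
    proof
      fix y assume "y \<in> F (f x)"
      then have y: "y \<in> residues" "f y = f x" by (auto simp: F_def)
      have "\<nu> ((y - x) * (y + x)) < 1"
        using f[OF y(1) that y(2)] by (simp add: algebra_simps power2_eq_square)
      then have "\<nu> (y - x) < 1 \<or> \<nu> (y + x) < 1"
        using mult_mono[of 1 "\<nu> (y - x)" 1 "\<nu> (y + x)"] by (force simp: mult)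
      then have "rep y = rep x \<or> rep y = rep (- x)"
        by (simp add: rep_eq_iff)
      then show "y \<in> {x, rep (- x)}"
        using residuesD(2)[OF y(1)] residuesD(2)[OF that] by auto
    qed
    have "rep (- o') = o'"
      using o'(2) by (metis minus o'_def diff_zero rep_eq_iff)
    then have F0: "F (f o') \<subseteq> {o'}"
      using F[OF o'(1)] by simp
    have "residues = F (f o') \<union> (\<Union>z\<in>f ` residues - {f o'}. F z)"
      by (auto simp: F_def)
    then have "card residues \<le> card (F (f o')) + card (\<Union>z\<in>f ` residues - {f o'}. F z)"
      by (metis card_Un_le)
    also have "card (F (f o')) \<le> 1"
      using card_mono[OF _ F0] by simp
    also have "card (\<Union>z\<in>f ` residues - {f o'}. F z) \<le> (\<Sum>z\<in>f ` residues - {f o'}. card (F z))"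
      using finite_residues by (intro card_UN_le) auto
    also have "\<dots> \<le> (\<Sum>z\<in>f ` residues - {f o'}. 2)"
    proof (rule sum_mono)
      fix z assume "z \<in> f ` residues - {f o'}"
      then obtain x where x: "x \<in> residues" "z = f x" by blast
      have "card (F z) \<le> card {x, rep (- x)}"
        using F[OF x(1)] x(2) by (intro card_mono) auto
      also have "\<dots> \<le> 2" by (simp add: card_insert_if)
      finally show "card (F z) \<le> 2" .
    qed
    also have "\<dots> = 2 * (card (f ` residues) - 1)"
      using o'(1) finite_residues by (simp add: card_Diff_singleton)
    finally have "card residues \<le> 1 + 2 * (card (f ` residues) - 1)"
      by simp
    moreover have "card (f ` residues) > 0"
      using o'(1) finite_residues by (auto simp: card_gt_0_iff)
    ultimately show ?thesis by linarith
  qed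
  define f where "f x = rep (a * x\<^sup>2)" for x
  define g where "g x = rep (c - b * x\<^sup>2)" for x
  have f: "card residues < 2 * card (f ` residues)"
  proof (rule half)
    fix x y assume "f x = f y"
    then have "\<nu> (a * (x\<^sup>2 - y\<^sup>2)) < 1"
      by (simp add: f_def rep_eq_iff algebra_simps)
    then show "\<nu> (x\<^sup>2 - y\<^sup>2) < 1" using assms by (simp add: mult)
  qed
  have g: "card residues < 2 * card (g ` residues)"
  proof (rule half)
    fix x y assume "g x = g y"
    then have "\<nu> (b * (y\<^sup>2 - x\<^sup>2)) < 1"
      by (simp add: g_def rep_eq_iff algebra_simps)
    then show "\<nu> (x\<^sup>2 - y\<^sup>2) < 1" using assms by (simp add: mult diff_commute)
  qed
  have sub: "f ` residues \<union> g ` residues \<subseteq> residues"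
    using residuesD(1) assms
    by (auto simp: f_def g_def intro!: rep_in diff_le simp: mult power power_le_one)
  have "f ` residues \<inter> g ` residues \<noteq> {}"
  proof
    assume "f ` residues \<inter> g ` residues = {}"
    then have "card (f ` residues \<union> g ` residues) = card (f ` residues) + card (g ` residues)"
      using finite_residues by (intro card_Un_disjoint) auto
    moreover have "card (f ` residues \<union> g ` residues) \<le> card residues"
      using sub finite_residues by (rule card_mono[rotated])
    ultimately show False using f g by linarith
  qed
  then obtain x y where xy: "x \<in> residues" "y \<in> residues" "f x = g y" by blast
  have "\<nu> (a * x\<^sup>2 + b * y\<^sup>2 - c) < 1"
    using xy(3) by (simp add: f_def g_def rep_eq_iff algebra_simps)
  then show ?thesis using xy residuesD(1) by blast
qed

text \<open>Gaussian elimination up to null elements: an equation with a non-null coefficient is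
  solved for that unknown and substituted into the others.\<close>

lemma homogeneous_system:
  assumes "finite I" "r < card I"
  shows "\<exists>c. (\<exists>i\<in>I. \<nu> (c i) \<noteq> 0) \<and> (\<forall>j<r. \<nu> (\<Sum>i\<in>I. M j i * c i) = 0)"
  using assms
proof (induction r arbitrary: I M)
  case 0
  then show ?case by (intro exI[of _ "\<lambda>_. 1"]) (auto simp: card_gt_0_iff)
next
  case (Suc r)
  show ?case
  proof (cases "\<forall>i\<in>I. \<nu> (M r i) = 0")
    case True
    obtain c where c: "\<exists>i\<in>I. \<nu> (c i) \<noteq> 0" "\<forall>j<r. \<nu> (\<Sum>i\<in>I. M j i * c i) = 0"
      using Suc.IH[OF Suc.prems(1), of M] Suc.prems(2) by auto
    moreover have "\<nu> (\<Sum>i\<in>I. M r i * c i) = 0"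
      using True by (intro zero_sum zero_multl) auto
    ultimately show ?thesis by (metis less_Suc_eq)
  next
    case False
    then obtain k where k: "k \<in> I" "\<nu> (M r k) \<noteq> 0" by blast
    define p where "p = invr (M r k)"
    have p: "\<nu> (M r k * p - 1) = 0" using invr[OF k(2)] by (simp add: p_def)
    define J where "J = I - {k}"
    have J: "finite J" "r < card J" "I = insert k J" "k \<notin> J"
      using Suc.prems k by (auto simp: J_def)
    obtain c where c: "\<exists>i\<in>J. \<nu> (c i) \<noteq> 0"
        "\<forall>j<r. \<nu> (\<Sum>i\<in>J. (M j i - M j k * p * M r i) * c i) = 0"
      using Suc.IH[OF J(1,2), of "\<lambda>j i. M j i - M j k * p * M r i"] by blast
    define S where "S j = (\<Sum>i\<in>J. M j i * c i)" for j
    define d where "d = c(k := - p * S r)"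
    have sum: "(\<Sum>i\<in>I. M j i * d i) = S j - M j k * p * S r" for j
    proof -
      have "(\<Sum>i\<in>J. M j i * d i) = S j"
        unfolding S_def using J(4) by (intro sum.cong) (auto simp: d_def)
      then show ?thesis
        using J by (simp add: d_def algebra_simps)
    qed
    have "\<nu> (\<Sum>i\<in>I. M j i * d i) = 0" if "j < Suc r" for j
    proof (cases "j = r")
      case True
      have "S r - M r k * p * S r = - (M r k * p - 1) * S r" by (simp add: algebra_simps power2_eq_square)
      then show ?thesis using p by (simp add: sum True mult diff_commute)
    next
      case False
      have "(\<Sum>i\<in>J. (M j i - M j k * p * M r i) * c i) = S j - M j k * p * S r"
        unfolding S_def sum_distrib_left sum_subtractf[symmetric]
        by (intro sum.cong refl, simp add: algebra_simps power2_eq_square)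
      moreover have "j < r" using False that by simp
      ultimately show ?thesis unfolding sum using c(2) by metis
    qed
    moreover have "\<exists>i\<in>I. \<nu> (d i) \<noteq> 0"
      using c(1) J by (auto simp: d_def)
    ultimately show ?thesis by blast
  qed
qed

end

section \<open>Quinary forms over a local ring are isotropic\<close>

context local_ring
begin

lemma bform_zero: "(\<And>i. i < m \<Longrightarrow> \<nu> (v i) = 0) \<Longrightarrow> \<nu> (bform a m u v) = 0"
  unfolding bform_def by (intro zero_sum) (simp add: mult)

lemma qform_cong_zero:
  assumes "\<And>i. i < m \<Longrightarrow> \<nu> (u i - v i) = 0"
  shows "\<nu> (qform a m u) = \<nu> (qform a m v)"
proof -
  have "qform a m u - qform a m v = (\<Sum>i<m. (u i - v i) * (a i * (u i + v i)))"
    unfolding qform_def sum_subtractf[symmetric]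
    by (intro sum.cong refl, simp add: algebra_simps power2_eq_square)
  then have "\<nu> (qform a m u - qform a m v) = 0"
    using assms by (auto intro!: zero_sum simp: mult)
  then show ?thesis by (rule eq_if_diff_zero)
qed

section \<open>Lattices of an anisotropic form\<close>

context
  fixes a :: "nat \<Rightarrow> 'r" and m :: nat
  assumes anisotropic: "\<And>v i. \<nu> (qform a m v) = 0 \<Longrightarrow> i < m \<Longrightarrow> \<nu> (v i) = 0"
begin

private abbreviation "q \<equiv> qform a m"
private abbreviation "b \<equiv> bform a m"

text \<open>Were the inequality false, the quadratic equation \<open>q (x u + v) = 0\<close> in \<open>x\<close> would be
  solvable by Hensel's lemma.\<close>

lemma bform_sq_le: "(\<nu> (b u v))\<^sup>2 \<le> \<nu> (q u) * \<nu> (q v)"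
proof (rule ccontr)
  define B where "B = b u v"
  assume "\<not> ?thesis"
  then have less: "\<nu> (q u) * \<nu> (q v) < (\<nu> B)\<^sup>2" by (simp add: B_def)
  then have B0: "\<nu> B \<noteq> 0" by (metis less_eq_real_def mult_nonneg_nonneg nonneg not_le power_zero_numeral)
  then have Bpos: "\<nu> B > 0" using nonneg[of B] by linarith
  \<comment> \<open>The substitution \<open>x = - (q v / B) y\<close> turns
    \<open>x\<^sup>2 q u + x B + q v = 0\<close> into \<open>1 + \<epsilon> y\<^sup>2 = y\<close>,
    whose left side is a contraction of the unit ball.\<close>
  define \<epsilon> where "\<epsilon> = q u * q v * (invr B)\<^sup>2"
  have \<epsilon>: "\<nu> \<epsilon> < 1"
    using less Bpos by (simp add: \<epsilon>_def mult power nu_invr[OF B0] power_divide)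
  have "\<exists>y\<in>{y \<in> UNIV. \<nu> y \<le> 1}. \<nu> ((1 + \<epsilon> * y\<^sup>2) - y) = 0"
  proof (rule contraction_fixpoint[OF complete_on_ball[OF complete], where c = "\<nu> \<epsilon>" and ?x0.0 = 0])
    fix x assume "x \<in> {y \<in> UNIV. \<nu> y \<le> 1}"
    then show "1 + \<epsilon> * x\<^sup>2 \<in> {y \<in> UNIV. \<nu> y \<le> 1}"
      using \<epsilon> by (auto intro!: add_le mult_le_1 simp: power power_le_one)
  next
    fix x y assume xy: "x \<in> {y \<in> UNIV. \<nu> y \<le> 1}" "y \<in> {y \<in> UNIV. \<nu> y \<le> 1}"
    have "(1 + \<epsilon> * x\<^sup>2) - (1 + \<epsilon> * y\<^sup>2) = \<epsilon> * (x - y) * (x + y)"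
      by (simp add: algebra_simps power2_eq_square)
    moreover have "\<nu> (x + y) \<le> 1" using xy by (intro add_le) auto
    ultimately show "\<nu> ((1 + \<epsilon> * x\<^sup>2) - (1 + \<epsilon> * y\<^sup>2)) \<le> \<nu> \<epsilon> * \<nu> (x - y)"
      by (simp add: mult mult_left_le)
  qed (use \<epsilon> in auto)
  then obtain y where y: "\<nu> y \<le> 1" "\<nu> ((1 + \<epsilon> * y\<^sup>2) - y) = 0" by blast
  define x where "x = - (q v * invr B * y)"
  define t where "t = (\<lambda>i. x * u i + 1 * v i)"
  have "q t = q v * ((1 + \<epsilon> * y\<^sup>2) - y) - (B * invr B - 1) * (q v * y)"
    unfolding t_def qform_comb B_def[symmetric] x_def \<epsilon>_def
    by (simp add: algebra_simps power2_eq_square)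
  then have "\<nu> (q t) = 0"
    using y(2) invr[OF B0] by (auto intro!: zero_diff simp: mult)
  \<comment> \<open>Anisotropy makes all entries of the root vector \<open>t\<close> null, so
    \<open>B = - 2 x q u\<close> up to a null element. The bound on \<open>\<nu> x\<close> then
    contradicts the assumed size of \<open>B\<close>.\<close>
  then have "\<nu> (b u t) = 0"
    using anisotropic by (intro bform_zero) auto
  then have "\<nu> (B - - (x * (2 * q u))) = 0"
    unfolding t_def bform_comb bform_self by (simp add: B_def add.commute)
  then have "\<nu> B = \<nu> x * (\<nu> 2 * \<nu> (q u))"
    using eq_if_diff_zero minus by (metis mult)
  also have "\<nu> x * (\<nu> 2 * \<nu> (q u)) \<le> \<nu> x * (1 * \<nu> (q u))"
    using two_le by (intro mult_left_mono mult_right_mono) auto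
  also have "\<nu> x \<le> \<nu> (q v) / \<nu> B"
    using y(1) Bpos by (simp add: x_def mult nu_invr[OF B0] divide_right_mono mult_left_le)
  finally have "\<nu> B \<le> \<nu> (q v) / \<nu> B * \<nu> (q u)"
    by (simp add: mult_right_mono)
  then have "(\<nu> B)\<^sup>2 \<le> \<nu> (q u) * \<nu> (q v)"
    using Bpos by (simp add: field_simps power2_eq_square)
  then show False using less by simp
qed

lemma bform_le:
  assumes "\<nu> (q u) \<le> r" "\<nu> (q v) \<le> r"
  shows "\<nu> (b u v) \<le> r"
proof -
  have r: "0 \<le> r" using assms(1) nonneg order_trans by blast
  have "(\<nu> (b u v))\<^sup>2 \<le> r * r"
    using bform_sq_le[of u v] mult_mono[OF assms r] by (simp add: r order_trans)
  then show ?thesis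
    using r power2_le_imp_le[of "\<nu> (b u v)" r] by (simp add: power2_eq_square)
qed

lemma qform_scale_val: "\<nu> (q (\<lambda>i. x * u i)) = (\<nu> x)\<^sup>2 * \<nu> (q u)"
  by (simp add: qform_scale mult power)

text \<open>The cross term is controlled by \<open>bform_le\<close>. Hence the vectors with
  \<open>\<nu> (q v) \<le> r\<close> form a module over the valuation ring.\<close>

lemma qform_add_le:
  assumes "\<nu> (q u) \<le> r" "\<nu> (q v) \<le> r"
  shows "\<nu> (q (\<lambda>i. u i + v i)) \<le> r"
  using qform_comb[of a m 1 u 1 v] bform_le[OF assms] assms by (auto intro: add_le)

lemma qform_add_less:
  assumes "\<nu> (q u) < r" "\<nu> (q v) < r"
  shows "\<nu> (q (\<lambda>i. u i + v i)) < r"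
  using qform_add_le[of u "max (\<nu> (q u)) (\<nu> (q v))" v] assms by simp

lemma qform_scale_le:
  assumes "\<nu> (q u) \<le> r" "\<nu> x \<le> 1"
  shows "\<nu> (q (\<lambda>i. x * u i)) \<le> r"
  using assms mult_le_one[of "(\<nu> x)\<^sup>2" 1] mult_right_mono[of "(\<nu> x)\<^sup>2" 1 "\<nu> (q u)"]
  by (simp add: qform_scale_val power_le_one)

lemma qform_scale_less:
  assumes "\<nu> (q u) \<le> r" "\<nu> x < 1" "0 < r"
  shows "\<nu> (q (\<lambda>i. x * u i)) < r"
proof -
  have "(\<nu> x)\<^sup>2 < 1"
    using assms(2) by (simp add: power_less_one_iff)
  then have "(\<nu> x)\<^sup>2 * \<nu> (q u) \<le> (\<nu> x)\<^sup>2 * r" "(\<nu> x)\<^sup>2 * r < 1 * r"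
    using assms by (auto intro: mult_left_mono)
  then show ?thesis by (simp add: qform_scale_val)
qed

lemma qform_comb_le:
  assumes "\<nu> (q u) \<le> r" "\<nu> (q v) \<le> r" "\<nu> x \<le> 1" "\<nu> y \<le> 1"
  shows "\<nu> (q (\<lambda>i. x * u i + y * v i)) \<le> r"
  using assms by (intro qform_add_le qform_scale_le)

text \<open>Modulo lower levels the cross term disappears, and every unit residue is a square; take
  \<open>y\<close> with \<open>y\<^sup>2\<close> congruent to \<open>- q v / q u\<close>.\<close>

lemma isotropic_residue_char_2:
  assumes "\<nu> 2 < 1" "\<nu> (q u) = r" "\<nu> (q v) = r" "\<nu> (b u v) < r" "0 < r"
  shows "\<exists>y. \<nu> y = 1 \<and> \<nu> (q (\<lambda>i. y * u i + 1 * v i)) < r"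
proof -
  define c where "c = - (q v * invr (q u))"
  have c: "\<nu> c = 1"
    using assms by (simp add: c_def mult nu_invr)
  obtain y where y: "\<nu> y = 1" "\<nu> (y\<^sup>2 - c) < 1"
    using square_root_char_2[OF assms(1) c] by blast
  have "q (\<lambda>i. y * u i + 1 * v i) = (y\<^sup>2 - c) * q u + y * b u v - (q u * invr (q u) - 1) * q v"
    unfolding qform_comb c_def by (simp add: algebra_simps)
  moreover have "\<nu> ((q u * invr (q u) - 1) * q v) = 0"
    using assms by (intro zero_multl invr) auto
  ultimately have "\<nu> (q (\<lambda>i. y * u i + 1 * v i)) < r"
    using y assms by (auto intro!: add_less diff_less simp: mult)
  with y show ?thesis by blast
qed

text \<open>A Gram-Schmidt step; \<open>bform_le\<close> and the invertibility of 2 keep its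
  coefficient integral.\<close>

lemma orthogonalize:
  assumes "\<nu> 2 = 1" "\<nu> (q u) = r" "\<nu> (q v) \<le> r" "0 < r"
  shows "\<exists>k. \<nu> k \<le> 1 \<and> \<nu> (b u (\<lambda>i. k * u i + 1 * v i)) = 0"
proof -
  define k where "k = - (b u v * invr (2 * q u))"
  have nz: "\<nu> (2 * q u) \<noteq> 0" using assms by (simp add: mult)
  have "\<nu> k \<le> 1"
    using bform_le[of u r v] assms by (simp add: k_def mult nu_invr[OF nz])
  moreover have "b u (\<lambda>i. k * u i + 1 * v i) = - (2 * q u * invr (2 * q u) - 1) * b u v"
    unfolding bform_comb bform_self k_def by (simp add: algebra_simps)
  then have "\<nu> (b u (\<lambda>i. k * u i + 1 * v i)) = 0"
    using invr[OF nz] by (simp add: mult diff_commute)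
  ultimately show ?thesis by blast
qed

text \<open>The hypotheses say that \<open>q / r\<close> reduces to an anisotropic ternary form over the finite
  residue field.\<close>

lemma no_anisotropic_ternary:
  assumes r: "0 < r" and u: "\<nu> (q u1) \<le> r" "\<nu> (q u2) \<le> r" "\<nu> (q u3) \<le> r"
    and prim: "\<And>x y z. \<nu> x \<le> 1 \<Longrightarrow> \<nu> y \<le> 1 \<Longrightarrow> \<nu> z \<le> 1 \<Longrightarrow> \<nu> x = 1 \<or> \<nu> y = 1 \<or> \<nu> z = 1 \<Longrightarrow>
        r \<le> \<nu> (q (\<lambda>i. x * u1 i + y * u2 i + z * u3 i))"
  shows False
proof -
  have q1: "\<nu> (q u1) = r" and q2: "\<nu> (q u2) = r"
    using u prim[of 1 0 0] prim[of 0 1 0] by auto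
  show False
  proof (cases "\<nu> 2 = 1")
    case False
    then have two: "\<nu> 2 < 1" using two_le by simp
    show False
    proof (cases "\<nu> (b u1 u2) < r")
      case True
      obtain y where y: "\<nu> y = 1" "\<nu> (q (\<lambda>i. y * u1 i + 1 * u2 i)) < r"
        using isotropic_residue_char_2[OF two q1 q2 True r] by blast
      then show False using prim[of y 1 0] by simp
    next
      case False
      then have b12: "\<nu> (b u1 u2) = r"
        using bform_le[OF u(1,2)] by simp
      \<comment> \<open>The polar product of \<open>u1\<close> and \<open>u2\<close> now has full
        size, so the square-root argument does not apply to them. But it can be used to replace
        \<open>u3\<close> by a vector \<open>v\<close> orthogonal to \<open>u1\<close>, and the pair
        \<open>u1\<close>, \<open>v\<close> qualifies.\<close>
      define k where "k = - (b u1 u3 * invr (b u1 u2))"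
      have k: "\<nu> k \<le> 1"
        using bform_le[OF u(1,3)] r by (simp add: k_def mult nu_invr b12)
      define v where "v = (\<lambda>i. k * u2 i + 1 * u3 i)"
      have v: "\<nu> (q v) = r"
        unfolding v_def using qform_comb_le[OF u(2,3) k, of 1] prim[of 0 k 1] k by simp
      have "b u1 v = - (b u1 u2 * invr (b u1 u2) - 1) * b u1 u3"
        unfolding v_def bform_comb k_def by (simp add: algebra_simps)
      then have "\<nu> (b u1 v) = 0"
        using invr[of "b u1 u2"] b12 r by (simp add: mult diff_commute)
      then obtain y where y: "\<nu> y = 1" "\<nu> (q (\<lambda>i. y * u1 i + 1 * v i)) < r"
        using isotropic_residue_char_2[OF two q1 v _ r] r by auto
      moreover have "(\<lambda>i. y * u1 i + 1 * v i) = (\<lambda>i. y * u1 i + k * u2 i + 1 * u3 i)"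
        by (auto simp: v_def)
      ultimately show False using prim[of y k 1] k by simp
    qed
  next
    case True
    \<comment> \<open>Orthogonal vectors \<open>u1\<close>, \<open>v2\<close>, \<open>v3\<close> are
      built with integral coordinates. Each new vector has coefficient 1 at its own
      \<open>u\<close>, so \<open>prim\<close> keeps it at level exactly \<open>r\<close>.\<close>
    obtain k2 where k2: "\<nu> k2 \<le> 1" "\<nu> (b u1 (\<lambda>i. k2 * u1 i + 1 * u2 i)) = 0"
      using orthogonalize[OF True q1 u(2) r] by blast
    define v2 where "v2 = (\<lambda>i. k2 * u1 i + 1 * u2 i)"
    have v2: "\<nu> (q v2) = r"
      unfolding v2_def using qform_comb_le[OF u(1,2) k2(1), of 1] prim[of k2 1 0] k2 by simp
    obtain k3 where k3: "\<nu> k3 \<le> 1" "\<nu> (b u1 (\<lambda>i. k3 * u1 i + 1 * u3 i)) = 0"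
      using orthogonalize[OF True q1 u(3) r] by blast
    define t where "t = (\<lambda>i. k3 * u1 i + 1 * u3 i)"
    have t: "\<nu> (q t) = r"
      unfolding t_def using qform_comb_le[OF u(1,3) k3(1), of 1] prim[of k3 0 1] k3 by simp
    obtain l where l: "\<nu> l \<le> 1" "\<nu> (b v2 (\<lambda>i. l * v2 i + 1 * t i)) = 0"
      using orthogonalize[OF True v2 _ r, of t] t by auto
    define v3 where "v3 = (\<lambda>i. l * v2 i + 1 * t i)"
    have b13: "\<nu> (b u1 v3) = 0"
      unfolding v3_def bform_comb using k2(2) k3(2)
      by (auto intro!: zero_add simp: mult t_def v2_def)
    have v3_eq: "v3 = (\<lambda>i. (l * k2 + k3) * u1 i + l * u2 i + 1 * u3 i)"
      by (auto simp: v3_def v2_def t_def algebra_simps)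
    have lk: "\<nu> (l * k2 + k3) \<le> 1"
      using l k2 k3 by (intro add_le mult_le_1)
    have v3: "\<nu> (q v3) = r"
    proof (rule antisym)
      show "r \<le> \<nu> (q v3)"
        unfolding v3_eq using lk l by (intro prim) auto
      show "\<nu> (q v3) \<le> r"
        unfolding v3_def using v2 t l by (intro qform_comb_le) auto
    qed
    \<comment> \<open>Scaling by \<open>j\<close> turns the values into units, so that counting
      residues solves \<open>q u1 x\<^sup>2 + q v2 y\<^sup>2 = - q v3\<close> modulo the maximal
      ideal. The resulting vector has coefficient 1 at \<open>u3\<close>, which contradicts
      \<open>prim\<close>.\<close>
    define j where "j = invr (q v3)"
    have j: "\<nu> j = 1 / r" "\<nu> (q v3 * j - 1) = 0"
      using v3 r invr[of "q v3"] by (auto simp: j_def nu_invr)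
    obtain x y where xy: "\<nu> x \<le> 1" "\<nu> y \<le> 1"
        "\<nu> (q u1 * j * x\<^sup>2 + q v2 * j * y\<^sup>2 - (- 1)) < 1"
      using binary_form_residue[OF True, of "q u1 * j" "q v2 * j" "- 1"] q1 v2 r
      by (auto simp: mult j)
    define s where "s = (\<lambda>i. x * u1 i + 1 * (y * v2 i + 1 * v3 i))"
    have s_eq: "s = (\<lambda>i. (x + y * k2 + (l * k2 + k3)) * u1 i + (y + l) * u2 i + 1 * u3 i)"
      by (auto simp: s_def v2_def v3_eq algebra_simps)
    have "\<nu> (x + y * k2 + (l * k2 + k3)) \<le> 1" "\<nu> (y + l) \<le> 1"
      using lk xy l k2 by (auto intro!: add_le mult_le_1)
    then have "r \<le> \<nu> (q s)"
      unfolding s_eq by (intro prim) auto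
    moreover have "\<nu> (q s) < r"
    proof -
      have "q s = q v3 * (q u1 * j * x\<^sup>2 + q v2 * j * y\<^sup>2 - (- 1))
          - (q v3 * j - 1) * (q u1 * x\<^sup>2 + q v2 * y\<^sup>2)
          + (x * y * b u1 v2 + x * b u1 v3 + y * b v2 v3)"
        unfolding s_def qform_comb bform_comb by (simp add: algebra_simps power2_eq_square)
      moreover have "\<nu> (x * y * b u1 v2 + x * b u1 v3 + y * b v2 v3) < r"
        using k2(2) b13 l(2) r by (auto intro!: add_less simp: mult v2_def v3_def)
      moreover have "\<nu> (q v3 * (q u1 * j * x\<^sup>2 + q v2 * j * y\<^sup>2 - (- 1))) < r"
        using xy(3) v3 r by (simp only: mult[of "q v3"]) simp
      ultimately show ?thesis
        using j(2) r by (auto intro!: add_less diff_less simp: mult[of "q v3 * j - 1"])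
    qed
    ultimately show False by simp
  qed
qed

lemma unit_comb_ge:
  assumes "\<And>x. \<nu> x \<le> 1 \<Longrightarrow> r \<le> \<nu> (q (\<lambda>i. v i - x * u i))" "\<nu> x \<le> 1" "\<nu> y = 1"
  shows "r \<le> \<nu> (q (\<lambda>i. x * u i + y * v i))"
proof -
  define z where "z = - (x * invr y)"
  have "\<nu> z \<le> 1" using assms by (simp add: z_def mult nu_invr)
  then have "r \<le> \<nu> (q (\<lambda>i. v i - z * u i))" by (rule assms(1))
  also have "\<dots> = \<nu> (q (\<lambda>i. y * (v i - z * u i)))"
    using assms by (simp add: qform_scale_val)
  also have "\<dots> = \<nu> (q (\<lambda>i. x * u i + y * v i))"
  proof (rule qform_cong_zero)
    fix i
    have "y * (v i - z * u i) - (x * u i + y * v i) = (y * invr y - 1) * (x * u i)"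
      by (simp add: z_def algebra_simps)
    then show "\<nu> (y * (v i - z * u i) - (x * u i + y * v i)) = 0"
      using invr[of y] assms by (simp add: mult)
  qed
  finally show ?thesis .
qed

text \<open>Vectors of level at most \<open>r\<close> modulo those of smaller level form a space
  over the residue field on which the form stays anisotropic, so
  \<open>no_anisotropic_ternary\<close> bounds its dimension by 2. Generators are picked greedily
  and padded with zero.\<close>

lemma two_generators:
  assumes r: "0 < r"
  shows "\<exists>g1 g2. \<forall>v. \<nu> (q v) \<le> r \<longrightarrow>
      (\<exists>x y. \<nu> (q (\<lambda>i. v i - (x * g1 i + y * g2 i))) < r)"
proof (cases "\<forall>v. \<nu> (q v) \<le> r \<longrightarrow> \<nu> (q v) < r")
  case True
  then show ?thesis by (intro exI[of _ "\<lambda>_. 0"]) auto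
next
  case False
  then obtain g1 where g1: "\<nu> (q g1) \<le> r" "r \<le> \<nu> (q g1)" by (auto simp: not_less)
  show ?thesis
  proof (cases "\<forall>v. \<nu> (q v) \<le> r \<longrightarrow> (\<exists>x. \<nu> x \<le> 1 \<and> \<nu> (q (\<lambda>i. v i - x * g1 i)) < r)")
    case True
    then show ?thesis by (intro exI[of _ g1] exI[of _ "\<lambda>_. 0"]) auto
  next
    case False
    then obtain g2 where g2: "\<nu> (q g2) \<le> r" "\<And>x. \<nu> x \<le> 1 \<Longrightarrow> r \<le> \<nu> (q (\<lambda>i. g2 i - x * g1 i))"
      by force
    show ?thesis
    proof (rule ccontr)
      assume "\<not> ?thesis"
      then obtain g3 where g3: "\<nu> (q g3) \<le> r"
          "\<And>x y. r \<le> \<nu> (q (\<lambda>i. g3 i - (x * g1 i + y * g2 i)))"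
        by (meson not_le)
      have sub: "r \<le> \<nu> (q (\<lambda>i. u i + v i))" if "r \<le> \<nu> (q u)" "\<nu> (q v) < r" for u v
      proof (rule ccontr)
        assume "\<not> ?thesis"
        then have "\<nu> (q (\<lambda>i. (u i + v i) + (- 1) * v i)) < r"
          using that(2) qform_scale_val[of "- 1" v]
          by (intro qform_add_less[of "\<lambda>i. u i + v i" r "\<lambda>i. (- 1) * v i"]) auto
        then show False using that(1) by simp
      qed
      show False
      proof (rule no_anisotropic_ternary[OF r g1(1) g2(1) g3(1)])
        fix x y z :: 'r assume xyz: "\<nu> x \<le> 1" "\<nu> y \<le> 1" "\<nu> z \<le> 1" "\<nu> x = 1 \<or> \<nu> y = 1 \<or> \<nu> z = 1"
        \<comment> \<open>The last unit among the coefficients decides: the terms after it fall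
          below level \<open>r\<close>, and those before it are covered by the choice of its
          generator.\<close>
        show "r \<le> \<nu> (q (\<lambda>i. x * g1 i + y * g2 i + z * g3 i))"
        proof (cases "\<nu> z = 1")
          case True
          have "r \<le> \<nu> (q (\<lambda>i. 1 * (x * g1 i + y * g2 i) + z * g3 i))"
          proof (rule unit_comb_ge[OF _ _ True])
            fix k
            show "r \<le> \<nu> (q (\<lambda>i. g3 i - k * (x * g1 i + y * g2 i)))"
              using g3(2)[of "k * x" "k * y"] by (simp add: algebra_simps)
          qed auto
          then show ?thesis by simp
        next
          case False
          then have z: "\<nu> (q (\<lambda>i. z * g3 i)) < r"
            using xyz(3) by (intro qform_scale_less g3 r) auto
          show ?thesis
          proof (cases "\<nu> y = 1")
            case True
            show ?thesis
              using unit_comb_ge[OF g2(2) xyz(1) True] z by (rule sub)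
          next
            case y: False
            then have "\<nu> (q (\<lambda>i. y * g2 i)) < r"
              using xyz(2) by (intro qform_scale_less g2 r) auto
            moreover have "r \<le> \<nu> (q (\<lambda>i. x * g1 i))"
              using xyz(4) y False g1 by (simp add: qform_scale_val)
            ultimately show ?thesis using z by (intro sub)
          qed
        qed
      qed
    qed
  qed
qed

text \<open>
  Two pairs of generators, at levels \<open>1\<close> and \<open>\<nu> w\<close>, span the lattice \<open>{v. \<nu> (q v) \<le> 1}\<close> modulo \<open>w\<close>.
  In dimension at least 5 some nonzero \<open>c\<close> is orthogonal to all four of them, and by iteration its
  products with lattice vectors are arbitrarily small, hence zero.
\<close>

lemma dimension_le_4: "m \<le> 4"
proof (rule ccontr)
  assume "\<not> m \<le> 4"
  obtain w where w: "0 < \<nu> w" "\<nu> w < 1" "\<And>x. \<nu> x < 1 \<Longrightarrow> \<nu> x \<le> \<nu> w"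
    using uniformizer_ex by blast
  obtain g0 g1 where g01: "\<And>v. \<nu> (q v) \<le> 1 \<Longrightarrow>
      \<exists>x y. \<nu> (q (\<lambda>i. v i - (x * g0 i + y * g1 i))) < 1"
    using two_generators[of 1] by auto
  obtain g2 g3 where g23: "\<And>v. \<nu> (q v) \<le> \<nu> w \<Longrightarrow>
      \<exists>x y. \<nu> (q (\<lambda>i. v i - (x * g2 i + y * g3 i))) < \<nu> w"
    using two_generators[OF w(1)] by auto
  define g where "g = (!) [g0, g1, g2, g3]"
  obtain c where c: "\<exists>i<m. \<nu> (c i) \<noteq> 0" "\<And>j. j < 4 \<Longrightarrow> \<nu> (\<Sum>i<m. 2 * a i * g j i * c i) = 0"
    using homogeneous_system[of "{..<m}" 4 "\<lambda>j i. 2 * a i * g j i"] \<open>\<not> m \<le> 4\<close> by auto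
  have orth: "\<nu> (b c g0) = 0" "\<nu> (b c g1) = 0" "\<nu> (b c g2) = 0" "\<nu> (b c g3) = 0"
    using c(2)[of 0] c(2)[of 1] c(2)[of 2] c(2)[of 3]
    by (simp_all add: bform_def g_def mult_ac)
  have qc: "\<nu> (q c) > 0"
    using anisotropic[of c] c(1) nonneg[of "q c"] by (auto simp: less_le)
  have decay: "\<nu> (b c v) \<le> \<nu> w ^ k * sqrt (\<nu> (q c))" if "\<nu> (q v) \<le> 1" for k v
    using that
  proof (induction k arbitrary: v)
    case 0
    have "(\<nu> (b c v))\<^sup>2 \<le> \<nu> (q c)"
      using bform_sq_le[of c v] 0 mult_left_le[of "\<nu> (q v)" "\<nu> (q c)"] by simp
    then show ?case by (simp add: real_le_rsqrt)
  next
    case (Suc k)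
    obtain x y where xy: "\<nu> (q (\<lambda>i. v i - (x * g0 i + y * g1 i))) < 1"
      using g01[OF Suc.prems] by blast
    define v1 where "v1 = (\<lambda>i. v i - (x * g0 i + y * g1 i))"
    have "\<nu> (q v1) \<le> \<nu> w"
      using xy w(3) by (simp add: v1_def)
    then obtain x' y' where xy': "\<nu> (q (\<lambda>i. v1 i - (x' * g2 i + y' * g3 i))) < \<nu> w"
      using g23 by blast
    define v2 where "v2 = (\<lambda>i. v1 i - (x' * g2 i + y' * g3 i))"
    \<comment> \<open>Since no value lies strictly between \<open>\<nu> w\<close> and 1, the level
      of \<open>v2\<close> is at most \<open>(\<nu> w)\<^sup>2\<close>. Division by \<open>w\<close>
      therefore returns to the lattice, and the induction hypothesis gains a factor
      \<open>\<nu> w\<close>.\<close>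
    have "\<nu> (q v2 * invr w) < 1"
      using xy' w by (simp add: mult nu_invr v2_def)
    then have "\<nu> (q v2) \<le> (\<nu> w)\<^sup>2"
      using w(3)[of "q v2 * invr w"] w(1)
      by (simp add: mult nu_invr pos_divide_le_eq power2_eq_square)
    then have "\<nu> (q (\<lambda>i. invr w * v2 i)) \<le> 1"
      using w(1) by (simp add: qform_scale_val nu_invr power_divide)
    then have "\<nu> (b c (\<lambda>i. invr w * v2 i)) \<le> \<nu> w ^ k * sqrt (\<nu> (q c))"
      by (rule Suc.IH)
    moreover have "b c (\<lambda>i. invr w * v2 i) = invr w * b c v2"
      using bform_comb[of a m c "invr w" v2 0 v2] by simp
    ultimately have "\<nu> (b c v2) \<le> \<nu> w ^ Suc k * sqrt (\<nu> (q c))"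
      using w(1) by (simp add: mult nu_invr field_simps)
    moreover have "\<nu> (b c v - b c v2) = 0"
    proof -
      have "b c (\<lambda>i. 1 * v i + (- 1) * v2 i)
          = b c (\<lambda>i. 1 * (x * g0 i + y * g1 i) + 1 * (x' * g2 i + y' * g3 i))"
        by (rule arg_cong[where f = "b c"]) (auto simp: v1_def v2_def)
      then have "b c v - b c v2 = x * b c g0 + y * b c g1 + (x' * b c g2 + y' * b c g3)"
        unfolding bform_comb by simp
      then show ?thesis
        using orth by (auto intro!: zero_add simp: mult)
    qed
    ultimately show ?case using eq_if_diff_zero by metis
  qed
  \<comment> \<open>A multiple \<open>w ^ N * c\<close> lies in the lattice, yet its product with
    \<open>c\<close> is \<open>2 * w ^ N * q c\<close>, which is not null.\<close>
  obtain N where N: "(\<nu> w)\<^sup>2 ^ N < 1 / \<nu> (q c)"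
    using real_arch_pow_inv[of "1 / \<nu> (q c)" "(\<nu> w)\<^sup>2"] qc w by (auto simp: power_less_one_iff)
  define v where "v = (\<lambda>i. w ^ N * c i)"
  have "\<nu> (q v) \<le> 1"
    unfolding v_def qform_scale_val power
    using N qc by (simp add: field_simps flip: power_mult)
  have "\<nu> (b c v) \<le> e" if "e > 0" for e
  proof -
    have "(\<lambda>k. \<nu> w ^ k * sqrt (\<nu> (q c))) \<longlonglongrightarrow> 0"
      using w by (intro tendsto_mult_left_zero LIMSEQ_realpow_zero) auto
    then obtain k where "\<nu> w ^ k * sqrt (\<nu> (q c)) < e"
      using LIMSEQ_0_less[OF _ \<open>e > 0\<close>] by (metis order_refl)
    then show ?thesis using decay[OF \<open>\<nu> (q v) \<le> 1\<close>, of k] by simp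
  qed
  then have "\<nu> (b c v) \<le> 0"
    by (metis dense not_le order_less_imp_le)
  moreover have "b c v = w ^ N * (2 * q c)"
    using bform_comb[of a m c "w ^ N" c 0 c] by (simp add: v_def bform_self)
  ultimately show False
    using qc zero_less_power[OF w(1), of N] two nonneg[of 2] by (simp add: mult power mult_le_0_iff)
qed

end

theorem quinary_form_isotropic: "\<exists>v. \<nu> (qform a 5 v) = 0 \<and> (\<exists>i<5. \<nu> (v i) \<noteq> 0)"
  using dimension_le_4[of a 5] by force

end

section \<open>The spectral valuation\<close>

lemma scale_into_unit_interval:
  fixes \<rho> x :: real
  assumes "0 < \<rho>" "\<rho> < 1" "0 < x"
  shows "\<exists>n. \<rho> < \<rho> ^ n * x \<and> \<rho> ^ n * x \<le> 1 \<or> \<rho> < x / \<rho> ^ n \<and> x / \<rho> ^ n \<le> 1"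
proof (cases "x \<le> 1")
  case True
  define n where "n = (LEAST n. \<rho> ^ n < x)"
  have "\<exists>n. \<rho> ^ n < x"
    using real_arch_pow_inv assms by blast
  then have n: "\<rho> ^ n < x" unfolding n_def by (rule LeastI_ex)
  then have "n \<noteq> 0" using True by (intro notI) simp
  then obtain k where k: "n = Suc k" by (cases n) auto
  have "\<not> \<rho> ^ k < x"
    using not_less_Least[of k "\<lambda>n. \<rho> ^ n < x"] k by (simp add: n_def)
  then show ?thesis
    using n k assms by (intro exI[of _ k]) (simp add: field_simps)
next
  case False
  define n where "n = (LEAST n. \<rho> ^ n * x \<le> 1)"
  obtain j where "\<rho> ^ j < 1 / x"
    using real_arch_pow_inv[of "1 / x" \<rho>] assms by auto
  then have "\<rho> ^ j * x \<le> 1"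
    using assms by (simp add: field_simps)
  then have n: "\<rho> ^ n * x \<le> 1" unfolding n_def by (rule LeastI)
  then have "n \<noteq> 0" using False by (intro notI) simp
  then obtain k where k: "n = Suc k" by (cases n) auto
  have "\<not> \<rho> ^ k * x \<le> 1"
    using not_less_Least[of k "\<lambda>n. \<rho> ^ n * x \<le> 1"] k by (simp add: n_def)
  then have "\<rho> < \<rho> ^ n * x"
    using k assms mult_strict_left_mono[of 1 "\<rho> ^ k * x" \<rho>] by (simp add: mult_ac)
  then show ?thesis using n by blast
qed

text \<open>The model is the polynomial ring with a multiple of the Gauss norm of the remainder
  modulo \<open>q\<close>. Powers of \<open>c\<close> and \<open>d\<close> rescale exactly, so
  compactness arguments can be confined to the annulus between \<rho> and 1.\<close>

locale compact_normed_ring = ultranorm s for s :: "'r::comm_ring_1 \<Rightarrow> real" +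
  fixes c d :: 'r and \<rho> :: real
  assumes submult: "s (x * y) \<le> s x * s y"
    and one_nonzero: "s 1 \<noteq> 0"
    and two_nonzero: "s 2 \<noteq> 0"
    and inverse_ex: "s x \<noteq> 0 \<Longrightarrow> \<exists>y. s (x * y - 1) = 0"
    and complete: "complete_on UNIV"
    and totally_bounded: "totally_bounded_on UNIV"
    and cd: "c * d = 1"
    and s_c: "s (c * x) = \<rho> * s x"
    and \<rho>: "0 < \<rho>" "\<rho> < 1"
begin

lemma zero_mult: "s x = 0 \<Longrightarrow> s (x * y) = 0" "s x = 0 \<Longrightarrow> s (y * x) = 0"
  using submult[of x y] submult[of y x] nonneg[of "x * y"] nonneg[of "y * x"] by auto

lemma zero_add: "s x = 0 \<Longrightarrow> s y = 0 \<Longrightarrow> s (x + y) = 0"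
  using add[of x y] nonneg[of "x + y"] by simp

lemma power_le: "s (x ^ k) \<le> s 1 * s x ^ k"
proof (induction k)
  case (Suc k)
  have "s (x ^ Suc k) \<le> s x * s (x ^ k)"
    using submult by simp
  also have "\<dots> \<le> s x * (s 1 * s x ^ k)"
    using Suc by (intro mult_left_mono) auto
  finally show ?case by (simp add: mult_ac)
qed simp

lemma zero_power_diff_1:
  assumes "s (x - 1) = 0"
  shows "s (x ^ k - 1) = 0"
proof (induction k)
  case (Suc k)
  have "x ^ Suc k - 1 = (x - 1) * x ^ k + (x ^ k - 1)"
    by (simp add: algebra_simps)
  then show ?case using Suc assms by (metis zero_add zero_mult(1))
qed simp

definition scaling :: "'r \<Rightarrow> 'r \<Rightarrow> real \<Rightarrow> bool" where
  "scaling e e' t \<longleftrightarrow> e * e' = 1 \<and> 0 < t \<and> (\<forall>z. s (e * z) = t * s z)"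

lemma scaling_c: "scaling c d \<rho>"
  using cd s_c \<rho> by (simp add: scaling_def)

lemma scaling_sym: "scaling e e' t \<Longrightarrow> scaling e' e (1 / t)"
proof -
  assume *: "scaling e e' t"
  have "s (e' * z) = 1 / t * s z" for z
  proof -
    have "e * (e' * z) = z" using * by (simp add: scaling_def flip: mult.assoc)
    then have "s z = t * s (e' * z)" using * unfolding scaling_def by metis
    then show ?thesis using * by (simp add: scaling_def)
  qed
  then show ?thesis using * by (simp add: scaling_def mult.commute)
qed

lemma scaling_mult: "scaling e e' t \<Longrightarrow> scaling f f' u \<Longrightarrow> scaling (e * f) (f' * e') (t * u)"
  unfolding scaling_def
  by (metis (no_types, opaque_lifting) mult.assoc mult.commute mult_1 mult_pos_pos)

lemma scaling_power: "scaling e e' t \<Longrightarrow> scaling (e ^ n) (e' ^ n) (t ^ n)"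
proof (induction n)
  case 0
  then show ?case by (simp add: scaling_def)
next
  case (Suc n)
  then show ?case
    using scaling_mult[OF Suc.prems Suc.IH[OF Suc.prems]] by (simp add: mult.commute)
qed

lemma scaling_ex:
  assumes "0 < x"
  obtains e e' t where "scaling e e' t" "\<rho> < t * x" "t * x \<le> 1"
proof -
  obtain n where "\<rho> < \<rho> ^ n * x \<and> \<rho> ^ n * x \<le> 1 \<or> \<rho> < x / \<rho> ^ n \<and> x / \<rho> ^ n \<le> 1"
    using scale_into_unit_interval[OF \<rho> assms] by blast
  then show ?thesis
    using that[OF scaling_power[OF scaling_c, of n]]
      that[OF scaling_sym[OF scaling_power[OF scaling_c, of n]]] by auto
qed

section \<open>Power-bounded elements\<close>

definition power_bounded :: "'r \<Rightarrow> bool" where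
  "power_bounded x \<longleftrightarrow> (\<exists>B. \<forall>k. s (x ^ k) \<le> B)"

text \<open>
  A nonzero vector with bounded orbit under \<open>\<alpha>\<close> would make \<open>1\<close> a vector with bounded orbit.  So all
  nonzero vectors eventually grow, by compactness after a bounded number of steps.
\<close>

lemma growth:
  assumes "\<not> power_bounded \<alpha>"
  obtains K where "\<And>x. \<exists>k\<in>{1..K}. s x \<le> s (\<alpha> ^ k * x)"
proof -
  have "\<exists>K. \<forall>x. \<rho> < s x \<longrightarrow> s x \<le> 1 \<longrightarrow> (\<exists>k\<le>K. 1 < s (\<alpha> ^ k * x))"
  proof (rule ccontr)
    assume "\<not> ?thesis"
    then have "\<forall>K. \<exists>x. \<rho> < s x \<and> s x \<le> 1 \<and> (\<forall>k\<le>K. s (\<alpha> ^ k * x) \<le> 1)"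
      by (meson not_le)
    then obtain X where X: "\<And>K. \<rho> < s (X K)" "\<And>K. s (X K) \<le> 1"
        "\<And>K k. k \<le> K \<Longrightarrow> s (\<alpha> ^ k * X K) \<le> 1"
      by metis
    \<comment> \<open>Vectors whose orbits stay bounded for longer and longer accumulate at a vector
      \<open>L\<close> whose whole orbit is bounded. It is not null, as every \<open>X k\<close>
      stays outside the ball of radius \<rho>.\<close>
    obtain L where L: "\<forall>e>0. \<forall>n. \<exists>k\<ge>n. s (X k - L) < e"
      using cluster_point[OF complete totally_bounded, of X 1] X(2) by auto
    obtain k where "s (X k - L) < \<rho>"
      using L \<rho>(1) by blast
    then have "s L \<noteq> 0"
      using X(1)[of k] eq_if_diff_less[of "X k" L] \<rho> by simp
    then obtain y where y: "s (L * y - 1) = 0"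
      using inverse_ex by blast
    have orbit: "s (\<alpha> ^ j * L) \<le> 1" for j
    proof -
      define e where "e = 1 / (s (\<alpha> ^ j) + 1)"
      have e: "e > 0" "s (\<alpha> ^ j) * e \<le> 1"
        using nonneg[of "\<alpha> ^ j"] by (simp_all add: e_def add_nonneg_pos)
      obtain k where k: "k \<ge> j" "s (X k - L) < e"
        using L e(1) by blast
      have "s (\<alpha> ^ j * (X k - L)) \<le> s (\<alpha> ^ j) * e"
        using submult[of "\<alpha> ^ j" "X k - L"] k(2) mult_left_mono[of "s (X k - L)" e "s (\<alpha> ^ j)"] by simp
      then have "s (\<alpha> ^ j * X k - \<alpha> ^ j * (X k - L)) \<le> 1"
        using e X(3)[OF k(1)] by (intro diff_le) auto
      then show ?thesis by (simp add: algebra_simps)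
    qed
    have "s (\<alpha> ^ j) \<le> s y" for j
    proof -
      have "s (\<alpha> ^ j * L * y - \<alpha> ^ j) = 0"
        using zero_mult(2)[OF y, of "\<alpha> ^ j"] by (simp add: algebra_simps)
      then have "s (\<alpha> ^ j) = s (\<alpha> ^ j * L * y)"
        using eq_if_diff_zero by metis
      also have "\<dots> \<le> s (\<alpha> ^ j * L) * s y"
        by (rule submult)
      also have "\<dots> \<le> 1 * s y"
        using orbit by (intro mult_right_mono) auto
      finally show ?thesis by simp
    qed
    then show False
      using assms by (auto simp: power_bounded_def)
  qed
  then obtain K where K: "\<And>x. \<rho> < s x \<Longrightarrow> s x \<le> 1 \<Longrightarrow> \<exists>k\<le>K. 1 < s (\<alpha> ^ k * x)"
    by blast
  have "\<exists>k\<in>{1..Suc K}. s x \<le> s (\<alpha> ^ k * x)" for x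
  proof (cases "s x = 0")
    case True
    then show ?thesis by (intro bexI[of _ 1]) auto
  next
    case False
    then have "0 < s x" using nonneg[of x] by linarith
    then obtain e e' t where e: "scaling e e' t" "\<rho> < t * s x" "t * s x \<le> 1"
      by (rule scaling_ex)
    then have t: "0 < t" "\<And>z. s (e * z) = t * s z"
      by (auto simp: scaling_def)
    obtain k where k: "k \<le> K" "1 < s (\<alpha> ^ k * (e * x))"
      using K[of "e * x"] e t by auto
    have "s (\<alpha> ^ k * (e * x)) = t * s (\<alpha> ^ k * x)"
      using t(2)[of "\<alpha> ^ k * x"] by (simp add: mult.left_commute)
    then have "t * s x < t * s (\<alpha> ^ k * x)"
      using k(2) e(3) by simp
    then have "s x < s (\<alpha> ^ k * x)"
      using t(1) by simp
    moreover have "k \<noteq> 0"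
      using \<open>s x < s (\<alpha> ^ k * x)\<close> by (intro notI) simp
    ultimately show ?thesis
      using k(1) by (intro bexI[of _ k]) auto
  qed
  then show ?thesis using that by blast
qed

text \<open>Growth under \<beta> bounds \<open>s (\<alpha> ^ n)\<close> by
  \<open>s (\<alpha> ^ (n - k))\<close> for some \<open>k\<close> between 1 and \<open>K\<close>, so
  the powers of \<alpha> descend to exponents at most \<open>K\<close>. This dichotomy replaces the
  fact that a valuation ring contains an element or its inverse.\<close>

lemma power_bounded_or_inverse:
  assumes "s (\<alpha> * \<beta> - 1) = 0"
  shows "power_bounded \<alpha> \<or> power_bounded \<beta>"
proof (rule disjCI)
  assume "\<not> power_bounded \<beta>"
  then obtain K where K: "\<And>x. \<exists>k\<in>{1..K}. s x \<le> s (\<beta> ^ k * x)"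
    using growth by blast
  define D where "D = (\<Sum>j\<le>K. s (\<alpha> ^ j))"
  have D: "s (\<alpha> ^ j) \<le> D" if "j \<le> K" for j
    unfolding D_def using that by (intro member_le_sum) auto
  have "s (\<alpha> ^ n) \<le> D" for n
  proof (induction n rule: less_induct)
    case (less n)
    obtain k where k: "k \<in> {1..K}" "s (\<alpha> ^ n) \<le> s (\<beta> ^ k * \<alpha> ^ n)"
      using K by blast
    show ?case
    proof (cases "k \<le> n")
      case True
      have "s ((\<alpha> * \<beta>) ^ k * \<alpha> ^ (n - k) - \<alpha> ^ (n - k)) = 0"
        using zero_mult(1)[OF zero_power_diff_1[OF assms, of k], of "\<alpha> ^ (n - k)"]
        by (simp add: algebra_simps)
      moreover have "(\<alpha> * \<beta>) ^ k * \<alpha> ^ (n - k) = \<beta> ^ k * \<alpha> ^ n"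
        using True power_add[of \<alpha> k "n - k"] by (simp add: power_mult_distrib mult_ac)
      ultimately have "s (\<beta> ^ k * \<alpha> ^ n) = s (\<alpha> ^ (n - k))"
        using eq_if_diff_zero by metis
      then show ?thesis
        using k less.IH[of "n - k"] True by auto
    next
      case False
      then show ?thesis using k(1) by (intro D) auto
    qed
  qed
  then show "power_bounded \<alpha>"
    by (auto simp: power_bounded_def)
qed

section \<open>The spectral radius as a multiplicative valuation\<close>

definition dominates :: "real \<Rightarrow> 'r \<Rightarrow> bool" where
  "dominates r x \<longleftrightarrow> 0 < r \<and> (\<exists>B. \<forall>k. s (x ^ k) \<le> B * r ^ k)"

text \<open>The spectral radius, usually the limit of the \<open>k\<close>-th roots of
  \<open>s (x ^ k)\<close>; as an infimum of growth rates it is defined without proving that limit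
  to exist.\<close>

definition spectral :: "'r \<Rightarrow> real" where
  "spectral x = Inf {r. dominates r x}"

lemma dominatesE:
  assumes "dominates r x"
  obtains B where "0 \<le> B" "\<And>k. s (x ^ k) \<le> B * r ^ k"
proof -
  obtain B where B: "\<And>k. s (x ^ k) \<le> B * r ^ k"
    using assms by (auto simp: dominates_def)
  have "0 \<le> B" using order_trans[OF nonneg B[of 0]] by simp
  with B show ?thesis using that by blast
qed

lemma dominates_mono:
  assumes "dominates r x" "r \<le> r'"
  shows "dominates r' x"
proof -
  obtain B where B: "0 \<le> B" "\<And>k. s (x ^ k) \<le> B * r ^ k"
    using assms(1) by (rule dominatesE) blast
  have r: "0 < r" using assms(1) by (simp add: dominates_def)
  have "s (x ^ k) \<le> B * r' ^ k" for k
    using B(2)[of k] mult_left_mono[OF power_mono[OF assms(2), of k] B(1)] r by linarith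
  then show ?thesis using assms(2) r by (auto simp: dominates_def)
qed

lemma dominates_norm:
  assumes "0 < r" "s x \<le> r"
  shows "dominates r x"
proof -
  have "s (x ^ k) \<le> s 1 * r ^ k" for k
    using power_le[of x k] mult_left_mono[OF power_mono[OF assms(2), of k], of "s 1"] by simp
  then show ?thesis using assms(1) by (auto simp: dominates_def)
qed

lemma dominates_bdd_below: "bdd_below {r. dominates r x}"
  by (rule bdd_belowI[of _ 0]) (auto simp: dominates_def)

lemma dominates_ne: "{r. dominates r x} \<noteq> {}"
  using dominates_norm[of "s x + 1" x] nonneg[of x] by auto

lemma spectral_le: "dominates r x \<Longrightarrow> spectral x \<le> r"
  unfolding spectral_def by (rule cInf_lower) (auto intro: dominates_bdd_below)

lemma dominates_if_spectral_less: "spectral x < r \<Longrightarrow> dominates r x"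
  unfolding spectral_def
  using cInf_lessD[OF dominates_ne] dominates_mono by (metis less_imp_le mem_Collect_eq)

lemma spectral_nonneg: "0 \<le> spectral x"
  unfolding spectral_def by (rule cInf_greatest[OF dominates_ne]) (simp add: dominates_def)

lemma spectral_le_norm: "spectral x \<le> s x"
proof (rule field_le_epsilon)
  fix e :: real assume "e > 0"
  then show "spectral x \<le> s x + e"
    by (intro spectral_le dominates_norm) (auto intro: add_nonneg_pos)
qed

lemma spectral_1: "spectral 1 = 1"
proof (rule antisym)
  show "spectral 1 \<le> 1"
    by (rule spectral_le) (auto simp: dominates_def)
  show "1 \<le> spectral 1"
    unfolding spectral_def
  proof (rule cInf_greatest[OF dominates_ne], rule ccontr)
    fix r assume r: "r \<in> {r. dominates r 1}" "\<not> 1 \<le> r"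
    then obtain B where B: "\<And>k. s 1 \<le> B * r ^ k"
      using dominatesE[of r 1] by auto
    have "(\<lambda>k. B * r ^ k) \<longlonglongrightarrow> 0"
      using r by (intro tendsto_mult_right_zero LIMSEQ_realpow_zero) (auto simp: dominates_def)
    then have "s 1 \<le> 0"
      using B by (intro LIMSEQ_le_const) auto
    then show False using one_nonzero nonneg[of 1] by simp
  qed
qed

lemma norm_of_nat_mult_le: "s (of_nat n * x) \<le> s x"
  by (induction n) (auto simp: algebra_simps intro: add_le)

text \<open>Binomial coefficients do not increase an ultrametric norm, so every term of the
  expansion has growth rate \<open>r\<close>.\<close>

lemma dominates_add:
  assumes "dominates r x" "dominates r y"
  shows "dominates r (x + y)"
proof -
  obtain B where B: "0 \<le> B" "\<And>k. s (x ^ k) \<le> B * r ^ k"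
    using assms(1) by (rule dominatesE) blast
  obtain C where C: "0 \<le> C" "\<And>k. s (y ^ k) \<le> C * r ^ k"
    using assms(2) by (rule dominatesE) blast
  have r: "0 < r" using assms(1) by (simp add: dominates_def)
  have "s ((x + y) ^ k) \<le> (B * C) * r ^ k" for k
    unfolding binomial_ring
  proof (rule sum_le)
    fix i assume i: "i \<in> {..k}"
    have "s (of_nat (k choose i) * x ^ i * y ^ (k - i)) \<le> s (x ^ i * y ^ (k - i))"
      using norm_of_nat_mult_le[of "k choose i" "x ^ i * y ^ (k - i)"] by (simp add: mult.assoc)
    also have "\<dots> \<le> s (x ^ i) * s (y ^ (k - i))"
      by (rule submult)
    also have "\<dots> \<le> (B * r ^ i) * (C * r ^ (k - i))"
      using B C r by (intro mult_mono) auto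
    also have "\<dots> = (B * C) * r ^ k"
      using i by (simp flip: power_add)
    finally show "s (of_nat (k choose i) * x ^ i * y ^ (k - i)) \<le> (B * C) * r ^ k" .
  qed (use B C r in auto)
  then show ?thesis using r by (auto simp: dominates_def)
qed

lemma dominates_minus: "dominates r x \<Longrightarrow> dominates r (- x)"
proof -
  have "s ((- x) ^ k) = s (x ^ k)" for k
    by (cases "even k") simp_all
  then show "dominates r x \<Longrightarrow> dominates r (- x)"
    by (simp add: dominates_def)
qed

lemma ultranorm_spectral: "ultranorm spectral"
proof
  show "0 \<le> spectral x" for x by (rule spectral_nonneg)
  show "spectral 0 = 0" using spectral_le_norm[of 0] spectral_nonneg[of 0] by simp
  show "spectral (x - y) \<le> max (spectral x) (spectral y)" for x y
  proof (rule dense_ge)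
    fix r assume "max (spectral x) (spectral y) < r"
    then have "dominates r x" "dominates r (- y)"
      by (auto intro: dominates_minus dominates_if_spectral_less)
    then show "spectral (x - y) \<le> r"
      using dominates_add[of r x "- y"] by (intro spectral_le) simp
  qed
qed

lemma spectral_submult: "spectral (x * y) \<le> spectral x * spectral y"
proof -
  have "spectral (x * y) \<le> r * t" if "spectral x < r" "spectral y < t" for r t
  proof -
    have d: "dominates r x" "dominates t y"
      using that by (auto intro: dominates_if_spectral_less)
    obtain B where B: "0 \<le> B" "\<And>k. s (x ^ k) \<le> B * r ^ k"
      using d(1) by (rule dominatesE) blast
    obtain C where C: "0 \<le> C" "\<And>k. s (y ^ k) \<le> C * t ^ k"
      using d(2) by (rule dominatesE) blast
    have "s ((x * y) ^ k) \<le> (B * C) * (r * t) ^ k" for k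
    proof -
      have "s ((x * y) ^ k) \<le> s (x ^ k) * s (y ^ k)"
        unfolding power_mult_distrib by (rule submult)
      also have "\<dots> \<le> (B * r ^ k) * (C * t ^ k)"
        using B C d by (intro mult_mono) (auto simp: dominates_def)
      finally show ?thesis by (simp add: power_mult_distrib mult_ac)
    qed
    then show ?thesis
      using d by (intro spectral_le) (auto simp: dominates_def)
  qed
  then have *: "spectral (x * y) \<le> (spectral x + inverse (real (Suc n))) * (spectral y + inverse (real (Suc n)))" for n
    by simp
  have "(\<lambda>n. (spectral x + inverse (real (Suc n))) * (spectral y + inverse (real (Suc n))))
      \<longlonglongrightarrow> (spectral x + 0) * (spectral y + 0)"
    by (intro tendsto_intros LIMSEQ_inverse_real_of_nat)
  then show ?thesis
    using * by (intro LIMSEQ_le_const[of _ "spectral x * spectral y"]) auto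
qed

lemma spectral_scaling:
  assumes "scaling e e' t"
  shows "spectral (e * x) = t * spectral x"
proof -
  have le: "spectral (e * x) \<le> t * spectral x" if e: "scaling e e' t" for e e' t x
  proof (rule ccontr)
    have t: "0 < t" using e by (simp add: scaling_def)
    assume "\<not> ?thesis"
    then have "spectral x < spectral (e * x) / t"
      using t by (simp add: field_simps)
    then obtain r where r: "spectral x < r" "r < spectral (e * x) / t"
      using dense by blast
    have d: "dominates r x" by (rule dominates_if_spectral_less[OF r(1)])
    obtain B where B: "0 \<le> B" "\<And>k. s (x ^ k) \<le> B * r ^ k"
      using d by (rule dominatesE) blast
    have "s ((e * x) ^ k) \<le> B * (t * r) ^ k" for k
    proof -
      have "s ((e * x) ^ k) = t ^ k * s (x ^ k)"
        using scaling_power[OF e, of k] by (simp add: power_mult_distrib scaling_def)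
      then show ?thesis
        using t mult_left_mono[OF B(2)[of k], of "t ^ k"] by (simp add: power_mult_distrib mult_ac)
    qed
    then have "dominates (t * r) (e * x)"
      using t d by (auto simp: dominates_def)
    then have "spectral (e * x) \<le> t * r" by (rule spectral_le)
    then show False using r(2) t by (simp add: field_simps)
  qed
  have t: "0 < t" and ee: "e * e' = 1" using assms by (auto simp: scaling_def)
  have "e' * (e * x) = x" using ee by (metis mult.assoc mult.commute mult_1)
  then have "spectral x \<le> 1 / t * spectral (e * x)"
    using le[OF scaling_sym[OF assms], of "e * x"] by simp
  then have "t * spectral x \<le> spectral (e * x)"
    using t by (simp add: field_simps)
  then show ?thesis using le[OF assms, of x] by simp
qed

text \<open>A growth rate of the powers of \<open>x ^ n\<close> extends to all powers of
  \<open>x\<close>, since only finitely many remainders of exponents modulo \<open>n\<close>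
  occur.\<close>

lemma spectral_power_ge:
  assumes "0 < n"
  shows "spectral x ^ n \<le> spectral (x ^ n)"
proof (rule ccontr)
  assume "\<not> ?thesis"
  then obtain R where R: "spectral (x ^ n) < R" "R < spectral x ^ n"
    using dense not_le by metis
  have d: "dominates R (x ^ n)" by (rule dominates_if_spectral_less[OF R(1)])
  have "0 < R" using d by (simp add: dominates_def)
  obtain r where r: "0 < r" "r ^ n = R"
    using realpow_pos_nth[OF assms \<open>0 < R\<close>] by blast
  obtain B where B: "0 \<le> B" "\<And>k. s ((x ^ n) ^ k) \<le> B * R ^ k"
    using d by (rule dominatesE) blast
  define S where "S = (\<Sum>i<n. s (x ^ i) / r ^ i)"
  have "s (x ^ j) \<le> (B * S) * r ^ j" for j
  proof -
    define i k where "i = j mod n" and "k = j div n"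
    have j: "j = n * k + i" "i < n" using assms by (auto simp: i_def k_def)
    have "s (x ^ i) / r ^ i \<le> S"
      unfolding S_def using j(2) r(1) by (intro member_le_sum) auto
    then have i: "s (x ^ i) \<le> S * r ^ i"
      using r(1) by (simp add: field_simps)
    have "s (x ^ j) \<le> s ((x ^ n) ^ k) * s (x ^ i)"
      unfolding j(1) power_add power_mult by (rule submult)
    also have "\<dots> \<le> (B * R ^ k) * (S * r ^ i)"
      using B i \<open>0 < R\<close> by (intro mult_mono) auto
    also have "\<dots> = (B * S) * r ^ j"
      unfolding j(1) power_add power_mult r(2) by (simp add: mult_ac)
    finally show ?thesis .
  qed
  then have "dominates r x" using r(1) by (auto simp: dominates_def)
  then have "spectral x \<le> r" by (rule spectral_le)
  then have "spectral x ^ n \<le> R"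
    using r spectral_nonneg[of x] power_mono by blast
  then show False using R(2) by simp
qed

text \<open>Scaling factors form a geometric progression of ratio \<rho>. If the product exceeded 1,
  some power of it would exceed \<open>1 / \<rho>\<close>, leaving room for a factor that lifts a
  multiple of \<open>\<alpha> ^ n\<close> and the inverse multiple of \<open>\<beta> ^ n\<close>
  both above 1, against \<open>power_bounded_or_inverse\<close>.\<close>

lemma spectral_inverse:
  assumes "s (\<alpha> * \<beta> - 1) = 0"
  shows "spectral \<alpha> * spectral \<beta> \<le> 1"
proof (rule ccontr)
  assume "\<not> ?thesis"
  then have gt: "1 < spectral \<alpha> * spectral \<beta>" by simp
  obtain n where n: "1 / \<rho> < (spectral \<alpha> * spectral \<beta>) ^ n"
    using real_arch_pow[OF gt] by blast
  have "n \<noteq> 0" using n \<rho> by (intro notI) simp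
  define a b where "a = spectral (\<alpha> ^ n)" and "b = spectral (\<beta> ^ n)"
  have "(spectral \<alpha> * spectral \<beta>) ^ n \<le> a * b"
    unfolding power_mult_distrib a_def b_def using \<open>n \<noteq> 0\<close>
    by (intro mult_mono spectral_power_ge) (auto simp: spectral_nonneg)
  with n have "1 / \<rho> < a * b" by simp
  then have ab: "1 < \<rho> * (a * b)"
    using \<rho> by (simp add: field_simps)
  have "0 \<le> a" "0 \<le> b" by (simp_all add: a_def b_def spectral_nonneg)
  moreover have "a \<noteq> 0" using ab by (intro notI) simp
  ultimately have "0 < a" by simp
  obtain e e' t where e: "scaling e e' t" "\<rho> < t * a" "t * a \<le> 1"
    using \<open>0 < a\<close> by (rule scaling_ex)
  have t: "0 < t" using e by (simp add: scaling_def)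
  \<comment> \<open>The extra factor \<open>d\<close> moves the value \<open>t * a\<close> from the
    annulus to just above 1; by \<open>ab\<close> the reciprocal factor still leaves
    \<open>b\<close> above 1.\<close>
  define f f' where "f = e * d" and "f' = c * e'"
  have f: "scaling f f' (t * (1 / \<rho>))"
    unfolding f_def f'_def by (rule scaling_mult[OF e(1) scaling_sym[OF scaling_c]])
  have "1 < spectral (f * \<alpha> ^ n)"
    unfolding spectral_scaling[OF f] a_def[symmetric] using e(2) \<rho> by (simp add: field_simps)
  moreover have "1 < spectral (f' * \<beta> ^ n)"
  proof -
    have "t * a \<le> 1" by (rule e(3))
    also have "1 < \<rho> * (a * b)" by (rule ab)
    finally have "t < \<rho> * b" using \<open>0 < a\<close> by simp
    then show ?thesis
      unfolding spectral_scaling[OF scaling_sym[OF f]] b_def[symmetric] using t \<rho>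
      by (simp add: field_simps)
  qed
  moreover have "f * f' = 1" using f by (simp add: scaling_def)
  then have "f * \<alpha> ^ n * (f' * \<beta> ^ n) = (\<alpha> * \<beta>) ^ n"
    by (metis (no_types, lifting) mult.assoc mult.left_commute mult_1 power_mult_distrib)
  then have "s (f * \<alpha> ^ n * (f' * \<beta> ^ n) - 1) = 0"
    using zero_power_diff_1[OF assms] by simp
  then have "power_bounded (f * \<alpha> ^ n) \<or> power_bounded (f' * \<beta> ^ n)"
    by (rule power_bounded_or_inverse)
  moreover have "spectral x \<le> 1" if "power_bounded x" for x
    using that by (intro spectral_le) (simp add: power_bounded_def dominates_def)
  ultimately show False by fastforce
qed

lemma spectral_zero_iff: "spectral x = 0 \<longleftrightarrow> s x = 0"
proof
  show "s x = 0 \<Longrightarrow> spectral x = 0"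
    using spectral_le_norm[of x] spectral_nonneg[of x] by simp
  assume x: "spectral x = 0"
  show "s x = 0"
  proof (rule ccontr)
    assume "s x \<noteq> 0"
    then obtain y where y: "s (x * y - 1) = 0" using inverse_ex by blast
    then have "spectral (x * y - 1) = 0"
      using spectral_le_norm[of "x * y - 1"] spectral_nonneg[of "x * y - 1"] by simp
    then have "spectral (x * y) = 1"
      using ultranorm.eq_if_diff_zero[OF ultranorm_spectral] spectral_1 by metis
    then show False using spectral_submult[of x y] x by simp
  qed
qed

text \<open>Multiplication by an inverse \<open>z\<close> of \<open>y\<close> recovers
  \<open>x\<close>, so \<open>spectral_inverse\<close> turns submultiplicativity around.\<close>

lemma spectral_mult: "spectral (x * y) = spectral x * spectral y"
proof (cases "s y = 0")
  case True
  then have "spectral (x * y) = 0" "spectral y = 0"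
    by (simp_all add: zero_mult(2) spectral_zero_iff)
  then show ?thesis by simp
next
  case False
  obtain z where z: "s (y * z - 1) = 0" using inverse_ex[OF False] by blast
  have "s (x * y * z - x) = 0"
    using zero_mult(2)[OF z, of x] by (simp add: algebra_simps)
  then have "spectral (x * y * z) = spectral x"
    using ultranorm.eq_if_diff_zero[OF ultranorm_spectral] spectral_zero_iff by metis
  then have "spectral x \<le> spectral (x * y) * spectral z"
    using spectral_submult[of "x * y" z] by simp
  then have "spectral x * spectral y \<le> spectral (x * y) * spectral z * spectral y"
    by (intro mult_right_mono) (auto simp: spectral_nonneg)
  also have "\<dots> \<le> spectral (x * y)"
    using mult_left_mono[OF spectral_inverse[OF z] spectral_nonneg[of "x * y"]] by (simp add: mult_ac)
  finally show ?thesis using spectral_submult[of x y] by simp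
qed

text \<open>On the annulus the spectral radius is bounded away from zero: a cluster point of vectors
  violating this would have spectral radius 0 without being null. The bound carries completeness and
  total boundedness over to \<open>spectral\<close>.\<close>

lemma norm_le_spectral:
  obtains C where "0 < C" "\<And>x. s x \<le> C * spectral x"
proof -
  interpret sp: ultranorm spectral by (rule ultranorm_spectral)
  have "\<exists>n::nat. \<forall>x. \<rho> < s x \<longrightarrow> s x \<le> 1 \<longrightarrow> inverse (real (Suc n)) \<le> spectral x"
  proof (rule ccontr)
    assume "\<not> ?thesis"
    then have "\<forall>n. \<exists>x. \<rho> < s x \<and> s x \<le> 1 \<and> spectral x < inverse (real (Suc n))"
      by (meson not_le)
    then obtain X where X: "\<And>n. \<rho> < s (X n)" "\<And>n. s (X n) \<le> 1"
        "\<And>n. spectral (X n) < inverse (real (Suc n))"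
      by metis
    obtain L where L: "\<forall>e>0. \<forall>n. \<exists>k\<ge>n. s (X k - L) < e"
      using cluster_point[OF complete totally_bounded, of X 1] X(2) by auto
    obtain k where "s (X k - L) < \<rho>"
      using L \<rho>(1) by blast
    then have "s L \<noteq> 0"
      using X(1)[of k] eq_if_diff_less[of "X k" L] \<rho> by simp
    moreover have "spectral L \<le> e" if "e > 0" for e
    proof -
      obtain n where n: "inverse (real (Suc n)) < e"
        using reals_Archimedean[OF \<open>e > 0\<close>] by blast
      obtain k where k: "k \<ge> n" "s (X k - L) < e"
        using L \<open>e > 0\<close> by blast
      have "spectral (X k) \<le> e"
        using X(3)[of k] n k(1) by (smt (verit) inverse_le_iff_le of_nat_0_less_iff of_nat_mono zero_less_Suc Suc_le_mono)
      moreover have "spectral (X k - L) \<le> e"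
        using spectral_le_norm[of "X k - L"] k(2) by simp
      ultimately show ?thesis using sp.diff_le[of "X k" e "X k - L"] by simp
    qed
    then have "spectral L \<le> 0" by (metis dense not_le order_less_imp_le)
    ultimately show False
      using spectral_zero_iff spectral_nonneg[of L] by simp
  qed
  then obtain n :: nat where n: "\<And>x. \<rho> < s x \<Longrightarrow> s x \<le> 1 \<Longrightarrow> inverse (real (Suc n)) \<le> spectral x"
    by blast
  have "s x \<le> real (Suc n) * spectral x" for x
  proof (cases "s x = 0")
    case True
    then show ?thesis by (simp add: spectral_nonneg)
  next
    case False
    then have "0 < s x" using nonneg[of x] by linarith
    then obtain e e' t where e: "scaling e e' t" "\<rho> < t * s x" "t * s x \<le> 1"
      by (rule scaling_ex)
    then have t: "0 < t" "s (e * x) = t * s x" by (auto simp: scaling_def)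
    have "t * s x \<le> 1" by (rule e(3))
    also have "1 \<le> real (Suc n) * spectral (e * x)"
      using n[of "e * x"] e t by (simp add: field_simps)
    also have "\<dots> = t * (real (Suc n) * spectral x)"
      by (simp add: spectral_scaling[OF e(1)])
    finally show ?thesis using t by simp
  qed
  then show ?thesis using that[of "real (Suc n)"] by simp
qed

theorem local_ring_spectral: "local_ring spectral"
proof -
  interpret sp: ultranorm spectral by (rule ultranorm_spectral)
  obtain C where C: "0 < C" "\<And>x. s x \<le> C * spectral x"
    by (rule norm_le_spectral) blast
  show ?thesis
  proof
    show "spectral 1 = 1" by (rule spectral_1)
    show "spectral (x * y) = spectral x * spectral y" for x y by (rule spectral_mult)
    show "\<exists>y. spectral (x * y - 1) = 0" if "spectral x \<noteq> 0" for x
      using that inverse_ex spectral_zero_iff by metis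
    show "spectral 2 \<noteq> 0" using two_nonzero spectral_zero_iff by simp
    show "\<exists>x. 0 < spectral x \<and> spectral x < 1"
      using spectral_scaling[OF scaling_c, of 1] \<rho> by (intro exI[of _ c]) (simp add: spectral_1)
    show "sp.complete_on UNIV"
      unfolding sp.complete_on_def
    proof (intro allI impI)
      fix X assume X: "sp.cauchy X"
      have "cauchy X"
        unfolding cauchy_def
      proof (intro allI impI)
        fix e :: real assume "e > 0"
        then have "e / C > 0" using C by simp
        then obtain M where "\<forall>m\<ge>M. \<forall>n\<ge>M. spectral (X m - X n) < e / C"
          using X by (auto simp: sp.cauchy_def)
        then show "\<exists>M. \<forall>m\<ge>M. \<forall>n\<ge>M. s (X m - X n) < e"
          using C by (intro exI[of _ M]) (metis le_less_trans mult.commute pos_less_divide_eq)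
      qed
      then obtain L where L: "(\<lambda>n. s (X n - L)) \<longlonglongrightarrow> 0"
        using complete_onD[OF complete] by blast
      have "(\<lambda>n. spectral (X n - L)) \<longlonglongrightarrow> 0"
        by (rule real_tendsto_sandwich[OF _ _ tendsto_const L]) (auto simp: spectral_le_norm)
      then show "\<exists>L\<in>UNIV. (\<lambda>n. spectral (X n - L)) \<longlonglongrightarrow> 0" by blast
    qed
    show "sp.totally_bounded_on UNIV"
      unfolding sp.totally_bounded_on_def
    proof (intro allI impI)
      fix r e :: real assume "e > 0"
      obtain T where T: "finite T" "\<And>x. s x \<le> C * r \<Longrightarrow> \<exists>t\<in>T. s (x - t) < e"
        using totally_bounded_onD[OF totally_bounded \<open>e > 0\<close>, of "C * r"] by auto
      have "\<exists>t\<in>T. spectral (x - t) < e" if "spectral x \<le> r" for x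
      proof -
        have "s x \<le> C * r"
          using C(2)[of x] mult_left_mono[OF that, of C] C(1) by linarith
        then show ?thesis using T(2) spectral_le_norm le_less_trans by meson
      qed
      then show "\<exists>T. finite T \<and> (\<forall>x\<in>UNIV. spectral x \<le> r \<longrightarrow> (\<exists>t\<in>T. spectral (x - t) < e))"
        using T(1) by blast
    qed
  qed
qed

end

section \<open>Valuations on residue rings of polynomials\<close>

text \<open>Every point of an ultrametric ball is a centre of it, so balls meeting \<open>W\<close>
  are recentred in \<open>W\<close> at the same radius.\<close>

lemma (in ultranorm) totally_bounded_on_centers:
  assumes "totally_bounded_on W" "e > 0"
  obtains T where "finite T" "T \<subseteq> W" "\<And>x. x \<in> W \<Longrightarrow> s x \<le> r \<Longrightarrow> \<exists>t\<in>T. s (x - t) < e"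
proof -
  obtain T where T: "finite T" "\<And>x. x \<in> W \<Longrightarrow> s x \<le> r \<Longrightarrow> \<exists>t\<in>T. s (x - t) < e"
    by (rule totally_bounded_onD[OF assms, of r]) blast
  define T' where "T' = {t \<in> T. \<exists>w\<in>W. s (w - t) < e}"
  have "\<forall>t\<in>T'. \<exists>w. w \<in> W \<and> s (w - t) < e"
    by (auto simp: T'_def)
  then obtain w where w: "\<forall>t\<in>T'. w t \<in> W \<and> s (w t - t) < e"
    by (rule bchoice[THEN exE])
  have "\<exists>u\<in>w ` T'. s (x - u) < e" if "x \<in> W" "s x \<le> r" for x
  proof -
    obtain t where t: "t \<in> T" "s (x - t) < e" using T(2)[of x] \<open>x \<in> W\<close> \<open>s x \<le> r\<close> by blast
    then have "t \<in> T'" using that by (auto simp: T'_def)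
    then show ?thesis using diff_trans_less[OF t(2), of "w t"] w by (auto simp: diff_commute)
  qed
  moreover have "finite (w ` T')" using T(1) by (simp add: T'_def)
  moreover have "w ` T' \<subseteq> W" using w by blast
  ultimately show ?thesis by (rule that[rotated 2])
qed

lemma poly_bezout:
  fixes a b :: "'a::field poly"
  shows "\<exists>d u v. d dvd a \<and> d dvd b \<and> d = a * u + b * v"
proof (induction "euclidean_size b" arbitrary: a b rule: less_induct)
  case less
  show ?case
  proof (cases "b = 0")
    case True
    then show ?thesis by (intro exI[of _ a] exI[of _ 1]) auto
  next
    case False
    then have "euclidean_size (a mod b) < euclidean_size b"
      by (rule mod_size_less)
    then obtain d u v where d: "d dvd b" "d dvd a mod b" "d = b * u + (a mod b) * v"
      using less by blast
    have "d dvd a" using d(1,2) by (metis dvd_mod_iff)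
    moreover have "d = a * v + b * (u - (a div b) * v)"
      using d(3) div_mult_mod_eq[of a b] by algebra
    ultimately show ?thesis using d(1) by blast
  qed
qed

lemma irreducible_poly_bezout:
  fixes q :: "'a::field poly"
  assumes "irreducible q" "\<not> q dvd x"
  obtains u v where "x * u + q * v = 1"
proof -
  obtain d u v where d: "d dvd x" "d dvd q" "d = x * u + q * v"
    using poly_bezout by blast
  have "d dvd 1"
    using irreducibleD'[OF assms(1) d(2)] d(1) assms(2) dvd_trans by blast
  then obtain e where "1 = d * e" by (auto elim: dvdE)
  then have "x * (u * e) + q * (v * e) = 1"
    using d(3) by (simp add: algebra_simps)
  then show ?thesis using that by blast
qed

section \<open>The Gauss norm on polynomials of bounded degree\<close>

definition gauss_norm :: "('a::zero \<Rightarrow> real) \<Rightarrow> 'a poly \<Rightarrow> real" where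
  "gauss_norm N p = Max ((\<lambda>i. N (coeff p i)) ` {..degree p})"

locale complete_valued_field = ultranorm N for N :: "'a::field_char_0 \<Rightarrow> real" +
  assumes mult: "N (x * y) = N x * N y"
    and zero_iff: "N x = 0 \<longleftrightarrow> x = 0"
    and complete: "complete_on UNIV"
    and totally_bounded: "totally_bounded_on UNIV"
    and nontrivial: "\<exists>x. 0 < N x \<and> N x < 1"
begin

lemma pos_iff: "0 < N x \<longleftrightarrow> x \<noteq> 0"
  using nonneg[of x] zero_iff[of x] by linarith

lemma one [simp]: "N 1 = 1"
  using mult[of 1 1] zero_iff[of 1] by simp

lemma power: "N (x ^ n) = N x ^ n"
  by (induction n) (auto simp: mult)

lemma inverse: "N (inverse x) = inverse (N x)"
proof (cases "x = 0")
  case False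
  then have "N x * N (inverse x) = 1" by (simp flip: mult)
  then show ?thesis by (metis inverse_unique)
qed simp

lemma local_ring_field: "local_ring N"
proof
  show "\<exists>y. N (x * y - 1) = 0" if "N x \<noteq> 0" for x
    using that by (intro exI[of _ "inverse x"]) (auto simp: zero_iff)
qed (use mult complete totally_bounded nontrivial zero_iff[of 2] in auto)

abbreviation gauss :: "'a poly \<Rightarrow> real" where
  "gauss \<equiv> gauss_norm N"

lemma coeff_le_gauss: "N (coeff p i) \<le> gauss p"
proof (cases "i \<le> degree p")
  case True
  then show ?thesis unfolding gauss_norm_def by (intro Max_ge) auto
next
  case False
  have "N (coeff p 0) \<le> gauss p" unfolding gauss_norm_def by (intro Max_ge) auto
  then have "0 \<le> gauss p" using nonneg order_trans by blast
  then show ?thesis using False by (simp add: coeff_eq_0)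
qed

lemma gauss_le: "(\<And>i. N (coeff p i) \<le> B) \<Longrightarrow> gauss p \<le> B"
  unfolding gauss_norm_def by (intro Max.boundedI) auto

lemma gauss_attained: "\<exists>i. gauss p = N (coeff p i)"
proof -
  have "gauss p \<in> (\<lambda>i. N (coeff p i)) ` {..degree p}"
    unfolding gauss_norm_def by (intro Max_in) auto
  then show ?thesis by blast
qed

sublocale gauss: ultranorm gauss
proof
  show "0 \<le> gauss x" for x
    using coeff_le_gauss[of x 0] nonneg order_trans by blast
  show "gauss 0 = 0" by (simp add: gauss_norm_def)
  show "gauss (x - y) \<le> max (gauss x) (gauss y)" for x y
  proof (rule gauss_le)
    fix i
    show "N (coeff (x - y) i) \<le> max (gauss x) (gauss y)"
      using coeff_le_gauss[of x i] coeff_le_gauss[of y i] by (auto intro!: diff_le)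
  qed
qed

lemma gauss_zero_iff: "gauss p = 0 \<longleftrightarrow> p = 0"
proof
  assume "gauss p = 0"
  then have "N (coeff p i) = 0" for i
    using coeff_le_gauss[of p i] nonneg[of "coeff p i"] by simp
  then show "p = 0" by (auto simp: zero_iff poly_eq_iff)
qed simp

lemma gauss_smult: "gauss (smult c p) = N c * gauss p"
proof (rule antisym)
  show "gauss (smult c p) \<le> N c * gauss p"
    by (rule gauss_le) (simp add: mult coeff_le_gauss mult_left_mono)
  show "N c * gauss p \<le> gauss (smult c p)"
    using gauss_attained[of p] coeff_le_gauss[of "smult c p"] by (auto simp: mult)
qed

lemma gauss_mult_le: "gauss (p * r) \<le> gauss p * gauss r"
proof (rule gauss_le)
  fix i
  show "N (coeff (p * r) i) \<le> gauss p * gauss r"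
    unfolding coeff_mult
    by (intro sum_le) (auto simp: mult intro!: mult_mono coeff_le_gauss)
qed

lemma gauss_complete: "gauss.complete_on {p. degree p \<le> d}"
  unfolding gauss.complete_on_def
proof (intro allI impI)
  fix X assume X: "range X \<subseteq> {p. degree p \<le> d}" "gauss.cauchy X"
  have N_diff: "N (coeff (X m) i - coeff (X n) i) \<le> gauss (X m - X n)" for m n i
    using coeff_le_gauss[of "X m - X n" i] by simp
  have "\<exists>l. (\<lambda>n. N (coeff (X n) i - l)) \<longlonglongrightarrow> 0" for i
  proof -
    have "cauchy (\<lambda>n. coeff (X n) i)"
      using X(2) N_diff unfolding cauchy_def gauss.cauchy_def by (meson le_less_trans)
    then show ?thesis using complete_onD[OF complete] by (metis UNIV_I)
  qed
  then obtain l where l: "\<And>i. (\<lambda>n. N (coeff (X n) i - l i)) \<longlonglongrightarrow> 0"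
    by metis
  define L where "L = Poly (map l [0..<Suc d])"
  have coeff_L: "coeff L i = (if i \<le> d then l i else 0)" for i
    by (auto simp: L_def nth_default_def simp del: upt_Suc)
  have "gauss (X n - L) \<le> e" if n: "n \<ge> M" and M: "\<forall>m\<ge>M. \<forall>n\<ge>M. gauss (X m - X n) < e" "e > 0"
    for M n e
  proof (rule gauss_le)
    fix i
    show "N (coeff (X n - L) i) \<le> e"
    proof (cases "i \<le> d")
      case True
      obtain M' where M': "\<And>m. m \<ge> M' \<Longrightarrow> N (coeff (X m) i - l i) < e"
        using LIMSEQ_0_less[OF l \<open>e > 0\<close>] by blast
      have "N (coeff (X n) i - coeff (X (max M M')) i) \<le> e"
        using N_diff[of n i "max M M'"] M(1) n by (meson le_less_trans less_imp_le max.cobounded1)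
      then show ?thesis
        using diff_trans_le[of "coeff (X n) i" "coeff (X (max M M')) i" e "l i"]
          M'[of "max M M'"] True by (simp add: coeff_L)
    next
      case False
      moreover have "degree (X n) \<le> d" using X(1) by auto
      ultimately show ?thesis using \<open>e > 0\<close> by (simp add: coeff_L coeff_eq_0)
    qed
  qed
  note bound = this
  have "(\<lambda>n. gauss (X n - L)) \<longlonglongrightarrow> 0"
  proof (rule LIMSEQ_I)
    fix r :: real assume "r > 0"
    then have "r / 2 > 0" by simp
    then obtain M where "\<forall>m\<ge>M. \<forall>n\<ge>M. gauss (X m - X n) < r / 2"
      using X(2) unfolding gauss.cauchy_def by blast
    then have "\<forall>n\<ge>M. gauss (X n - L) \<le> r / 2"
      using bound \<open>r / 2 > 0\<close> by blast
    then show "\<exists>no. \<forall>n\<ge>no. norm (gauss (X n - L) - 0) < r"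
      using \<open>r > 0\<close> by (intro exI[of _ M]) (auto intro: le_less_trans)
  qed
  moreover have "degree L \<le> d"
    by (rule degree_le) (simp add: coeff_L)
  ultimately show "\<exists>L\<in>{p. degree p \<le> d}. (\<lambda>n. gauss (X n - L)) \<longlonglongrightarrow> 0"
    by blast
qed

lemma gauss_totally_bounded: "gauss.totally_bounded_on {p. degree p \<le> d}"
  unfolding gauss.totally_bounded_on_def
proof (intro allI impI)
  fix r e :: real assume "e > 0"
  then have e2: "e / 2 > 0" by simp
  obtain T where T: "finite T" "\<And>x. N x \<le> r \<Longrightarrow> \<exists>t\<in>T. N (x - t) < e / 2"
    using totally_bounded_onD[OF totally_bounded e2] by (metis UNIV_I)
  define U where "U = Poly ` {xs. set xs \<subseteq> T \<and> length xs = Suc d}"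
  have "\<exists>u\<in>U. gauss (p - u) < e" if p: "degree p \<le> d" "gauss p \<le> r" for p
  proof -
    have "\<forall>i. \<exists>t. t \<in> T \<and> N (coeff p i - t) < e / 2"
      using T(2) coeff_le_gauss p(2) order_trans by blast
    then obtain t where t: "\<And>i. t i \<in> T" "\<And>i. N (coeff p i - t i) < e / 2" by metis
    define u where "u = Poly (map t [0..<Suc d])"
    have "u \<in> U"
      unfolding U_def u_def using t(1) by (intro imageI) (auto simp del: upt_Suc)
    moreover have "gauss (p - u) \<le> e / 2"
    proof (rule gauss_le)
      fix i
      show "N (coeff (p - u) i) \<le> e / 2"
        using t(2)[of i] p(1) e2
        by (auto simp: u_def nth_default_def coeff_eq_0 simp del: upt_Suc)
    qed
    then have "gauss (p - u) < e" using \<open>e > 0\<close> by simp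
    ultimately show ?thesis by blast
  qed
  moreover have "finite U"
    unfolding U_def using T(1) by (intro finite_imageI finite_lists_length_eq)
  ultimately show "\<exists>T. finite T \<and> (\<forall>x\<in>{p. degree p \<le> d}. gauss x \<le> r \<longrightarrow> (\<exists>t\<in>T. gauss (x - t) < e))"
    by blast
qed

lemma gauss_linear_bound:
  assumes "\<And>x y. f (x + y) = f x + f y" "\<And>c x. f (smult c x) = smult c (f x)"
  obtains C where "C > 0" "\<And>x. degree x \<le> d \<Longrightarrow> gauss (f x) \<le> C * gauss x"
proof
  define C where "C = 1 + (\<Sum>i\<le>d. gauss (f (monom 1 i)))"
  show "C > 0" unfolding C_def by (intro add_pos_nonneg sum_nonneg) auto
  fix x :: "'a poly" assume "degree x \<le> d"
  have f0: "f 0 = 0" using assms(2)[of 0 0] by simp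
  have f_sum: "f (sum g A) = (\<Sum>i\<in>A. f (g i))" if "finite A" for A and g :: "nat \<Rightarrow> 'a poly"
    using that by (induction A rule: finite_induct) (auto simp: f0 assms(1))
  have "x = (\<Sum>i\<le>d. smult (coeff x i) (monom 1 i))"
    using poly_as_sum_of_monoms'[OF \<open>degree x \<le> d\<close>] by (simp add: smult_monom)
  then have "f x = f (\<Sum>i\<le>d. smult (coeff x i) (monom 1 i))" by simp
  also have "\<dots> = (\<Sum>i\<le>d. smult (coeff x i) (f (monom 1 i)))"
    by (subst f_sum) (auto simp: assms(2))
  finally have fx: "f x = (\<Sum>i\<le>d. smult (coeff x i) (f (monom 1 i)))" .
  have "gauss (f (monom 1 i)) \<le> C" if "i \<le> d" for i
    unfolding C_def using member_le_sum[of i "{..d}" "\<lambda>i. gauss (f (monom 1 i))"] that by simp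
  then show "gauss (f x) \<le> C * gauss x"
    unfolding fx using \<open>C > 0\<close>
    by (intro gauss.sum_le) (auto simp: gauss_smult mult.commute[of C] intro!: mult_mono coeff_le_gauss)
qed

text \<open>The remainders form a finite-dimensional space, complete and totally bounded for the
  Gauss norm, and Bezout supplies inverses; the spectral radius then does the rest.\<close>

lemma residue_valuation_ex:
  fixes q :: "'a poly"
  assumes q: "irreducible q"
  shows "\<exists>\<nu>. local_ring \<nu> \<and> (\<forall>x. \<nu> x = 0 \<longleftrightarrow> q dvd x)"
proof -
  define n where "n = degree q"
  have "q \<noteq> 0" using q by auto
  have n: "n > 0"
    using q is_unit_iff_degree[OF \<open>q \<noteq> 0\<close>] by (auto simp: n_def irreducible_def)
  have deg_mod: "degree (x mod q) \<le> n - 1" for x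
    using degree_mod_less'[OF \<open>q \<noteq> 0\<close>, of x] n by (cases "x mod q = 0") (auto simp: n_def)
  have mod_id: "x mod q = x" if "degree x \<le> n - 1" for x
    using that n by (intro mod_poly_less) (auto simp: n_def)
  \<comment> \<open>\<open>C\<close> bounds reduction modulo \<open>q\<close> on products of two
    remainders. Building it into \<open>s\<close> makes \<open>s\<close> submultiplicative.\<close>
  obtain C where C: "C > 0" "\<And>x. degree x \<le> 2 * n \<Longrightarrow> gauss (x mod q) \<le> C * gauss x"
    using gauss_linear_bound[of "\<lambda>x. x mod q" "2 * n"] by (metis poly_mod_add_left mod_smult_left)
  define s where "s x = C * gauss (x mod q)" for x
  have s_zero: "s x = 0 \<longleftrightarrow> q dvd x" for x
    using C(1) by (auto simp: s_def gauss_zero_iff mod_eq_0_iff_dvd)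
  obtain \<pi> where \<pi>: "0 < N \<pi>" "N \<pi> < 1" using nontrivial by blast
  have not_unit: "\<not> q dvd x" if "is_unit x" for x
    using q that by (meson dvd_unit_imp_unit irreducible_not_unit)
  interpret s: ultranorm s
  proof
    show "s (x - y) \<le> max (s x) (s y)" for x y
      using mult_left_mono[OF gauss.diff[of "x mod q" "y mod q"], of C] C(1)
      by (simp add: s_def poly_mod_diff_left max_mult_distrib_left)
  qed (use C(1) in \<open>auto simp: s_def\<close>)
  have "compact_normed_ring s [:\<pi>:] [:inverse \<pi>:] (N \<pi>)"
  proof
    show "s (x * y) \<le> s x * s y" for x y
    proof -
      have "gauss (x * y mod q) = gauss ((x mod q) * (y mod q) mod q)"
        by (simp add: mod_mult_eq)
      also have "\<dots> \<le> C * gauss ((x mod q) * (y mod q))"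
        using degree_mult_le[of "x mod q" "y mod q"] deg_mod[of x] deg_mod[of y]
        by (intro C(2)) linarith
      also have "\<dots> \<le> C * (gauss (x mod q) * gauss (y mod q))"
        using C(1) gauss_mult_le by (intro mult_left_mono) auto
      finally show ?thesis using C(1) by (simp add: s_def mult_ac)
    qed
    show "s 1 \<noteq> 0" "s 2 \<noteq> 0"
      unfolding s_zero using is_unit_const_poly_iff[of "2::'a"]
      by (auto intro!: not_unit simp: numeral_poly dvd_field_iff)
    show "\<exists>y. s (x * y - 1) = 0" if "s x \<noteq> 0" for x
    proof -
      obtain u v where "x * u + q * v = 1"
        using irreducible_poly_bezout[OF q, of x] \<open>s x \<noteq> 0\<close> unfolding s_zero by metis
      then have "x * u - 1 = q * (- v)" by (simp add: algebra_simps)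
      then show ?thesis unfolding s_zero by (metis dvd_triv_left)
    qed
    show "[:\<pi>:] * [:inverse \<pi>:] = 1"
      using \<pi> by (auto simp: pos_iff one_pCons)
    show "s ([:\<pi>:] * x) = N \<pi> * s x" for x
      by (simp add: s_def mod_smult_left gauss_smult)
    show "s.complete_on UNIV"
      unfolding s.complete_on_def
    proof (intro allI impI)
      fix X assume X: "s.cauchy X"
      have sX: "s (x - y) = C * gauss (x mod q - y mod q)" for x y
        by (simp add: s_def poly_mod_diff_left)
      have "gauss.cauchy (\<lambda>n. X n mod q)"
        unfolding gauss.cauchy_def
      proof (intro allI impI)
        fix e :: real assume "e > 0"
        then have "C * e > 0" using C(1) by simp
        then obtain M where M: "\<forall>m\<ge>M. \<forall>n\<ge>M. s (X m - X n) < C * e"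
          using X unfolding s.cauchy_def by blast
        then show "\<exists>M. \<forall>m\<ge>M. \<forall>n\<ge>M. gauss (X m mod q - X n mod q) < e"
          using C(1) unfolding sX by (intro exI[of _ M]) simp
      qed
      then obtain L where L: "degree L \<le> n - 1" "(\<lambda>k. gauss (X k mod q - L)) \<longlonglongrightarrow> 0"
        using gauss.complete_onD[OF gauss_complete, of "\<lambda>k. X k mod q" "n - 1"] deg_mod by auto
      have "s (X k - L) = C * gauss (X k mod q - L)" for k
        using mod_id[OF L(1)] by (simp add: sX)
      then have "(\<lambda>k. s (X k - L)) \<longlonglongrightarrow> 0"
        using tendsto_mult_right_zero[OF L(2), of C] by simp
      then show "\<exists>L\<in>UNIV. (\<lambda>k. s (X k - L)) \<longlonglongrightarrow> 0" by blast
    qed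
    show "s.totally_bounded_on UNIV"
      unfolding s.totally_bounded_on_def
    proof (intro allI impI)
      fix r e :: real assume "e > 0"
      then have "e / C > 0" using C(1) by simp
      then obtain T where T: "finite T" "T \<subseteq> {p. degree p \<le> n - 1}"
          "\<And>x. degree x \<le> n - 1 \<Longrightarrow> gauss x \<le> r / C \<Longrightarrow> \<exists>t\<in>T. gauss (x - t) < e / C"
        using gauss.totally_bounded_on_centers[OF gauss_totally_bounded, of "e / C" "n - 1" "r / C"]
        by auto
      have "\<exists>t\<in>T. s (x - t) < e" if "s x \<le> r" for x
      proof -
        have "gauss (x mod q) \<le> r / C"
          using that C(1) by (simp add: s_def field_simps)
        then obtain t where t: "t \<in> T" "gauss (x mod q - t) < e / C"
          using T(3) deg_mod by blast
        moreover have "t mod q = t" using T(2) t(1) by (intro mod_id) auto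
        ultimately show ?thesis
          using C(1) by (intro bexI[of _ t]) (simp_all add: s_def poly_mod_diff_left field_simps)
      qed
      then show "\<exists>T. finite T \<and> (\<forall>x\<in>UNIV. s x \<le> r \<longrightarrow> (\<exists>t\<in>T. s (x - t) < e))"
        using T(1) by blast
    qed
  qed (use \<pi> in auto)
  then have "local_ring (compact_normed_ring.spectral s)"
    and "compact_normed_ring.spectral s x = 0 \<longleftrightarrow> s x = 0" for x
    by (rule compact_normed_ring.local_ring_spectral, rule compact_normed_ring.spectral_zero_iff)
  then show ?thesis using s_zero by blast
qed

theorem quinary_form_isotropic_field:
  fixes a :: "nat \<Rightarrow> 'a"
  shows "\<exists>v. qform a 5 v = 0 \<and> (\<exists>i<5. v i \<noteq> 0)"
  using local_ring.quinary_form_isotropic[OF local_ring_field, of a] by (simp add: zero_iff)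

theorem quinary_form_isotropic_mod:
  fixes q :: "'a poly"
  assumes "irreducible q"
  shows "\<exists>v. q dvd qform a 5 v \<and> (\<exists>i<5. \<not> q dvd v i)"
  using residue_valuation_ex[OF assms] local_ring.quinary_form_isotropic[of _ a] by metis

end

section \<open>Completeness and total boundedness of p-adic fields\<close>

lemma (in ultranorm) triangle: "s (x + y) \<le> s x + s y"
  using add[of x y] nonneg[of x] nonneg[of y] by linarith

lemma small_factor:
  fixes e b :: real
  assumes "0 < e" "0 \<le> b"
  shows "\<exists>e'>0. e' * b < e"
proof (intro exI conjI)
  have pos: "0 < b + 1" using assms by simp
  then show "0 < e / (b + 1)" using assms by simp
  show "e / (b + 1) * b < e" using pos assms by (simp add: field_simps)
qed

section \<open>Finite-dimensional spaces over a complete subfield\<close>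

locale finite_extension = ultranorm N for N :: "'a::field_char_0 \<Rightarrow> real" +
  fixes F :: "'a set"
  assumes mult: "N (x * y) = N x * N y"
    and zero_iff: "N x = 0 \<longleftrightarrow> x = 0"
    and F: "0 \<in> F" "\<And>x y. x \<in> F \<Longrightarrow> y \<in> F \<Longrightarrow> x - y \<in> F" "\<And>x y. x \<in> F \<Longrightarrow> y \<in> F \<Longrightarrow> x * y \<in> F"
        "\<And>x. x \<in> F \<Longrightarrow> inverse x \<in> F" "1 \<in> F"
    and complete_F: "complete_on F"
    and totally_bounded_F: "totally_bounded_on F"
begin

definition subspace :: "'a set \<Rightarrow> bool" where
  "subspace W \<longleftrightarrow> 0 \<in> W \<and> (\<forall>x\<in>W. \<forall>y\<in>W. x - y \<in> W) \<and> (\<forall>c\<in>F. \<forall>x\<in>W. c * x \<in> W)"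

definition adjoin :: "'a \<Rightarrow> 'a set \<Rightarrow> 'a set" where
  "adjoin b W = {v + c * b | v c. v \<in> W \<and> c \<in> F}"

lemma subspace_adjoin:
  assumes "subspace W"
  shows "subspace (adjoin b W)"
proof -
  have W: "0 \<in> W" "\<And>x y. x \<in> W \<Longrightarrow> y \<in> W \<Longrightarrow> x - y \<in> W" "\<And>c x. c \<in> F \<Longrightarrow> x \<in> W \<Longrightarrow> c * x \<in> W"
    using assms by (auto simp: subspace_def)
  have "0 \<in> adjoin b W"
    unfolding adjoin_def using W(1) F(1) by force
  moreover have "x - y \<in> adjoin b W" if xy: "x \<in> adjoin b W" "y \<in> adjoin b W" for x y
  proof -
    obtain v c v' c' where *: "x = v + c * b" "y = v' + c' * b" "v \<in> W" "v' \<in> W" "c \<in> F" "c' \<in> F"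
      using xy by (auto simp: adjoin_def)
    then have "x - y = (v - v') + (c - c') * b" by (simp add: algebra_simps)
    then show ?thesis unfolding adjoin_def using * W(2) F(2) by blast
  qed
  moreover have "k * x \<in> adjoin b W" if kx: "k \<in> F" "x \<in> adjoin b W" for k x
  proof -
    obtain v c where *: "x = v + c * b" "v \<in> W" "c \<in> F"
      using kx by (auto simp: adjoin_def)
    then have "k * x = k * v + (k * c) * b" by (simp add: algebra_simps)
    then show ?thesis unfolding adjoin_def using * W(3) F(3) kx(1) by blast
  qed
  ultimately show ?thesis by (simp add: subspace_def)
qed

text \<open>A complete set is closed: points of \<open>W\<close> approaching \<open>b\<close> would
  converge to \<open>b\<close> inside \<open>W\<close>.\<close>

lemma distance_pos:
  assumes "complete_on W" "b \<notin> W"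
  obtains \<delta> where "\<delta> > 0" "\<And>w. w \<in> W \<Longrightarrow> \<delta> \<le> N (b - w)"
proof -
  have "\<exists>n::nat. \<forall>w\<in>W. inverse (real (Suc n)) \<le> N (b - w)"
  proof (rule ccontr)
    assume "\<not> ?thesis"
    then have "\<forall>n. \<exists>w. w \<in> W \<and> N (b - w) < inverse (real (Suc n))"
      by (meson not_le)
    then obtain X where X: "\<And>n. X n \<in> W" "\<And>n. N (b - X n) < inverse (real (Suc n))"
      by metis
    have lim: "(\<lambda>n. N (b - X n)) \<longlonglongrightarrow> 0"
      by (rule real_tendsto_sandwich[OF _ _ tendsto_const LIMSEQ_inverse_real_of_nat])
        (auto intro!: always_eventually less_imp_le X(2) simp del: of_nat_Suc)
    have "cauchy X"
      unfolding cauchy_def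
    proof (intro allI impI)
      fix e :: real assume "e > 0"
      then obtain M where M: "\<And>n. n \<ge> M \<Longrightarrow> N (b - X n) < e"
        using LIMSEQ_0_less[OF lim] by blast
      then show "\<exists>M. \<forall>m\<ge>M. \<forall>n\<ge>M. N (X m - X n) < e"
        using diff_trans_less diff_commute by metis
    qed
    then obtain L where L: "L \<in> W" "(\<lambda>n. N (X n - L)) \<longlonglongrightarrow> 0"
      using complete_onD[OF assms(1), of X] X(1) by blast
    have "N (b - L) \<le> N (b - X n) + N (X n - L)" for n
      using triangle[of "b - X n" "X n - L"] by simp
    moreover have "(\<lambda>n. N (b - X n) + N (X n - L)) \<longlonglongrightarrow> 0 + 0"
      by (intro tendsto_add lim L(2))
    ultimately have "N (b - L) \<le> 0"
      using LIMSEQ_le_const by force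
    then have "b = L"
      using nonneg[of "b - L"] zero_iff[of "b - L"] by simp
    then show False using L(1) assms(2) by simp
  qed
  then show ?thesis using that by (metis inverse_positive_iff_positive of_nat_0_less_iff zero_less_Suc)
qed

text \<open>For nonzero \<open>c\<close> the vector is \<open>c * (b - w)\<close> with
  \<open>w = - v / c\<close> in \<open>W\<close>. The coordinate \<open>c\<close> is thus controlled
  by the norm of the vector, which lets completeness and total boundedness pass to
  \<open>adjoin b W\<close>.\<close>

lemma adjoin_bounds:
  assumes W: "subspace W" "complete_on W" and b: "b \<notin> W"
  obtains \<delta> where "\<delta> > 0" "\<And>v c. v \<in> W \<Longrightarrow> c \<in> F \<Longrightarrow> N c * \<delta> \<le> N (v + c * b)"
proof -
  obtain \<delta> where \<delta>: "\<delta> > 0" "\<And>w. w \<in> W \<Longrightarrow> \<delta> \<le> N (b - w)"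
    by (rule distance_pos[OF W(2) b]) blast
  have "N c * \<delta> \<le> N (v + c * b)" if "v \<in> W" "c \<in> F" for v c
  proof (cases "c = 0")
    case False
    have "0 - inverse c * v \<in> W"
      using W(1) that F(4) unfolding subspace_def by blast
    then have "\<delta> \<le> N (b - (0 - inverse c * v))"
      by (rule \<delta>(2))
    then have "N c * \<delta> \<le> N (c * (b - (0 - inverse c * v)))"
      unfolding mult by (intro mult_left_mono) auto
    also have "c * (b - (0 - inverse c * v)) = v + c * b"
      using False by (simp add: field_simps)
    finally show ?thesis .
  qed simp
  then show ?thesis using that \<delta>(1) by blast
qed

lemma adjoin_complete:
  assumes W: "subspace W" "complete_on W" and b: "b \<notin> W"
  shows "complete_on (adjoin b W)"
  unfolding complete_on_def
proof (intro allI impI)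
  fix X assume X: "range X \<subseteq> adjoin b W" "cauchy X"
  obtain \<delta> where \<delta>: "\<delta> > 0" "\<And>v c. v \<in> W \<Longrightarrow> c \<in> F \<Longrightarrow> N c * \<delta> \<le> N (v + c * b)"
    by (rule adjoin_bounds[OF assms]) blast
  have "\<forall>n. \<exists>v c. X n = v + c * b \<and> v \<in> W \<and> c \<in> F"
    using X(1) unfolding adjoin_def by blast
  then obtain v c where vc: "\<And>n. X n = v n + c n * b" "\<And>n. v n \<in> W" "\<And>n. c n \<in> F"
    by metis
  have le: "N (c m - c n) * \<delta> \<le> N (X m - X n)" for m n
  proof -
    have "v m - v n \<in> W" using W(1) vc(2) by (simp add: subspace_def)
    then have "N (c m - c n) * \<delta> \<le> N ((v m - v n) + (c m - c n) * b)"
      using F(2) vc(3) by (intro \<delta>(2)) auto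
    then show ?thesis by (simp add: vc(1) algebra_simps)
  qed
  have c: "cauchy c"
    unfolding cauchy_def
  proof (intro allI impI)
    fix e :: real assume "e > 0"
    then have "e * \<delta> > 0" using \<delta>(1) by simp
    then obtain M where "\<forall>m\<ge>M. \<forall>n\<ge>M. N (X m - X n) < e * \<delta>"
      using X(2) unfolding cauchy_def by blast
    then have "\<forall>m\<ge>M. \<forall>n\<ge>M. N (c m - c n) * \<delta> < e * \<delta>"
      using le le_less_trans by blast
    then show "\<exists>M. \<forall>m\<ge>M. \<forall>n\<ge>M. N (c m - c n) < e"
      using \<delta>(1) by (intro exI[of _ M]) simp
  qed
  then obtain l where l: "l \<in> F" "(\<lambda>n. N (c n - l)) \<longlonglongrightarrow> 0"
    using complete_onD[OF complete_F, of c] vc(3) by blast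
  have "cauchy v"
    unfolding cauchy_def
  proof (intro allI impI)
    fix e :: real assume e: "e > 0"
    obtain e' where e': "e' > 0" "e' * N b < e"
      using small_factor[OF e nonneg] by blast
    obtain M1 where M1: "\<forall>m\<ge>M1. \<forall>n\<ge>M1. N (X m - X n) < e"
      using X(2) e unfolding cauchy_def by blast
    obtain M2 where M2: "\<forall>m\<ge>M2. \<forall>n\<ge>M2. N (c m - c n) < e'"
      using c e'(1) unfolding cauchy_def by blast
    have "N (v m - v n) < e" if "m \<ge> max M1 M2" "n \<ge> max M1 M2" for m n
    proof -
      have "N ((c m - c n) * b) \<le> e' * N b"
        unfolding mult using M2 that by (intro mult_right_mono) (auto simp: less_imp_le)
      then have "N ((X m - X n) - (c m - c n) * b) < e"
        using M1 that e'(2) by (intro diff_less[of "X m - X n"]) auto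
      then show ?thesis by (simp add: vc(1) algebra_simps)
    qed
    then show "\<exists>M. \<forall>m\<ge>M. \<forall>n\<ge>M. N (v m - v n) < e" by blast
  qed
  then obtain u where u: "u \<in> W" "(\<lambda>n. N (v n - u)) \<longlonglongrightarrow> 0"
    using complete_onD[OF W(2), of v] vc(2) by blast
  have "(\<lambda>n. N (X n - (u + l * b))) \<longlonglongrightarrow> 0"
  proof (rule real_tendsto_sandwich[OF _ _ tendsto_const])
    show "(\<lambda>n. N (v n - u) + N (c n - l) * N b) \<longlonglongrightarrow> 0"
      using tendsto_add[OF u(2) tendsto_mult_left_zero[OF l(2)]] by simp
    show "\<forall>\<^sub>F n in sequentially. N (X n - (u + l * b)) \<le> N (v n - u) + N (c n - l) * N b"
    proof (intro always_eventually allI)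
      fix n
      have "X n - (u + l * b) = (v n - u) + (c n - l) * b"
        by (simp add: vc(1) algebra_simps)
      then show "N (X n - (u + l * b)) \<le> N (v n - u) + N (c n - l) * N b"
        using triangle[of "v n - u" "(c n - l) * b"] by (simp only: mult)
    qed
  qed auto
  moreover have "u + l * b \<in> adjoin b W"
    using u(1) l(1) by (auto simp: adjoin_def)
  ultimately show "\<exists>L\<in>adjoin b W. (\<lambda>n. N (X n - L)) \<longlonglongrightarrow> 0" by blast
qed

lemma adjoin_totally_bounded:
  assumes W: "subspace W" "complete_on W" "totally_bounded_on W" and b: "b \<notin> W"
  shows "totally_bounded_on (adjoin b W)"
  unfolding totally_bounded_on_def
proof (intro allI impI)
  fix r e :: real assume e: "e > 0"
  obtain \<delta> where \<delta>: "\<delta> > 0" "\<And>v c. v \<in> W \<Longrightarrow> c \<in> F \<Longrightarrow> N c * \<delta> \<le> N (v + c * b)"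
    by (rule adjoin_bounds[OF W(1,2) b]) blast
  obtain e' where e': "e' > 0" "e' * N b < e"
    using small_factor[OF e nonneg] by blast
  obtain T where T: "finite T" "\<And>c. c \<in> F \<Longrightarrow> N c \<le> r / \<delta> \<Longrightarrow> \<exists>t\<in>T. N (c - t) < e'"
    by (rule totally_bounded_onD[OF totally_bounded_F e'(1), of "r / \<delta>"]) blast
  obtain S where S: "finite S" "\<And>v. v \<in> W \<Longrightarrow> N v \<le> max r e \<Longrightarrow> \<exists>u\<in>S. N (v - u) < e"
    by (rule totally_bounded_onD[OF W(3) e, of "max r e"]) blast
  \<comment> \<open>A centre \<open>t\<close> need not lie in \<open>F\<close>, so each ball in use
    is represented by an actual pair of coordinates. Differences from that pair then stay in
    \<open>W\<close> and have norm at most \<open>max r e\<close>.\<close>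
  define good where "good t v c \<longleftrightarrow> v \<in> W \<and> c \<in> F \<and> N (v + c * b) \<le> r \<and> N (c - t) < e'" for t v c
  define T' where "T' = {t \<in> T. \<exists>v c. good t v c}"
  have "\<forall>t\<in>T'. \<exists>vc. good t (fst vc) (snd vc)"
    by (auto simp: T'_def)
  then obtain vc where vc: "\<forall>t\<in>T'. good t (fst (vc t)) (snd (vc t))"
    by (rule bchoice[THEN exE])
  define U where "U = (\<lambda>(t, u). fst (vc t) + snd (vc t) * b + u) ` (T' \<times> S)"
  have "\<exists>u\<in>U. N (x - u) < e" if x: "x \<in> adjoin b W" "N x \<le> r" for x
  proof -
    obtain v c where x_eq: "x = v + c * b" "v \<in> W" "c \<in> F"
      using x(1) by (auto simp: adjoin_def)
    have "N c \<le> r / \<delta>"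
      using \<delta>(2)[OF x_eq(2,3)] x(2) \<delta>(1) x_eq(1) by (simp add: field_simps)
    then obtain t where t: "t \<in> T" "N (c - t) < e'"
      using T(2) x_eq(3) by blast
    then have t': "t \<in> T'"
      using x x_eq by (auto simp: T'_def good_def)
    define v' c' where "v' = fst (vc t)" and "c' = snd (vc t)"
    have g: "v' \<in> W" "c' \<in> F" "N (v' + c' * b) \<le> r" "N (c' - t) < e'"
      using vc t' by (auto simp: good_def v'_def c'_def)
    have "N (c - c') < e'"
      using diff_trans_less[OF t(2), of c'] g(4) by (simp add: diff_commute)
    then have cc: "N ((c - c') * b) < e"
      using e'(2) mult_right_mono[of "N (c - c')" e' "N b"] by (simp add: mult)
    have "N ((x - (v' + c' * b)) - (c - c') * b) \<le> max r e"
      using x(2) g(3) cc by (intro diff_le) auto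
    then have "N (v - v') \<le> max r e"
      by (simp add: x_eq(1) algebra_simps)
    moreover have "v - v' \<in> W" using W(1) x_eq(2) g(1) by (simp add: subspace_def)
    ultimately obtain u where u: "u \<in> S" "N ((v - v') - u) < e"
      using S(2) by blast
    have "N (((v - v') - u) + (c - c') * b) < e"
      using u(2) cc by (rule add_less)
    then have "N (x - (v' + c' * b + u)) < e"
      by (simp add: x_eq(1) algebra_simps)
    moreover have "v' + c' * b + u \<in> U"
      unfolding U_def v'_def c'_def using t' u(1) by force
    ultimately show ?thesis by blast
  qed
  moreover have "finite U"
    unfolding U_def T'_def using T(1) S(1) by simp
  ultimately show "\<exists>T. finite T \<and> (\<forall>x\<in>adjoin b W. N x \<le> r \<longrightarrow> (\<exists>t\<in>T. N (x - t) < e))"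
    by blast
qed

text \<open>Elements are adjoined one at a time and skipped if already in \<open>W\<close>, so
  \<open>B\<close> may be linearly dependent.\<close>

lemma finite_span:
  assumes "finite B"
  shows "\<exists>W. subspace W \<and> complete_on W \<and> totally_bounded_on W \<and>
      (\<forall>c. c ` B \<subseteq> F \<longrightarrow> (\<Sum>b\<in>B. c b * b) \<in> W)"
  using assms
proof (induction B rule: finite_induct)
  case empty
  have "subspace {0}" "complete_on {0}" "totally_bounded_on {0}"
    unfolding subspace_def complete_on_def totally_bounded_on_def
    by (auto simp: image_subset_iff intro!: exI[of _ "{0}"])
  then show ?case by (intro exI[of _ "{0}"]) auto
next
  case (insert b B)
  then obtain W where W: "subspace W" "complete_on W" "totally_bounded_on W"
      "\<And>c. c ` B \<subseteq> F \<Longrightarrow> (\<Sum>b\<in>B. c b * b) \<in> W"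
    by blast
  show ?case
  proof (cases "b \<in> W")
    case True
    have "(\<Sum>b\<in>insert b B. c b * b) \<in> W" if "c ` insert b B \<subseteq> F" for c
    proof -
      have "0 - c b * b \<in> W" "(\<Sum>b\<in>B. c b * b) \<in> W"
        using W(1,4) True that by (auto simp: subspace_def)
      then have "(\<Sum>b\<in>B. c b * b) - (0 - c b * b) \<in> W"
        using W(1) unfolding subspace_def by blast
      then show ?thesis using insert.hyps by (simp add: add.commute)
    qed
    then show ?thesis using W by blast
  next
    case False
    have "(\<Sum>b\<in>insert b B. c b * b) \<in> adjoin b W" if "c ` insert b B \<subseteq> F" for c
    proof -
      have "(\<Sum>b\<in>B. c b * b) \<in> W" "c b \<in> F" using W(4) that by auto
      then show ?thesis
        unfolding adjoin_def sum.insert[OF insert.hyps] by (auto simp: add.commute[of "c b * b"])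
    qed
    then show ?thesis
      using subspace_adjoin[OF W(1)] adjoin_complete[OF W(1,2) False]
        adjoin_totally_bounded[OF W(1-3) False] by blast
  qed
qed

end

section \<open>The field of p-adic numbers and its finite extensions\<close>

lemma ultranorm_nonarch_abs:
  assumes "nonarch_abs N"
  shows "ultranorm N"
proof -
  have N: "\<And>x. 0 \<le> N x" "\<And>x. N x = 0 \<longleftrightarrow> x = 0" "\<And>x y. N (x * y) = N x * N y"
      "\<And>x y. N (x + y) \<le> max (N x) (N y)"
    using assms by (auto simp: nonarch_abs_def)
  have "N 1 * N 1 = N 1" "N 1 \<noteq> 0" using N(2)[of 1] by (simp_all flip: N(3))
  then have "N 1 = 1" by simp
  then have "(N (- 1))\<^sup>2 = 1" by (simp add: power2_eq_square flip: N(3))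
  then have "N (- 1) = 1" using N(1)[of "- 1"] by (auto simp: power2_eq_1_iff)
  then have "N (- x) = N x" for x using N(3)[of "- 1" x] by simp
  then show ?thesis
    using N(4)[of x "- y" for x y] by unfold_locales (use N in auto)
qed

lemma padic_abs_of_int: "\<not> int p dvd z \<Longrightarrow> padic_abs p (of_int z) = 1"
  by (auto simp: padic_abs_def not_dvd_imp_multiplicity_0)

lemma padic_abs_prime: "prime p \<Longrightarrow> padic_abs p (of_nat p) = 1 / real p"
proof -
  assume p: "prime p"
  then have "p > 1" by (rule prime_gt_1_nat)
  then have "quotient_of (of_nat p) = (int p, 1)" "multiplicity (int p) (int p) = 1"
    using quotient_of_int[of "int p"] multiplicity_self[of "int p"] by auto
  then show ?thesis using \<open>p > 1\<close> by (simp add: padic_abs_def power_int_minus divide_inverse)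
qed

text \<open>By density it suffices to treat rationals. One of norm at most 1 has denominator prime
  to \<open>p\<close>, hence is congruent to an integer modulo \<open>p ^ k\<close>, so finitely
  many fractions \<open>m / p ^ j\<close> form a net.\<close>

lemma Qp_totally_bounded:
  fixes N :: "'a::field_char_0 \<Rightarrow> real"
  assumes p: "prime p" and N: "nonarch_abs N" and F: "is_Qp p N F"
  shows "ultranorm.totally_bounded_on N F"
proof -
  interpret ultranorm N by (rule ultranorm_nonarch_abs[OF N])
  have mult: "N (x * y) = N x * N y" and zero_iff: "N x = 0 \<longleftrightarrow> x = 0" for x y
    using N by (auto simp: nonarch_abs_def)
  have one: "N 1 = 1" using mult[of 1 1] zero_iff[of 1] by simp
  have rat: "N (of_rat r) = padic_abs p r" for r
    using F by (auto simp: is_Qp_def)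
  have Np: "N (of_nat p) = 1 / real p"
    using rat[of "of_nat p"] padic_abs_prime[OF p] by (simp add: of_rat_of_nat_eq)
  have p1: "real p > 1" using prime_gt_1_nat[OF p] by simp
  have N_pow: "N (of_nat p ^ k) = 1 / real p ^ k" for k
    by (induction k) (auto simp: mult Np one)
  have N_int_le: "N (of_int z) \<le> 1" for z
  proof (cases z rule: int_cases2)
    case (nonneg n)
    have "N (of_nat n) \<le> 1" for n
      by (induction n) (auto simp: one intro: add_le)
    then show ?thesis using nonneg by simp
  next
    case (nonpos n)
    have "N (of_nat n) \<le> 1" for n
      by (induction n) (auto simp: one intro: add_le)
    then show ?thesis using nonpos by simp
  qed
  have N_int_eq: "N (of_int z) = 1" if "\<not> int p dvd z" for z
    using rat[of "of_int z"] padic_abs_of_int[OF that] by simp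
  have N_int_dvd: "N (of_int z) \<le> 1 / real p ^ k" if "int p ^ k dvd z" for z k
  proof -
    obtain y where "z = int p ^ k * y" using \<open>int p ^ k dvd z\<close> unfolding dvd_def by blast
    then have "N (of_int z) = (1 / real p ^ k) * N (of_int y)"
      by (simp add: mult N_pow)
    then show ?thesis using N_int_le[of y] p1 by (simp add: divide_right_mono)
  qed
  have digits: "\<exists>m<p ^ k. N (of_rat r - of_nat m) \<le> 1 / real p ^ k" if r: "N (of_rat r :: 'a) \<le> 1" for r k
  proof -
    obtain a b where ab: "quotient_of r = (a, b)" by fastforce
    have b: "b > 0" "coprime a b" and r_eq: "r = of_int a / of_int b"
      using quotient_of_denom_pos[OF ab] quotient_of_coprime[OF ab] quotient_of_div[OF ab] by auto
    have N_r: "N (of_rat r) * N (of_int b) = N (of_int a)"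
      using b(1) unfolding r_eq by (simp add: of_rat_divide flip: mult)
    have nb: "\<not> int p dvd b"
    proof
      assume pb: "int p dvd b"
      then have "\<not> int p dvd a"
        using b(2) p by (meson coprime_common_divisor not_prime_unit prime_int_nat_transfer prime_nat_int_transfer)
      then have "N (of_int a) = 1" by (rule N_int_eq)
      moreover have "N (of_int b) < 1" using N_int_dvd[of 1 b] pb p1 by (simp add: le_less_trans)
      ultimately show False
        using N_r r mult_le_one[OF r nonneg, of "of_int b"] mult_right_mono[OF r, of "N (of_int b)"] by simp
    qed
    have "coprime b (int p ^ k)"
      using prime_imp_coprime[of "int p" b] nb p by (simp add: coprime_commute)
    then obtain u v where uv: "u * b + v * int p ^ k = 1"
      using bezout_int[of b "int p ^ k"] by auto
    define y where "y = u * a"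
    define m where "m = nat (y mod int p ^ k)"
    have pk: "int p ^ k > 0" using p1 by simp
    have m: "int m = y mod int p ^ k" using pk by (simp add: m_def)
    have "m < p ^ k"
      using pos_mod_bound[OF pk, of y] m by (metis of_nat_less_iff of_nat_power)
    moreover have "int p ^ k dvd a - b * int m"
    proof -
      have "a - b * int m = a * (u * b + v * int p ^ k) - b * int m"
        unfolding uv by simp
      also have "\<dots> = a * v * int p ^ k + b * (y - int m)"
        by (simp add: y_def algebra_simps)
      finally show ?thesis
        unfolding m by (simp add: minus_mod_eq_mult_div)
    qed
    then have "N (of_int (a - b * int m)) \<le> 1 / real p ^ k" by (rule N_int_dvd)
    moreover have "(of_rat r - of_nat m) * of_int b = (of_int (a - b * int m) :: 'a)"
      using b(1) unfolding r_eq by (simp add: of_rat_divide field_simps)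
    then have "N (of_rat r - of_nat m) * N (of_int b) = N (of_int (a - b * int m))"
      by (simp flip: mult)
    then have "N (of_rat r - of_nat m) = N (of_int (a - b * int m))"
      by (simp add: N_int_eq[OF nb])
    ultimately show ?thesis by (intro exI[of _ m]) simp
  qed
  show ?thesis
    unfolding totally_bounded_on_def
  proof (intro allI impI)
    fix r e :: real assume e: "e > 0"
    \<comment> \<open>Multiplication by \<open>p ^ j\<close> moves the ball of radius
      \<open>r\<close> into the unit ball, and \<open>k\<close> more digits give precision
      \<open>e\<close>.\<close>
    obtain j where j: "r < real p ^ j" using real_arch_pow[OF p1] by blast
    obtain k where k: "(1 / real p) ^ k < e"
      using real_arch_pow_inv[OF e, of "1 / real p"] p1 by auto
    define T where "T = (\<lambda>m. of_nat m / of_nat p ^ j :: 'a) ` {..<p ^ (j + k)}"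
    have "\<exists>t\<in>T. N (x - t) < e" if x: "x \<in> F" "N x \<le> r" for x
    proof -
      \<comment> \<open>The cap at \<open>p ^ j\<close> keeps the approximating rational within the
        range that \<open>p ^ j\<close> clears.\<close>
      define e' where "e' = min e (real p ^ j)"
      have e': "e' > 0" using e p1 by (simp add: e'_def)
      obtain q where q: "N (x - of_rat q) < e'"
        using F x(1) e' unfolding is_Qp_def by blast
      have "N (x - (x - of_rat q)) \<le> real p ^ j"
        using x(2) j q by (intro diff_le[of x _ "x - of_rat q"]) (auto simp: e'_def)
      then have "N (of_rat q) \<le> real p ^ j" by simp
      moreover have "(of_rat (q * of_nat p ^ j) :: 'a) = of_rat q * of_nat p ^ j"
        by (simp add: of_rat_mult of_rat_power)
      ultimately have "N (of_rat (q * of_nat p ^ j) :: 'a) \<le> 1"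
        using p1 by (simp add: mult N_pow)
      then obtain m where m: "m < p ^ (j + k)"
          "N (of_rat (q * of_nat p ^ j) - of_nat m :: 'a) \<le> 1 / real p ^ (j + k)"
        using digits by blast
      have p0: "(of_nat p :: 'a) \<noteq> 0" using p1 by auto
      have "of_rat (q * of_nat p ^ j) - of_nat m = (of_rat q - of_nat m / of_nat p ^ j) * (of_nat p ^ j :: 'a)"
        using p0 by (simp add: of_rat_mult of_rat_power field_simps)
      then have "N (of_rat q - of_nat m / of_nat p ^ j) / real p ^ j \<le> 1 / real p ^ (j + k)"
        using m(2) by (simp add: mult N_pow)
      then have "N (of_rat q - of_nat m / of_nat p ^ j) / real p ^ j * real p ^ j
          \<le> 1 / real p ^ (j + k) * real p ^ j"
        using p1 by (intro mult_right_mono) auto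
      then have "N (of_rat q - of_nat m / of_nat p ^ j) \<le> (1 / real p) ^ k"
        using p1 by (simp add: power_add power_divide)
      then have "N (of_rat q - of_nat m / of_nat p ^ j) < e" using k by simp
      then have "N (x - of_nat m / of_nat p ^ j) < e"
        using q diff_trans_less[of x "of_rat q" e "of_nat m / of_nat p ^ j"] by (simp add: e'_def)
      then show ?thesis
        unfolding T_def using m(1) by (intro bexI[OF _ imageI[of m]]) auto
    qed
    then show "\<exists>T. finite T \<and> (\<forall>x\<in>F. N x \<le> r \<longrightarrow> (\<exists>t\<in>T. N (x - t) < e))"
      by (intro exI[of _ T]) (simp add: T_def)
  qed
qed

theorem padic_field_complete_valued_field:
  fixes N :: "'a::field_char_0 \<Rightarrow> real"
  assumes "padic_field p N"
  shows "complete_valued_field N"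
proof -
  obtain F where p: "prime p" and N: "nonarch_abs N" and F: "is_Qp p N F" and fin: "finite_over F"
    using assms by (auto simp: padic_field_def)
  interpret ultranorm N by (rule ultranorm_nonarch_abs[OF N])
  have mult: "N (x * y) = N x * N y" and zero_iff: "N x = 0 \<longleftrightarrow> x = 0" for x y
    using N by (auto simp: nonarch_abs_def)
  have sub: "is_subfield F" and compl: "complete_wrt N F" and rat: "N (of_rat r) = padic_abs p r" for r
    using F by (auto simp: is_Qp_def)
  have "complete_on F"
    using compl unfolding complete_wrt_def complete_on_def cauchy_def .
  moreover have "x - y \<in> F" if "x \<in> F" "y \<in> F" for x y
    using sub that unfolding is_subfield_def diff_conv_add_uminus by blast
  ultimately interpret finite_extension N F
    using sub mult zero_iff Qp_totally_bounded[OF p N F]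
    by unfold_locales (auto simp: is_subfield_def)
  obtain B where B: "finite B" "\<And>x. \<exists>c. c ` B \<subseteq> F \<and> x = (\<Sum>b\<in>B. c b * b)"
    using fin by (auto simp: finite_over_def)
  obtain W where W: "complete_on W" "totally_bounded_on W"
      "\<And>c. c ` B \<subseteq> F \<Longrightarrow> (\<Sum>b\<in>B. c b * b) \<in> W"
    using finite_span[OF B(1)] by blast
  have "x \<in> W" for x
    using B(2)[of x] W(3) by auto
  then have "W = UNIV" by blast
  moreover have "N (of_nat p) = 1 / real p"
    using rat[of "of_nat p"] padic_abs_prime[OF p] by (simp add: of_rat_of_nat_eq)
  then have "0 < N (of_nat p) \<and> N (of_nat p) < 1"
    using prime_gt_1_nat[OF p] by simp
  ultimately show ?thesis
    using W(1,2) mult zero_iff by unfold_locales auto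
qed

section \<open>Lifting solutions of quadratic congruences\<close>

text \<open>The second congruence says that \<open>v\<close> is a smooth point of the quadric modulo \<open>m\<close>.\<close>

definition smoothly_represents :: "(nat \<Rightarrow> 'r::comm_ring_1) \<Rightarrow> nat \<Rightarrow> 'r \<Rightarrow> 'r \<Rightarrow> bool" where
  "smoothly_represents a n G m \<longleftrightarrow>
     (\<exists>v u. m dvd qform a n v - G \<and> m dvd (\<Sum>i<n. a i * v i * u i) - 1)"

lemma smoothly_represents_dvd:
  "smoothly_represents a n G m \<Longrightarrow> m' dvd m \<Longrightarrow> smoothly_represents a n G m'"
  unfolding smoothly_represents_def by (meson dvd_trans)

lemma bform_eq_sum: "bform a n v u = 2 * (\<Sum>i<n. a i * v i * u i)"
  unfolding bform_def by (simp add: sum_distrib_left mult_ac)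

lemma qform_cong_dvd:
  assumes "\<And>i. m dvd v i - w i"
  shows "m dvd qform a n v - qform a n w"
proof -
  have "qform a n v - qform a n w = (\<Sum>i<n. (v i - w i) * (a i * (v i + w i)))"
    unfolding qform_def sum_subtractf[symmetric]
    by (intro sum.cong refl, simp add: algebra_simps power2_eq_square)
  then show ?thesis using assms by (auto intro!: dvd_sum)
qed

lemma pairing_cong_dvd:
  fixes a :: "nat \<Rightarrow> 'r::comm_ring_1"
  assumes "\<And>i. m dvd v i - v' i" "\<And>i. m dvd u i - u' i"
  shows "m dvd (\<Sum>i<n. a i * v i * u i) - (\<Sum>i<n. a i * v' i * u' i)"
proof -
  have "(\<Sum>i<n. a i * v i * u i) - (\<Sum>i<n. a i * v' i * u' i)
      = (\<Sum>i<n. (v i - v' i) * (a i * u i) + (u i - u' i) * (a i * v' i))"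
    unfolding sum_subtractf[symmetric] by (intro sum.cong refl, simp add: algebra_simps)
  then show ?thesis using assms by (auto intro!: dvd_sum)
qed

text \<open>Chinese remaindering: \<open>m' * y\<close> and \<open>m * x\<close> act as the two
  idempotents with which \<open>glue\<close> combines solutions.\<close>

lemma smoothly_represents_coprime:
  assumes "smoothly_represents a n G m" "smoothly_represents a n G m'" and one: "m * x + m' * y = 1"
  shows "smoothly_represents a n G (m * m')"
proof -
  obtain v u where v: "m dvd qform a n v - G" "m dvd (\<Sum>i<n. a i * v i * u i) - 1"
    using assms(1) by (auto simp: smoothly_represents_def)
  obtain v' u' where v': "m' dvd qform a n v' - G" "m' dvd (\<Sum>i<n. a i * v' i * u' i) - 1"
    using assms(2) by (auto simp: smoothly_represents_def)
  define glue where "glue f f' i = f i * (m' * y) + f' i * (m * x)" for f f' :: "nat \<Rightarrow> 'a" and i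
  have g: "m dvd glue f f' i - f i" "m' dvd glue f f' i - f' i" for f f' i
  proof -
    have "glue f f' i - f i = m * (x * (f' i - f i)) + (m * x + m' * y - 1) * f i"
      "glue f f' i - f' i = m' * (y * (f i - f' i)) + (m * x + m' * y - 1) * f' i"
      by (simp_all add: glue_def algebra_simps)
    then show "m dvd glue f f' i - f i" "m' dvd glue f f' i - f' i"
      by (simp_all add: one)
  qed
  have both: "m * m' dvd z" if "m dvd z" "m' dvd z" for z
  proof -
    have "m * m' dvd (m * z) * x" "m * m' dvd (z * m') * y"
      using that by (simp_all add: mult_dvd_mono dvd_mult2)
    then have "m * m' dvd z * (m * x) + z * (m' * y)"
      by (intro dvd_add) (simp_all add: mult_ac)
    also have "z * (m * x) + z * (m' * y) = z"
      using one by (simp flip: distrib_left)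
    finally show ?thesis .
  qed
  define w where "w = glue v v'"
  define t where "t = glue u u'"
  have "m dvd (qform a n w - qform a n v) + (qform a n v - G)"
    "m' dvd (qform a n w - qform a n v') + (qform a n v' - G)"
    unfolding w_def using g v v' by (intro dvd_add qform_cong_dvd; blast)+
  moreover have "m dvd ((\<Sum>i<n. a i * w i * t i) - (\<Sum>i<n. a i * v i * u i)) + ((\<Sum>i<n. a i * v i * u i) - 1)"
    "m' dvd ((\<Sum>i<n. a i * w i * t i) - (\<Sum>i<n. a i * v' i * u' i)) + ((\<Sum>i<n. a i * v' i * u' i) - 1)"
    unfolding w_def t_def using g v v' by (intro dvd_add pairing_cong_dvd; blast)+
  ultimately show ?thesis
    unfolding smoothly_represents_def by (intro exI[of _ w] exI[of _ t] conjI both) auto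
qed

text \<open>One Hensel step. Moving \<open>v\<close> by \<open>k u\<close> changes the value by
  \<open>2 k\<close> to first order, so \<open>k = - m e / 2\<close> cancels the error
  \<open>m e\<close>; the factor \<open>1 - m y'\<close> restores smoothness modulo
  \<open>m\<^sup>2\<close>.\<close>

lemma smoothly_represents_square:
  fixes m half :: "'r::comm_ring_1"
  assumes "smoothly_represents a n G m" and half: "2 * half = 1"
  shows "smoothly_represents a n G (m\<^sup>2)"
proof -
  obtain v u where v: "m dvd qform a n v - G" "m dvd (\<Sum>i<n. a i * v i * u i) - 1"
    using assms(1) by (auto simp: smoothly_represents_def)
  obtain e where e: "qform a n v - G = m * e" using v(1) by (auto simp: dvd_def)
  obtain y where y: "(\<Sum>i<n. a i * v i * u i) - 1 = m * y" using v(2) by (auto simp: dvd_def)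
  define k where "k = - (half * (m * e))"
  define w where "w = (\<lambda>i. 1 * v i + k * u i)"
  have "k * 2 = - ((2 * half) * (m * e))"
    by (simp add: k_def mult_ac)
  then have k2: "k * 2 = - (m * e)"
    unfolding half by simp
  have "qform a n w - G = m * e + (k * 2) * (1 + m * y) + k\<^sup>2 * qform a n u"
    unfolding w_def qform_comb bform_eq_sum using e y by (simp add: algebra_simps)
  also have "\<dots> = m\<^sup>2 * (- (e * y) + half\<^sup>2 * e\<^sup>2 * qform a n u)"
    unfolding k2 by (simp add: k_def algebra_simps power2_eq_square)
  finally have 1: "m\<^sup>2 dvd qform a n w - G" by simp
  define y' where "y' = y - half * e * qform a n u"
  have "(\<Sum>i<n. a i * w i * u i) = (\<Sum>i<n. a i * v i * u i) + k * qform a n u"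
    unfolding w_def qform_def sum_distrib_left sum.distrib[symmetric]
    by (intro sum.cong refl, simp add: algebra_simps power2_eq_square)
  also have "\<dots> = 1 + m * y'"
    using y by (simp add: k_def y'_def algebra_simps)
  finally have S: "(\<Sum>i<n. a i * w i * u i) = 1 + m * y'" .
  have "(\<Sum>i<n. a i * w i * (u i * (1 - m * y'))) = (\<Sum>i<n. a i * w i * u i) * (1 - m * y')"
    unfolding sum_distrib_right by (intro sum.cong refl, simp add: mult_ac)
  then have "(\<Sum>i<n. a i * w i * (u i * (1 - m * y'))) - 1 = m\<^sup>2 * - (y'\<^sup>2)"
    unfolding S by (simp add: algebra_simps power2_eq_square)
  then have "m\<^sup>2 dvd (\<Sum>i<n. a i * w i * (u i * (1 - m * y'))) - 1"
    by (metis dvd_triv_left)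
  with 1 show ?thesis
    unfolding smoothly_represents_def by (intro exI[of _ w] exI[of _ "\<lambda>i. u i * (1 - m * y')"]) simp
qed

lemma irreducible_factor_ex:
  fixes m :: "'a::field poly"
  assumes "degree m > 0"
  shows "\<exists>q. irreducible q \<and> q dvd m"
  using assms
proof (induction "degree m" arbitrary: m rule: less_induct)
  case less
  show ?case
  proof (cases "irreducible m")
    case False
    have m: "m \<noteq> 0" using less.prems by auto
    then have "\<not> is_unit m" using less.prems is_unit_iff_degree[OF m] by simp
    then obtain x y where xy: "m = x * y" "\<not> is_unit x" "\<not> is_unit y"
      using False m unfolding irreducible_def by blast
    then have "x \<noteq> 0" "y \<noteq> 0" using m by auto
    then have "degree x > 0" "degree y > 0"
      using xy is_unit_iff_degree by blast+
    moreover have "degree m = degree x + degree y"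
      unfolding xy(1) using \<open>x \<noteq> 0\<close> \<open>y \<noteq> 0\<close> by (rule degree_mult_eq)
    ultimately obtain q where "irreducible q" "q dvd x"
      using less.hyps[of x] by auto
    then show ?thesis unfolding xy(1) by (meson dvd_mult2)
  qed auto
qed

text \<open>Split off an irreducible \<open>q\<close> as \<open>m = q m'\<close>. If
  \<open>q\<close> divides \<open>m'\<close>, then \<open>m\<close> divides
  \<open>m'\<^sup>2\<close> and the Hensel step suffices; otherwise \<open>q\<close> and
  \<open>m'\<close> are coprime.\<close>

lemma smoothly_represents_poly:
  fixes m :: "'a::field_char_0 poly"
  assumes "m \<noteq> 0" "\<And>q. irreducible q \<Longrightarrow> q dvd m \<Longrightarrow> smoothly_represents a n G q"
  shows "smoothly_represents a n G m"
  using assms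
proof (induction "degree m" arbitrary: m rule: less_induct)
  case less
  show ?case
  proof (cases "degree m = 0")
    case True
    then have "m dvd z" for z using less.prems(1) is_unit_iff_degree unit_imp_dvd by blast
    then show ?thesis by (auto simp: smoothly_represents_def)
  next
    case False
    then obtain q where q: "irreducible q" "q dvd m"
      using irreducible_factor_ex by blast
    obtain m' where m': "m = q * m'" using q(2) by (auto simp: dvd_def)
    have nz: "q \<noteq> 0" "m' \<noteq> 0" using less.prems(1) m' by auto
    have "degree q > 0"
      using q(1) is_unit_iff_degree[OF nz(1)] by (auto simp: irreducible_def)
    then have "degree m' < degree m"
      unfolding m' using nz by (simp add: degree_mult_eq)
    then have rep: "smoothly_represents a n G m'"
      using less.hyps nz(2) less.prems(2) unfolding m' by (meson dvd_mult)
    show ?thesis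
    proof (cases "q dvd m'")
      case True
      have "2 * [:1 / 2 :: 'a:] = 1"
        by (simp add: numeral_poly one_pCons)
      then have "smoothly_represents a n G (m'\<^sup>2)"
        by (rule smoothly_represents_square[OF rep])
      moreover have "m dvd m'\<^sup>2"
        unfolding m' power2_eq_square using True by (intro mult_dvd_mono) auto
      ultimately show ?thesis by (rule smoothly_represents_dvd)
    next
      case False
      obtain u v where "m' * u + q * v = 1"
        using irreducible_poly_bezout[OF q(1) False] by blast
      then have "q * v + m' * u = 1" by (simp add: add.commute)
      then show ?thesis
        unfolding m' using less.prems(2)[OF q] rep by (intro smoothly_represents_coprime)
    qed
  qed
qed

text \<open>\<open>G\<close> vanishes modulo \<open>q\<close>, so an isotropic vector represents it.
  The point is smooth because \<open>a k * v k\<close> is invertible modulo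
  \<open>q\<close>.\<close>

lemma smoothly_represents_isotropic:
  fixes q :: "'a::field poly"
  assumes q: "irreducible q" and "q dvd G" "q dvd qform a n v" "k < n" "\<not> q dvd v k" "\<not> q dvd a k"
  shows "smoothly_represents a n G q"
proof -
  have "\<not> q dvd a k * v k"
    using field_poly_irreducible_imp_prime[OF q] assms(5,6) by (simp add: prime_elem_dvd_mult_iff)
  then obtain x y where xy: "a k * v k * x + q * y = 1"
    by (rule irreducible_poly_bezout[OF q]) blast
  define u where "u i = (if i = k then x else 0)" for i
  have "(\<Sum>i<n. a i * v i * u i) = (\<Sum>i<n. if i = k then a k * v k * x else 0)"
    by (intro sum.cong) (auto simp: u_def)
  then have "(\<Sum>i<n. a i * v i * u i) = a k * v k * x" using assms(4) by simp
  then have "(\<Sum>i<n. a i * v i * u i) - 1 = q * (- y)"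
    using xy by (simp add: algebra_simps)
  then show ?thesis
    unfolding smoothly_represents_def using assms(2,3)
    by (intro exI[of _ v] exI[of _ u]) (auto intro: dvd_diff)
qed

context complete_valued_field
begin

lemma gauss_const_mult: "gauss ([:c:] * x) = N c * gauss x"
  by (simp add: gauss_smult)

text \<open>
  For \<open>\<tau> = 0\<close> the solution \<open>v\<close> modulo \<open>m\<close> yields an exact one.  Smoothness gives a linear right
  inverse \<open>(X, V)\<close> of the derivative there, and the correction \<open>r\<close> needed for small \<open>\<tau>\<close> is the
  fixed point of a contraction \<open>T\<close>.
\<close>

lemma newton_perturbation:
  fixes m G :: "'a poly"
  assumes D: "degree m > 0" and a: "\<And>i. i < n \<Longrightarrow> degree (a i) \<le> 1"
    and G: "degree G \<le> 2 * degree m"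
    and rep: "smoothly_represents a n G m"
  shows "\<exists>\<epsilon>>0. \<forall>\<tau>. N \<tau> < \<epsilon> \<longrightarrow> (\<exists>x w. 2 * m * x + qform a n w + [:\<tau>:] * x\<^sup>2 = G)"
proof -
  define D where "D = degree m"
  have D0: "D > 0" using D by (simp add: D_def)
  have m0: "m \<noteq> 0" using D by auto
  define half where "half = [:1 / 2 :: 'a:]"
  have half: "2 * half = 1" by (simp add: half_def numeral_poly one_pCons)
  have mod_dvd: "m dvd x mod m - x" for x
    by (metis dvd_minus_iff minus_diff_eq dvd_minus_mod)
  have deg_mod: "degree (x mod m) \<le> D - 1" for x
    using degree_mod_less'[OF m0, of x] D0 by (cases "x mod m = 0") (auto simp: D_def)
  obtain v0 u where v0: "m dvd qform a n v0 - G" "m dvd (\<Sum>i<n. a i * v0 i * u i) - 1"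
    using rep by (auto simp: smoothly_represents_def)
  \<comment> \<open>Reduction modulo \<open>m\<close> bounds the degrees, so that the equation lives
    among polynomials of degree at most \<open>2 * D\<close>, where the Gauss norm is
    complete.\<close>
  define v where "v i = v0 i mod m" for i
  have v: "m dvd qform a n v - G" "m dvd (\<Sum>i<n. a i * v i * u i) - 1"
  proof -
    have "m dvd (qform a n v - qform a n v0) + (qform a n v0 - G)"
      using v0 mod_dvd by (intro dvd_add qform_cong_dvd) (auto simp: v_def)
    then show "m dvd qform a n v - G" by simp
    have "m dvd ((\<Sum>i<n. a i * v i * u i) - (\<Sum>i<n. a i * v0 i * u i)) + ((\<Sum>i<n. a i * v0 i * u i) - 1)"
      using v0 mod_dvd by (intro dvd_add pairing_cong_dvd) (auto simp: v_def)
    then show "m dvd (\<Sum>i<n. a i * v i * u i) - 1" by simp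
  qed
  have deg_v: "degree (v i) \<le> D - 1" for i unfolding v_def by (rule deg_mod)
  have deg3: "degree (x * y * z) \<le> 2 * D" if "degree x \<le> 1" "degree y \<le> D - 1" "degree z \<le> D - 1" for x y z :: "'a poly"
    using degree_mult_le[of "x * y" z] degree_mult_le[of x y] that D0 by linarith
  have deg_q: "degree (qform a n z) \<le> 2 * D" if "\<And>i. degree (z i) \<le> D - 1" for z
    unfolding qform_def power2_eq_square mult.assoc[symmetric]
    using a that by (intro degree_sum_le deg3) auto
  have deg_b: "degree (bform a n v z) \<le> 2 * D" if "\<And>i. degree (z i) \<le> D - 1" for z
  proof -
    have "degree (\<Sum>i<n. a i * v i * z i) \<le> 2 * D"
      using a that deg_v by (intro degree_sum_le deg3) auto
    then show ?thesis
      unfolding bform_eq_sum using degree_mult_le[of 2 "\<Sum>i<n. a i * v i * z i"]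
      by (simp add: numeral_poly)
  qed
  have quot: "degree x \<le> D" if "degree (2 * m * x) \<le> 2 * D" for x
  proof (cases "x = 0")
    case False
    have "degree (2 * m * x) = degree (2 :: 'a poly) + D + degree x"
      using False m0 by (simp add: degree_mult_eq D_def)
    then show ?thesis using that by linarith
  qed simp
  have halve: "2 * m * (half * z div m) = z" if "m dvd z" for z
  proof -
    have "m dvd half * z" using that by (rule dvd_mult)
    then have "2 * (m * (half * z div m)) = 2 * (half * z)" by simp
    then show ?thesis using half by (simp flip: mult.assoc)
  qed

  \<comment> \<open>The pair \<open>x0\<close>, \<open>v\<close> solves the equation for
    \<open>\<tau> = 0\<close>.\<close>
  define x0 where "x0 = half * (G - qform a n v) div m"
  have x0: "2 * m * x0 = G - qform a n v"
    unfolding x0_def using v(1) by (intro halve) (metis dvd_minus_iff minus_diff_eq)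
  have deg_x0: "degree x0 \<le> D"
    using G deg_q[of v] deg_v by (intro quot) (auto simp: x0 D_def intro!: degree_diff_le)

  \<comment> \<open>By smoothness \<open>bform a n v (V r)\<close> is congruent to \<open>r\<close>
    modulo \<open>m\<close>, and \<open>X r\<close> is what remains after division by
    \<open>2 m\<close>. Both depend linearly on \<open>r\<close>, hence are bounded.\<close>
  define V where "V r i = half * (r * u i) mod m" for r i
  define X where "X r = half * (r - bform a n v (V r)) div m" for r
  have deg_V: "degree (V r i) \<le> D - 1" for r i unfolding V_def by (rule deg_mod)
  have VX: "2 * m * X r + bform a n v (V r) = r" for r
  proof -
    have "m dvd (\<Sum>i<n. a i * v i * V r i) - (\<Sum>i<n. a i * v i * (half * (r * u i)))"
      unfolding V_def by (intro pairing_cong_dvd mod_dvd) auto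
    moreover have "(\<Sum>i<n. a i * v i * (half * (r * u i))) = half * r * (\<Sum>i<n. a i * v i * u i)"
      unfolding sum_distrib_left by (intro sum.cong refl) (simp add: mult_ac)
    ultimately have 1: "m dvd 2 * ((\<Sum>i<n. a i * v i * V r i) - half * r * (\<Sum>i<n. a i * v i * u i))"
      by (intro dvd_mult) simp
    have 2: "m dvd r * ((\<Sum>i<n. a i * v i * u i) - 1)"
      using v(2) by (rule dvd_mult)
    have "2 * (half * r * (\<Sum>i<n. a i * v i * u i)) = r * (\<Sum>i<n. a i * v i * u i)"
      using half by (simp flip: mult.assoc)
    then have "r - bform a n v (V r) =
        - (2 * ((\<Sum>i<n. a i * v i * V r i) - half * r * (\<Sum>i<n. a i * v i * u i)))
        - r * ((\<Sum>i<n. a i * v i * u i) - 1)"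
      unfolding bform_eq_sum by (simp add: algebra_simps)
    then have "m dvd r - bform a n v (V r)"
      by (simp only: dvd_diff dvd_minus_iff 1 2)
    then have "2 * m * X r = r - bform a n v (V r)"
      unfolding X_def by (rule halve)
    then show ?thesis by simp
  qed
  have deg_X: "degree (X r) \<le> D" if "degree r \<le> 2 * D" for r
  proof (rule quot)
    have "2 * m * X r = r - bform a n v (V r)" using VX[of r] by (simp add: algebra_simps)
    then show "degree (2 * m * X r) \<le> 2 * D"
      using that deg_b[of "V r"] deg_V by (auto intro!: degree_diff_le)
  qed
  have V_add: "V (r + r') i = V r i + V r' i" for r r' i
    by (simp add: V_def algebra_simps poly_mod_add_left)
  have V_smult: "V (smult c r) i = smult c (V r i)" for c r i
    by (simp add: V_def mod_smult_left)
  have bform_smult: "bform a n v (\<lambda>i. smult c (z i)) = smult c (bform a n v z)" for c z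
    using bform_comb[of a n v "[:c:]" z 0 z] by simp
  have V_add': "V (r + r') = (\<lambda>i. 1 * V r i + 1 * V r' i)" for r r' by (auto simp: V_add)
  have X_add: "X (r + r') = X r + X r'" for r r'
    unfolding X_def V_add' bform_comb by (simp add: algebra_simps poly_div_add_left poly_div_diff_left)
  have X_smult: "X (smult c r) = smult c (X r)" for c r
  proof -
    have "V (smult c r) = (\<lambda>i. smult c (V r i))" by (auto simp: V_smult)
    then have "half * (smult c r - bform a n v (V (smult c r))) = smult c (half * (r - bform a n v (V r)))"
      by (simp only: bform_smult smult_diff_right[symmetric] mult_smult_right)
    then show ?thesis unfolding X_def by (simp add: div_smult_left)
  qed
  have minus: "V (r - r') i = V r i - V r' i" "X (r - r') = X r - X r'" for r r' i
    using V_add[of "r - r'" r' i] X_add[of "r - r'" r'] by simp_all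

  have "\<exists>C>0. \<forall>r. degree r \<le> 2 * D \<longrightarrow> gauss (V r i) \<le> C * gauss r" for i
    by (rule gauss_linear_bound[of "\<lambda>r. V r i" "2 * D", OF V_add V_smult]) blast
  then obtain CV where CV: "\<And>i. CV i > 0" "\<And>i r. degree r \<le> 2 * D \<Longrightarrow> gauss (V r i) \<le> CV i * gauss r"
    by metis
  obtain CX where CX: "CX > 0" "\<And>r. degree r \<le> 2 * D \<Longrightarrow> gauss (X r) \<le> CX * gauss r"
    by (rule gauss_linear_bound[of X "2 * D", OF X_add X_smult]) blast
  \<comment> \<open>The fixed point is sought in the ball of radius \<rho>, which contains
    \<open>T 0 = - x0\<^sup>2\<close> and is therefore preserved by the contraction
    \<open>T\<close>.\<close>
  define \<rho> where "\<rho> = 1 + gauss (x0\<^sup>2)"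
  have \<rho>: "\<rho> \<ge> 1" "gauss (x0\<^sup>2) \<le> \<rho>" by (simp_all add: \<rho>_def)
  define KV where "KV = (\<Sum>i<n. gauss (a i) * (CV i * (CV i * \<rho>)))"
  have KV_ge: "gauss (a i) * (CV i * (CV i * \<rho>)) \<le> KV" if "i < n" for i
    unfolding KV_def using that \<rho>(1) CV(1)
    by (intro member_le_sum) (auto intro!: mult_nonneg_nonneg simp: less_imp_le)
  \<comment> \<open>A Lipschitz constant for the correction \<open>U\<close> on that ball; the bound
    on \<tau> below makes \<open>N \<tau> * K \<le> 1 / 2\<close>.\<close>
  define K where "K = gauss x0 * CX + CX * (CX * \<rho>) + KV"
  have KV0: "0 \<le> KV"
    unfolding KV_def using \<rho>(1) CV(1) by (intro sum_nonneg) (auto intro!: mult_nonneg_nonneg simp: less_imp_le)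
  have K: "gauss x0 * CX \<le> K" "CX * (CX * \<rho>) \<le> K" "KV \<le> K" "0 \<le> K"
    using KV0 CX(1) \<rho>(1) by (auto simp: K_def)
  show ?thesis
  proof (intro exI[of _ "1 / (2 * (K + 1))"] conjI allI impI)
    show "0 < 1 / (2 * (K + 1))" using K(4) by simp
    fix \<tau> assume "N \<tau> < 1 / (2 * (K + 1))"
    then have "N \<tau> * (2 * (K + 1)) < 1" using K(4) by (simp add: field_simps)
    then have "2 * (N \<tau> * K) + 2 * N \<tau> < 1" by (simp add: algebra_simps)
    then have \<tau>K: "N \<tau> * K \<le> 1 / 2" and "N \<tau> \<le> 1 / 2"
      using nonneg[of \<tau>] mult_nonneg_nonneg[OF nonneg K(4), of \<tau>] by linarith+
    then have \<tau>1: "N \<tau> \<le> 1" by simp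
    define U where "U r = x0 * X r + x0 * X r + [:\<tau>:] * (X r)\<^sup>2 + qform a n (V r)" for r
    \<comment> \<open>With \<open>x = x0 + \<tau> X r\<close> and \<open>w = v + \<tau> V r\<close>
      the left side of the equation exceeds \<open>G\<close> by
      \<open>\<tau> (r - T r)\<close>.\<close>
    define T where "T r = - (x0\<^sup>2 + [:\<tau>:] * U r)" for r
    define W where "W = {r \<in> {r. degree r \<le> 2 * D}. gauss r \<le> \<rho>}"
    have deg2: "degree (x * y) \<le> 2 * D" if "degree x \<le> D" "degree y \<le> D" for x y :: "'a poly"
      using degree_mult_le[of x y] that by linarith
    have deg_c: "degree ([:\<tau>:] * x) \<le> 2 * D" if "degree x \<le> 2 * D" for x
      using that degree_smult_le[of \<tau> x] by simp
    have deg_U: "degree (U r) \<le> 2 * D" if "degree r \<le> 2 * D" for r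
      unfolding U_def power2_eq_square using deg_X[OF that] deg_x0 deg_V
      by (intro degree_add_le deg_c deg2 deg_q)
    have deg_T: "degree (T r) \<le> 2 * D" if "degree r \<le> 2 * D" for r
      unfolding T_def degree_minus power2_eq_square using deg_x0 deg_U[OF that]
      by (intro degree_add_le deg_c deg2)
    have U_diff: "gauss (U r - U r') \<le> K * gauss (r - r')" if "r \<in> W" "r' \<in> W" for r r'
    proof -
      define d where "d = gauss (r - r')"
      have r: "degree (r - r') \<le> 2 * D" "degree (r + r') \<le> 2 * D" "gauss (r + r') \<le> \<rho>" "0 \<le> d"
        using that by (auto simp: W_def d_def intro!: degree_diff_le degree_add_le gauss.add_le)
      have Vd: "gauss (V r i - V r' i) \<le> CV i * d" "gauss (V r i + V r' i) \<le> CV i * \<rho>" for i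
      proof -
        show "gauss (V r i - V r' i) \<le> CV i * d"
          using CV(2)[OF r(1), of i] by (simp add: minus d_def)
        have "gauss (V r i + V r' i) \<le> CV i * gauss (r + r')"
          using CV(2)[OF r(2), of i] by (simp add: V_add)
        then show "gauss (V r i + V r' i) \<le> CV i * \<rho>"
          using mult_left_mono[OF r(3), of "CV i"] CV(1)[of i] by linarith
      qed
      have Xd: "gauss (X r - X r') \<le> CX * d" "gauss (X r + X r') \<le> CX * \<rho>"
      proof -
        show "gauss (X r - X r') \<le> CX * d"
          using CX(2)[OF r(1)] by (simp add: minus d_def)
        have "gauss (X r + X r') \<le> CX * gauss (r + r')"
          using CX(2)[OF r(2)] by (simp add: X_add)
        then show "gauss (X r + X r') \<le> CX * \<rho>"
          using mult_left_mono[OF r(3), of CX] CX(1) by linarith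
      qed
      have 1: "gauss (x0 * (X r - X r')) \<le> K * d"
      proof -
        have "gauss (x0 * (X r - X r')) \<le> gauss x0 * (CX * d)"
          using gauss_mult_le[of x0 "X r - X r'"] mult_left_mono[OF Xd(1), of "gauss x0"] by simp
        then show ?thesis using mult_right_mono[OF K(1) r(4)] by (simp add: mult_ac)
      qed
      have 2: "gauss ([:\<tau>:] * ((X r - X r') * (X r + X r'))) \<le> K * d"
      proof -
        have "gauss ((X r - X r') * (X r + X r')) \<le> (CX * d) * (CX * \<rho>)"
          using gauss_mult_le[of "X r - X r'" "X r + X r'"]
            mult_mono[OF Xd(1) Xd(2)] CX(1) r(4) by (simp add: order_trans)
        also have "\<dots> \<le> K * d"
          using mult_right_mono[OF K(2) r(4)] by (simp add: mult_ac)
        finally have "gauss ((X r - X r') * (X r + X r')) \<le> K * d" .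
        then show ?thesis
          unfolding gauss_const_mult
          using mult_left_le_one_le[OF gauss.nonneg nonneg \<tau>1] order_trans by blast
      qed
      have 3: "gauss (\<Sum>i<n. a i * ((V r i - V r' i) * (V r i + V r' i))) \<le> K * d"
      proof (rule gauss.sum_le)
        fix i assume "i \<in> {..<n}"
        then have i: "i < n" by simp
        have "gauss (a i * ((V r i - V r' i) * (V r i + V r' i)))
            \<le> gauss (a i) * gauss ((V r i - V r' i) * (V r i + V r' i))"
          by (rule gauss_mult_le)
        also have "\<dots> \<le> gauss (a i) * (gauss (V r i - V r' i) * gauss (V r i + V r' i))"
          by (intro mult_left_mono gauss_mult_le) auto
        also have "\<dots> \<le> gauss (a i) * ((CV i * d) * (CV i * \<rho>))"
          using Vd[of i] CV(1)[of i] r(4) by (intro mult_left_mono mult_mono) auto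
        also have "\<dots> = (gauss (a i) * (CV i * (CV i * \<rho>))) * d" by (simp add: mult_ac)
        also have "\<dots> \<le> K * d"
          using KV_ge[OF i] K(3) r(4) by (intro mult_right_mono) auto
        finally show "gauss (a i * ((V r i - V r' i) * (V r i + V r' i))) \<le> K * d" .
      qed (use K(4) r(4) in auto)
      have "qform a n (V r) - qform a n (V r') = (\<Sum>i<n. a i * ((V r i - V r' i) * (V r i + V r' i)))"
        unfolding qform_def sum_subtractf[symmetric]
        by (intro sum.cong refl, simp add: algebra_simps power2_eq_square)
      then have "U r - U r' = x0 * (X r - X r') + x0 * (X r - X r')
          + [:\<tau>:] * ((X r - X r') * (X r + X r')) + (\<Sum>i<n. a i * ((V r i - V r' i) * (V r i + V r' i)))"
        unfolding U_def by (simp add: algebra_simps power2_eq_square smult_diff_right smult_add_right)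
      then show ?thesis
        using gauss.add_le[OF gauss.add_le[OF gauss.add_le[OF 1 1] 2] 3] by (simp only: d_def)
    qed
    have T_diff: "gauss (T r - T r') \<le> 1 / 2 * gauss (r - r')" if "r \<in> W" "r' \<in> W" for r r'
    proof -
      have "T r - T r' = [:\<tau>:] * (U r' - U r)"
        by (simp add: T_def smult_diff_right)
      then have "gauss (T r - T r') = N \<tau> * gauss (U r' - U r)"
        by (simp only: gauss_const_mult)
      also have "\<dots> \<le> N \<tau> * (K * gauss (r' - r))"
        using U_diff that by (intro mult_left_mono) auto
      also have "\<dots> = (N \<tau> * K) * gauss (r - r')"
        by (simp add: gauss.diff_commute)
      also have "\<dots> \<le> 1 / 2 * gauss (r - r')"
        using \<tau>K by (intro mult_right_mono) auto
      finally show ?thesis .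
    qed
    have W0: "0 \<in> W" using \<rho>(1) by (simp add: W_def)
    have "X 0 = 0" "V 0 = (\<lambda>_. 0)" using X_smult[of 0 0] V_smult[of 0 0] by auto
    then have T0: "T 0 = - (x0\<^sup>2)" by (simp add: T_def U_def qform_def)
    have T_W: "T r \<in> W" if "r \<in> W" for r
    proof -
      have "gauss (T r - T 0) \<le> \<rho>"
        using T_diff[OF that W0] that \<rho>(1) by (simp add: W_def)
      then have "gauss ((T r - T 0) + T 0) \<le> \<rho>"
        using \<rho>(2) by (intro gauss.add_le[of "T r - T 0"]) (simp_all only: T0 gauss.minus)
      then show ?thesis using deg_T that by (simp add: W_def)
    qed
    have "gauss.complete_on W"
      unfolding W_def using \<rho>(1) by (intro gauss.complete_on_ball gauss_complete) simp
    then have "\<exists>r\<in>W. gauss (T r - r) = 0"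
      using W0 T_W T_diff by (intro gauss.contraction_fixpoint[of W 0 T "1 / 2"]) auto
    then obtain r where r: "T r = r" by (auto simp: gauss_zero_iff)
    define x where "x = x0 + [:\<tau>:] * X r"
    define w where "w = (\<lambda>i. 1 * v i + [:\<tau>:] * V r i)"
    define t where "t = [:\<tau>:]"
    have qw: "qform a n w = qform a n v + t * bform a n v (V r) + t\<^sup>2 * qform a n (V r)"
      unfolding w_def qform_comb t_def[symmetric] by simp
    have rT: "r = - (x0\<^sup>2 + t * (x0 * X r + x0 * X r + t * (X r)\<^sup>2 + qform a n (V r)))"
      using r unfolding T_def U_def t_def by simp
    have "2 * m * x + qform a n w + t * x\<^sup>2 = 2 * m * x0 + qform a n v + t * (2 * m * X r + bform a n v (V r))
        + t * (x0\<^sup>2 + t * (x0 * X r + x0 * X r + t * (X r)\<^sup>2 + qform a n (V r)))"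
      unfolding x_def qw t_def[symmetric] by (simp add: algebra_simps power2_eq_square)
    also have "\<dots> = G + t * (r + (x0\<^sup>2 + t * (x0 * X r + x0 * X r + t * (X r)\<^sup>2 + qform a n (V r))))"
      unfolding x0 VX by (simp add: distrib_left)
    also have "\<dots> = G"
      using rT unfolding eq_neg_iff_add_eq_0 by simp
    finally show "\<exists>x w. 2 * m * x + qform a n w + [:\<tau>:] * x\<^sup>2 = G"
      unfolding t_def by blast
  qed
qed

end

section \<open>Quaternion norms over the rational function field\<close>

text \<open>The reduced norm of the quaternion algebra \<open>(- p, g)\<close>.\<close>

definition quat_norm :: "'r::comm_ring_1 \<Rightarrow> 'r \<Rightarrow> 'r \<Rightarrow> 'r \<Rightarrow> 'r \<Rightarrow> 'r \<Rightarrow> 'r" where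
  "quat_norm p g x0 x1 x2 x3 = x0\<^sup>2 + p * x1\<^sup>2 - g * (x2\<^sup>2 + p * x3\<^sup>2)"

lemma quat_norm_mult:
  "quat_norm p g x0 x1 x2 x3 * quat_norm p g y0 y1 y2 y3 =
   quat_norm p g
     (x0 * y0 - p * x1 * y1 + g * (x2 * y2 + p * x3 * y3))
     (x0 * y1 + x1 * y0 + g * (x3 * y2 - x2 * y3))
     (x0 * y2 - p * x1 * y3 + x2 * y0 + p * x3 * y1)
     (x0 * y3 + x1 * y2 + x3 * y0 - x2 * y1)"
  unfolding quat_norm_def by (simp add: algebra_simps power2_eq_square)

lemma qform_5:
  "qform a 5 v = a 0 * (v 0)\<^sup>2 + a 1 * (v 1)\<^sup>2 + a 2 * (v 2)\<^sup>2 + a 3 * (v 3)\<^sup>2 + a 4 * (v 4)\<^sup>2"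
  by (simp add: qform_def eval_nat_numeral)

lemma less_5_iff: "i < 5 \<longleftrightarrow> i \<in> {0, 1, 2, 3, 4::nat}"
  by auto

context complete_valued_field
begin

text \<open>Adjoining \<open>- c\<close> gives a quinary form, which is isotropic. Anisotropy of the
  norm forces the new coordinate to be nonzero, and one divides by it.\<close>

lemma quat_norm_universal:
  fixes p g c :: 'a
  assumes "anisotropic ([1, p] \<otimes>\<^sub>q [1, - g])"
  shows "\<exists>x0 x1 x2 x3. quat_norm p g x0 x1 x2 x3 = c"
proof -
  obtain v where v: "qform ((!) [1, p, - g, - (g * p), - c]) 5 v = 0" "\<exists>i<5. v i \<noteq> 0"
    using quinary_form_isotropic_field by blast
  have eq: "quat_norm p g (v 0) (v 1) (v 2) (v 3) = c * (v 4)\<^sup>2"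
    using v(1) by (simp add: qform_5 quat_norm_def algebra_simps)
  have "v 4 \<noteq> 0"
  proof
    assume "v 4 = 0"
    \<comment> \<open>The tensor product lists its entries as 1, \<open>- g\<close>,
      \<open>p\<close>, \<open>- p g\<close>; hence the permuted coordinates.\<close>
    then have nz: "\<exists>x\<in>set [v 0, v 2, v 1, v 3]. x \<noteq> 0"
      using v(2) by (auto simp: less_5_iff)
    have "diag_form ([1, p] \<otimes>\<^sub>q [1, - g]) [v 0, v 2, v 1, v 3] = 0"
      using eq \<open>v 4 = 0\<close>
      by (simp add: diag_form_def form_tensor_def quat_norm_def eval_nat_numeral algebra_simps)
    then have "isotropic ([1, p] \<otimes>\<^sub>q [1, - g])"
      unfolding isotropic_def using nz
      by (intro exI[of _ "[v 0, v 2, v 1, v 3]"] conjI) (auto simp: form_tensor_def)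
    then show False using assms by blast
  qed
  then have "quat_norm p g (v 0 / v 4) (v 1 / v 4) (v 2 / v 4) (v 3 / v 4) = c"
    using eq by (simp add: quat_norm_def field_simps)
  then show ?thesis by blast
qed

abbreviation T :: "'a poly" where "T \<equiv> [:0, 1:]"

text \<open>The form \<Psi> of the overview: the norm on pure quaternions, followed by the sum
  \<open>A\<^sup>2 + p B\<^sup>2\<close> with coefficient \<open>- k t\<close>, where
  \<open>k\<close> will be \<open>\<kappa> / \<alpha>\<close>.\<close>

definition pure_form :: "'a \<Rightarrow> 'a \<Rightarrow> 'a \<Rightarrow> nat \<Rightarrow> 'a poly" where
  "pure_form p g k = (!) [[:p:], [:- g:], [:- (g * p):], [:- k:] * T, [:- (k * p):] * T]"

text \<open>At the irreducible factors of \<open>Q\<close> the form is quinary over a local field, hence isotropic;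
  at \<open>t\<close> its first entry represents the prescribed value because \<open>p P(0) / Q(0)\<close> is \<open>p\<close> times
  \<open>P(0) Q(0)\<close> up to a square.\<close>

lemma pure_form_represents:
  fixes P Q :: "'a poly"
  assumes p: "p \<noteq> 0" and g: "g \<noteq> 0" and k: "k \<noteq> 0" and P: "poly P 0 \<noteq> 0" and Q: "poly Q 0 \<noteq> 0"
  defines "h0 \<equiv> poly P 0 / poly Q 0"
  shows "smoothly_represents (pure_form p g k) 5 ([:p * h0:] * P * Q) (T * Q)"
proof (rule smoothly_represents_poly)
  define G where "G = [:p * h0:] * P * Q"
  have h0: "h0 \<noteq> 0" "h0 * poly Q 0 = poly P 0" using P Q by (simp_all add: h0_def)
  have T: "irreducible T" by (rule irreducible_linear_field_poly) simp
  have "Q \<noteq> 0" using Q by auto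
  then show "T * Q \<noteq> 0" by simp
  fix q assume q: "irreducible q" "q dvd T * Q"
  have unit: "\<not> q dvd [:c:]" if "c \<noteq> 0" for c
    using irreducible_not_unit[OF q(1)] that dvd_unit_imp_unit[of q "[:c:]"]
    by (auto simp: is_unit_const_poly_iff dvd_field_iff)
  consider "q dvd T" | "q dvd Q"
    using prime_elem_dvd_multD[OF field_poly_irreducible_imp_prime[OF q(1)] q(2)] by blast
  then show "smoothly_represents (pure_form p g k) 5 G q"
  proof cases
    case 1
    \<comment> \<open>Here \<open>z = P(0)\<close>, and \<open>p z\<^sup>2\<close> is exactly the
      value of \<open>G\<close> at zero.\<close>
    define z where "z = h0 * poly Q 0"
    have z: "z \<noteq> 0" using h0(2) P by (simp add: z_def)
    define v u where "v i = (if i = 0 then [:z:] else 0)" and "u i = (if i = 0 then [:1 / (p * z):] else 0)" for i :: nat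
    have "poly (qform (pure_form p g k) 5 v - G) 0 = 0"
      using h0(2) by (simp add: qform_5 pure_form_def v_def G_def z_def power2_eq_square)
    then have "T dvd qform (pure_form p g k) 5 v - G"
      by (simp only: poly_eq_0_iff_dvd minus_zero)
    moreover have "(\<Sum>i<5. pure_form p g k i * v i * u i) = 1"
      using p z by (simp add: eval_nat_numeral pure_form_def v_def u_def one_pCons)
    ultimately have "smoothly_represents (pure_form p g k) 5 G T"
      unfolding smoothly_represents_def by (intro exI[of _ v] exI[of _ u]) simp
    then show ?thesis using 1 by (rule smoothly_represents_dvd)
  next
    case 2
    have nT: "\<not> q dvd T"
    proof
      assume "q dvd T"
      then have "T dvd q" using irreducibleD'[OF T] q(1) by (auto simp: irreducible_def)
      then have "T dvd Q" using 2 dvd_trans by blast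
      then show False using Q poly_eq_0_iff_dvd[of Q 0] by simp
    qed
    have coeffs: "\<not> q dvd pure_form p g k i" if "i < 5" for i
    proof -
      have "\<not> q dvd [:c:] * T" if "c \<noteq> 0" for c
        using that nT unit[OF that] field_poly_irreducible_imp_prime[OF q(1)]
        by (simp only: prime_elem_dvd_mult_iff) simp
      then show ?thesis
        using that p g k unit by (auto simp: less_5_iff pure_form_def simp del: mult_pCons_left)
    qed
    obtain v j where v: "q dvd qform (pure_form p g k) 5 v" "j < 5" "\<not> q dvd v j"
      using quinary_form_isotropic_mod[OF q(1)] by blast
    have "q dvd G" unfolding G_def using 2 by (rule dvd_mult)
    then show ?thesis
      using v(3) coeffs[OF v(2)] by (rule smoothly_represents_isotropic[OF q(1) _ v(1,2)])
  qed
qed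

text \<open>The factor after \<open>[:\<alpha>:]\<close> is \<open>f Q\<^sup>2\<close> for
  \<open>c = 1 / (\<kappa> \<sigma>\<^sup>2)\<close>. Allowing all small \<sigma> lets a single
  \<open>c\<close> be fixed afterwards for both \<alpha>.\<close>

lemma quat_norm_approximation:
  fixes P Q :: "'a poly"
  assumes aniso: "anisotropic ([1, p] \<otimes>\<^sub>q [1, - g])"
    and p: "p \<noteq> 0" and g: "g \<noteq> 0" and \<alpha>: "\<alpha> \<noteq> 0" and P: "poly P 0 \<noteq> 0" and Q: "poly Q 0 \<noteq> 0"
    and deg: "degree P \<le> degree Q + 2"
  defines "\<kappa> \<equiv> p * (poly P 0 / poly Q 0)"
  shows "\<exists>\<epsilon>>0. \<forall>\<sigma>. \<sigma> \<noteq> 0 \<longrightarrow> N \<sigma> < \<epsilon> \<longrightarrow> (\<exists>x0 x1 x2 x3 A B.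
      quat_norm [:p:] [:g:] x0 x1 x2 x3 =
        [:\<alpha>:] * (P * Q + [:1 / (\<kappa> * \<sigma>\<^sup>2):] * T\<^sup>2 * Q\<^sup>2) + T * (A\<^sup>2 + [:p:] * B\<^sup>2))"
proof -
  have "Q \<noteq> 0" using Q by auto
  have \<kappa>: "\<kappa> \<noteq> 0" using p P Q by (simp add: \<kappa>_def)
  define k where "k = \<kappa> / \<alpha>"
  have k: "k \<noteq> 0" using \<kappa> \<alpha> by (simp add: k_def)
  define a where "a = pure_form p g k"
  have deg_m: "degree (T * Q) = degree Q + 1"
    using \<open>Q \<noteq> 0\<close> by (simp add: degree_mult_eq)
  have "\<exists>\<epsilon>>0. \<forall>\<tau>. N \<tau> < \<epsilon> \<longrightarrow> (\<exists>x w. 2 * (T * Q) * x + qform a 5 w + [:\<tau>:] * x\<^sup>2 = [:\<kappa>:] * P * Q)"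
  proof (rule newton_perturbation)
    show "0 < degree (T * Q)" by (simp only: deg_m)
    show "degree (a i) \<le> 1" if "i < 5" for i
      using that by (auto simp: a_def pure_form_def less_5_iff)
    show "degree ([:\<kappa>:] * P * Q) \<le> 2 * degree (T * Q)"
      unfolding deg_m using deg degree_mult_le[of "[:\<kappa>:] * P" Q] degree_smult_le[of \<kappa> P] by simp
    show "smoothly_represents a 5 ([:\<kappa>:] * P * Q) (T * Q)"
      unfolding a_def \<kappa>_def by (rule pure_form_represents[OF p g k P Q])
  qed
  then obtain \<epsilon> where \<epsilon>: "\<epsilon> > 0"
      "\<And>\<tau>. N \<tau> < \<epsilon> \<Longrightarrow> \<exists>x w. 2 * (T * Q) * x + qform a 5 w + [:\<tau>:] * x\<^sup>2 = [:\<kappa>:] * P * Q"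
    by blast
  show ?thesis
  \<comment> \<open>The perturbation parameter is \<open>\<sigma>\<^sup>2\<close>; the cap at 1
    ensures \<open>N (\<sigma>\<^sup>2) \<le> N \<sigma>\<close>.\<close>
  proof (intro exI[of _ "min \<epsilon> 1"] conjI allI impI)
    show "0 < min \<epsilon> 1" using \<epsilon>(1) by simp
    fix \<sigma> :: 'a assume \<sigma>: "\<sigma> \<noteq> 0" "N \<sigma> < min \<epsilon> 1"
    have "N (\<sigma>\<^sup>2) \<le> N \<sigma>"
      using \<sigma>(2) mult_left_le[of "N \<sigma>" "N \<sigma>"] by (simp add: power2_eq_square mult)
    then have "N (\<sigma>\<^sup>2) < \<epsilon>" using \<sigma>(2) by simp
    then obtain x w where xw: "2 * (T * Q) * x + qform a 5 w + [:\<sigma>\<^sup>2:] * x\<^sup>2 = [:\<kappa>:] * P * Q"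
      using \<epsilon>(2) by blast
    \<comment> \<open>Multiplication by a constant quaternion of this norm undoes the rescaling that
      made \<open>m\<^sup>2\<close> the leading term.\<close>
    obtain y0 y1 y2 y3 where y: "quat_norm p g y0 y1 y2 y3 = \<alpha> / (\<kappa> * \<sigma>\<^sup>2)"
      using quat_norm_universal[OF aniso] by blast
    define s where "s = [:\<sigma>:]"
    define L where "L = [:1 / (\<kappa> * \<sigma>\<^sup>2):]"
    have s2: "[:\<sigma>\<^sup>2:] = s\<^sup>2" by (simp add: s_def power2_eq_square)
    have L: "L * [:\<kappa>:] * s\<^sup>2 = 1"
      using \<kappa> \<sigma>(1) by (simp add: L_def s_def power2_eq_square one_pCons)
    have k': "[:\<alpha>:] * [:k:] = [:\<kappa>:]" using \<alpha> by (simp add: k_def)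
    have qa: "qform a 5 w = [:p:] * (w 0)\<^sup>2 - [:g:] * ((w 1)\<^sup>2 + [:p:] * (w 2)\<^sup>2)
        - [:k:] * T * ((w 3)\<^sup>2 + [:p:] * (w 4)\<^sup>2)"
      unfolding qform_5 a_def pure_form_def by (simp add: algebra_simps smult_add_right)
    have "quat_norm [:p:] [:g:] (T * Q + s\<^sup>2 * x) (s * w 0) (s * w 1) (s * w 2)
        = (T * Q)\<^sup>2 + s\<^sup>2 * (2 * (T * Q) * x + qform a 5 w + s\<^sup>2 * x\<^sup>2)
          + s\<^sup>2 * ([:k:] * T * ((w 3)\<^sup>2 + [:p:] * (w 4)\<^sup>2))"
      unfolding quat_norm_def qa by algebra
    also have "\<dots> = (T * Q)\<^sup>2 + s\<^sup>2 * ([:\<kappa>:] * P * Q) + s\<^sup>2 * ([:k:] * T * ((w 3)\<^sup>2 + [:p:] * (w 4)\<^sup>2))"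
      using xw unfolding s2 by simp
    finally have norm: "quat_norm [:p:] [:g:] (T * Q + s\<^sup>2 * x) (s * w 0) (s * w 1) (s * w 2) = \<dots>" .
    have "quat_norm [:p:] [:g:] [:y0:] [:y1:] [:y2:] [:y3:] = [:quat_norm p g y0 y1 y2 y3:]"
      by (simp add: quat_norm_def power2_eq_square)
    then have norm_y: "quat_norm [:p:] [:g:] [:y0:] [:y1:] [:y2:] [:y3:] = [:\<alpha>:] * L"
      by (simp add: y L_def)
    have "([:\<alpha>:] * L) * ((T * Q)\<^sup>2 + s\<^sup>2 * ([:\<kappa>:] * P * Q) + s\<^sup>2 * ([:k:] * T * ((w 3)\<^sup>2 + [:p:] * (w 4)\<^sup>2)))
        = [:\<alpha>:] * (P * Q + L * T\<^sup>2 * Q\<^sup>2) + T * ((w 3)\<^sup>2 + [:p:] * (w 4)\<^sup>2)"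
      using L k' by algebra
    then have "quat_norm [:p:] [:g:] [:y0:] [:y1:] [:y2:] [:y3:]
          * quat_norm [:p:] [:g:] (T * Q + s\<^sup>2 * x) (s * w 0) (s * w 1) (s * w 2)
        = [:\<alpha>:] * (P * Q + [:1 / (\<kappa> * \<sigma>\<^sup>2):] * T\<^sup>2 * Q\<^sup>2) + T * ((w 3)\<^sup>2 + [:p:] * (w 4)\<^sup>2)"
      unfolding norm norm_y L_def .
    then show "\<exists>x0 x1 x2 x3 A B. quat_norm [:p:] [:g:] x0 x1 x2 x3 =
        [:\<alpha>:] * (P * Q + [:1 / (\<kappa> * \<sigma>\<^sup>2):] * T\<^sup>2 * Q\<^sup>2) + T * (A\<^sup>2 + [:p:] * B\<^sup>2)"
      unfolding quat_norm_mult by blast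
  qed
qed

end

section \<open>From norm equations to isotropic forms\<close>

lemma isotropic_if_quat_norm:
  fixes p g F :: "'k::field"
  assumes "z \<noteq> 0" and "quat_norm p g x0 x1 x2 x3 = F * z\<^sup>2 + t * (A\<^sup>2 + p * B\<^sup>2)"
  shows "isotropic ([1, p] \<otimes>\<^sub>q [1, - g, - t, - F])"
proof -
  \<comment> \<open>The entries 1, \<open>- g\<close>, \<open>- t\<close>, \<open>- F\<close> are
    followed by their multiples by \<open>p\<close>. The coordinate of \<open>- p F\<close> is set
    to 0, and \<open>z\<close> makes the vector nonzero.\<close>
  have "diag_form ([1, p] \<otimes>\<^sub>q [1, - g, - t, - F]) [x0, x2, A, z, x1, x3, B, 0] = 0"
    using assms(2)
    by (simp add: diag_form_def form_tensor_def quat_norm_def eval_nat_numeral algebra_simps)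
  then show ?thesis
    unfolding isotropic_def using assms(1)
    by (intro exI[of _ "[x0, x2, A, z, x1, x3, B, 0]"] conjI) (auto simp: form_tensor_def)
qed

lemma to_fract_quat_norm:
  "to_fract (quat_norm p g x0 x1 x2 x3) =
   quat_norm (to_fract p) (to_fract g) (to_fract x0) (to_fract x1) (to_fract x2) (to_fract x3)"
  by (simp add: quat_norm_def power2_eq_square)

text \<open>Numerator and denominator vanish to the same order at zero, so the powers of
  \<open>t\<close> cancel.\<close>

lemma normalized_fraction_at_0:
  fixes h :: "'a::field poly fract"
  assumes "val_t h = Fin 0"
  obtains P Q where "h = Fract P Q" "poly P 0 \<noteq> 0" "poly Q 0 \<noteq> 0"
proof -
  obtain P0 Q0 where h: "h = Fract P0 Q0" "Q0 \<noteq> 0"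
    by (cases h) auto
  have P0: "P0 \<noteq> 0" and ord: "order 0 P0 = order 0 Q0"
    using assms val_t_Fract[OF h(2), of P0] unfolding h(1) by (auto split: if_splits)
  obtain P where P: "P0 = [:- 0, 1:] ^ order 0 P0 * P" "\<not> [:- 0, 1:] dvd P"
    using order_decomp[OF P0] by blast
  obtain Q where Q: "Q0 = [:- 0, 1:] ^ order 0 Q0 * Q" "\<not> [:- 0, 1:] dvd Q"
    using order_decomp[OF h(2)] by blast
  have "Q \<noteq> 0" using Q by auto
  have "P0 * Q = P * Q0"
    by (subst P(1), subst Q(1)) (simp add: ord mult_ac)
  then have "h = Fract P Q"
    unfolding h(1) using h(2) \<open>Q \<noteq> 0\<close> by (simp add: eq_fract)
  then show ?thesis
    using that P(2) Q(2) by (simp add: poly_eq_0_iff_dvd)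
qed

theorem theorem5p2:
  fixes p :: nat and N :: "'a::field_char_0 \<Rightarrow> real" and \<pi> \<gamma> :: 'a
    and h :: "'a poly fract"
  assumes "padic_field p N"
    and "uniformizer N \<pi>"
    and "\<gamma> \<noteq> 0"
    and "anisotropic ([1, \<pi>] \<otimes>\<^sub>q [1, - \<gamma>])"
    and "val_inf h \<ge> Fin (- 2)"
    and "val_t h = Fin 0"
  shows "\<exists>c::'a. \<exists>f. f = h + ratf_const c * ratf_t\<^sup>2 \<and>
           isotropic ([1, ratf_const \<pi>] \<otimes>\<^sub>q [1, - ratf_const \<gamma>, - ratf_t, - f]) \<and>
           isotropic ([1, ratf_const \<pi>] \<otimes>\<^sub>q [1, - ratf_const \<gamma>, - ratf_t, - (ratf_const \<gamma> * f)])"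
proof -
  interpret complete_valued_field N
    by (rule padic_field_complete_valued_field[OF assms(1)])
  have \<pi>: "\<pi> \<noteq> 0"
  proof
    assume "\<pi> = 0"
    then have "isotropic ([1, \<pi>] \<otimes>\<^sub>q [1, - \<gamma>])"
      unfolding isotropic_def
      by (intro exI[of _ "[0, 0, 1, 0]"]) (simp add: form_tensor_def diag_form_def eval_nat_numeral)
    then show False using assms(4) by blast
  qed
  obtain P Q where h: "h = Fract P Q" and P: "poly P 0 \<noteq> 0" and Q: "poly Q 0 \<noteq> 0"
    using normalized_fraction_at_0[OF assms(6)] by blast
  have nz: "P \<noteq> 0" "Q \<noteq> 0" using P Q by auto
  have deg: "degree P \<le> degree Q + 2"
    using assms(5) nz unfolding h by (simp add: val_inf_Fract)
  define \<kappa> where "\<kappa> = \<pi> * (poly P 0 / poly Q 0)"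
  obtain \<epsilon>1 where \<epsilon>1: "\<epsilon>1 > 0" "\<And>\<sigma>. \<sigma> \<noteq> 0 \<Longrightarrow> N \<sigma> < \<epsilon>1 \<Longrightarrow> \<exists>x0 x1 x2 x3 A B.
      quat_norm [:\<pi>:] [:\<gamma>:] x0 x1 x2 x3 =
        [:1:] * (P * Q + [:1 / (\<kappa> * \<sigma>\<^sup>2):] * T\<^sup>2 * Q\<^sup>2) + T * (A\<^sup>2 + [:\<pi>:] * B\<^sup>2)"
    using quat_norm_approximation[OF assms(4) \<pi> assms(3) one_neq_zero P Q deg] unfolding \<kappa>_def by blast
  obtain \<epsilon>2 where \<epsilon>2: "\<epsilon>2 > 0" "\<And>\<sigma>. \<sigma> \<noteq> 0 \<Longrightarrow> N \<sigma> < \<epsilon>2 \<Longrightarrow> \<exists>x0 x1 x2 x3 A B.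
      quat_norm [:\<pi>:] [:\<gamma>:] x0 x1 x2 x3 =
        [:\<gamma>:] * (P * Q + [:1 / (\<kappa> * \<sigma>\<^sup>2):] * T\<^sup>2 * Q\<^sup>2) + T * (A\<^sup>2 + [:\<pi>:] * B\<^sup>2)"
    using quat_norm_approximation[OF assms(4) \<pi> assms(3) assms(3) P Q deg] unfolding \<kappa>_def by blast
  obtain z where z: "0 < N z" "N z < 1" using nontrivial by blast
  obtain n where n: "N z ^ n < min \<epsilon>1 \<epsilon>2"
    using real_arch_pow_inv[of "min \<epsilon>1 \<epsilon>2" "N z"] \<epsilon>1(1) \<epsilon>2(1) z(2) by auto
  \<comment> \<open>One constant below both bounds, so that the same \<open>c\<close> works for
    \<open>\<alpha> = 1\<close> and \<open>\<alpha> = \<gamma>\<close>.\<close>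
  define \<sigma> where "\<sigma> = z ^ n"
  have \<sigma>: "\<sigma> \<noteq> 0" "N \<sigma> < \<epsilon>1" "N \<sigma> < \<epsilon>2"
    using z(1) n by (auto simp: \<sigma>_def power pos_iff)
  define c where "c = 1 / (\<kappa> * \<sigma>\<^sup>2)"
  define f where "f = h + ratf_const c * ratf_t\<^sup>2"
  have const: "ratf_const x = to_fract [:x:]" for x :: 'a
    by (simp add: ratf_const_def to_fract_def)
  have t: "ratf_t = to_fract T"
    by (simp add: ratf_t_def to_fract_def)
  have hQ: "h * to_fract Q = to_fract P"
    using nz by (simp add: h to_fract_def eq_fract)
  \<comment> \<open>Clearing denominators by \<open>Q\<^sup>2\<close> only rescales a square
    variable, so \<open>Q\<close> can serve as the coordinate \<open>z\<close> of
    \<open>isotropic_if_quat_norm\<close>.\<close>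
  have "f * (to_fract Q)\<^sup>2 = (h * to_fract Q) * to_fract Q
      + to_fract [:c:] * (to_fract T * to_fract T) * (to_fract Q * to_fract Q)"
    unfolding f_def const t by (simp add: power2_eq_square algebra_simps)
  then have fQ: "f * (to_fract Q)\<^sup>2 = to_fract (P * Q + [:c:] * T\<^sup>2 * Q\<^sup>2)"
    unfolding hQ by (simp only: power2_eq_square to_fract_add to_fract_mult)
  have iso: "isotropic ([1, ratf_const \<pi>] \<otimes>\<^sub>q [1, - ratf_const \<gamma>, - ratf_t, - (ratf_const \<alpha> * f)])"
    if "quat_norm [:\<pi>:] [:\<gamma>:] x0 x1 x2 x3 =
        [:\<alpha>:] * (P * Q + [:c:] * T\<^sup>2 * Q\<^sup>2) + T * (A\<^sup>2 + [:\<pi>:] * B\<^sup>2)" for \<alpha> x0 x1 x2 x3 A B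
  proof (rule isotropic_if_quat_norm)
    show "to_fract Q \<noteq> 0" using nz by simp
    show "quat_norm (ratf_const \<pi>) (ratf_const \<gamma>) (to_fract x0) (to_fract x1) (to_fract x2) (to_fract x3) =
        ratf_const \<alpha> * f * (to_fract Q)\<^sup>2
        + ratf_t * ((to_fract A)\<^sup>2 + ratf_const \<pi> * (to_fract B)\<^sup>2)"
      unfolding mult.assoc fQ const t to_fract_quat_norm[symmetric] that
      by (simp add: power2_eq_square del: mult_pCons_left)
  qed
  have "isotropic ([1, ratf_const \<pi>] \<otimes>\<^sub>q [1, - ratf_const \<gamma>, - ratf_t, - (ratf_const 1 * f)])"
    using \<epsilon>1(2)[OF \<sigma>(1,2)] iso unfolding c_def by blast
  moreover have "ratf_const 1 = (1 :: 'a poly fract)"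
    by (simp add: const flip: one_pCons)
  moreover have "isotropic ([1, ratf_const \<pi>] \<otimes>\<^sub>q [1, - ratf_const \<gamma>, - ratf_t, - (ratf_const \<gamma> * f)])"
    using \<epsilon>2(2)[OF \<sigma>(1,3)] iso unfolding c_def by blast
  ultimately show ?thesis
    using f_def by auto
qed

end
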